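(* Let $d\ge 1$ and let $c\in L^\infty(\mathbb{H}^d)$ be real-valued. For $\tau\ge 0$ and $\psi\in\mathcal{S}(\mathbb{H}^d)$ put $$[S(\tau)\psi](z,s):=\int_{\mathbb{R}^{2d}}\psi\big(z+\sqrt{\tau}\,\zeta,\;s+\sqrt{\tau}\,z\cdot_\sigma\zeta\big)\,\mathrm{d}\mu_G(\zeta)+\tau\,c(z,s)\,\psi(z,s),\qquad (z,s)\in\mathbb{R}^{2d}\times\mathbb{R}.$$ Then, for every $\tau\ge 0$, $S(\tau)$ extends to a linear and continuous operator on $L^2(\mathbb{H}^d)$ (still denoted $S(\tau)$). Furthermore, $$\lim_{n\to\infty}\sup_{\tau\in[0,\tau_0]}\big\|S(\tau/n)^n\psi-e^{\tau L_c}\psi\big\|_{L^2(\mathbb{H}^d)}=0$$ for all $\psi\in L^2(\mathbb{H}^d)$ and all $\tau_0>0$, where $L_c=\frac{L}{2}+c$.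
   Context: The Heisenberg group is $\mathbb{H}^d=\mathbb{R}^{2d}\times\mathbb{R}$ with points $(z,s)=(x,y,s)$, $x,y\in\mathbb{R}^d$, $s\in\mathbb{R}$, and group law $(x,y,s)\cdot(x',y',s')=(x+x',y+y',s+s'+x'y-xy')$. For $z=(x,y)$ and $z'=(x',y')$ in $\mathbb{R}^{2d}$, $z\cdot_\sigma z':=x'y-xy'$ (Euclidean scalar products in $\mathbb{R}^d$). $L^2(\mathbb{H}^d)=L^2(\mathbb{R}^{2d+1})$ with respect to Lebesgue measure, $\mathcal{S}(\mathbb{H}^d)=\mathcal{S}(\mathbb{R}^{2d+1})$ is the Schwartz space. $\mathrm{d}\mu_G(\zeta)=(2\pi)^{-d}e^{-|\zeta|^2/2}\,\mathrm{d}^{2d}\zeta$ is the standard Gaussian measure on $\mathbb{R}^{2d}$. Let $X_i=\partial_{x^i}+y^i\partial_s$, $Y_i=\partial_{y^i}-x^i\partial_s$, $i=1,\dots,d$, and $L_0=\sum_{i=1}^d(X_i^2+Y_i^2)$ on $C_c^\infty(\mathbb{H}^d)$. $L_0$ is essentially self-adjoint in $L^2(\mathbb{H}^d)$, and $L=\overline{L_0}$ denotes its self-adjoint closure, with domain $D(L)$. $L_c=\frac{L}{2}+c$ has domain $D(L)$, where $c$ acts as a multiplication operator; it is self-adjoint, and $e^{tL_c}$, $t\ge 0$, denotes the strongly continuous semigroup it generates on $L^2(\mathbb{H}^d)$. $S(\tau/n)^n$ is the composition of $n$ copies of $S(\tau/n)$. *)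

theory Defs
  imports "HOL-Analysis.Analysis"
begin

definition square_integrable :: "('a::euclidean_space \<Rightarrow> complex) \<Rightarrow> bool" where
  "square_integrable f \<longleftrightarrow>
     f \<in> borel_measurable lebesgue \<and> integrable lebesgue (\<lambda>x. (norm (f x))\<^sup>2)"

lemma square_integrable_measurable [measurable_dest]:
  "square_integrable f \<Longrightarrow> f \<in> borel_measurable lebesgue"
  by (simp add: square_integrable_def)

lemma square_integrable_zero: "square_integrable (\<lambda>x. 0)"
  by (simp add: square_integrable_def)

lemma square_integrable_add:
  assumes "square_integrable f" "square_integrable g"
  shows "square_integrable (\<lambda>x. f x + g x)"
proof -
  have [measurable]: "f \<in> borel_measurable lebesgue" "g \<in> borel_measurable lebesgue"
    using assms by (auto simp: square_integrable_def)
  have "integrable lebesgue (\<lambda>x. 2 * (norm (f x))\<^sup>2 + 2 * (norm (g x))\<^sup>2)"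
    using assms by (auto simp: square_integrable_def)
  moreover have "(norm (f x + g x))\<^sup>2 \<le> 2 * (norm (f x))\<^sup>2 + 2 * (norm (g x))\<^sup>2" for x
  proof -
    have "(norm (f x + g x))\<^sup>2 \<le> (norm (f x) + norm (g x))\<^sup>2"
      by (simp add: norm_triangle_ineq power_mono)
    also have "\<dots> \<le> 2 * (norm (f x))\<^sup>2 + 2 * (norm (g x))\<^sup>2"
      using sum_squares_bound [of "norm (f x)" "norm (g x)"]
      by (simp add: power2_sum)
    finally show ?thesis .
  qed
  ultimately have "integrable lebesgue (\<lambda>x. (norm (f x + g x))\<^sup>2)"
    by (elim Bochner_Integration.integrable_bound) (auto intro!: AE_I2)
  then show ?thesis
    by (simp add: square_integrable_def)
qed

lemma square_integrable_mult:
  assumes "square_integrable f"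
  shows "square_integrable (\<lambda>x. a * f x)"
  using assms by (auto simp: square_integrable_def norm_mult power_mult_distrib)

lemma square_integrable_scaleR:
  "square_integrable f \<Longrightarrow> square_integrable (\<lambda>x. r *\<^sub>R f x)"
  unfolding scaleR_conv_of_real by (rule square_integrable_mult)

lemma square_integrable_uminus:
  "square_integrable f \<Longrightarrow> square_integrable (\<lambda>x. - f x)"
  by (simp add: square_integrable_def)

lemma square_integrable_diff:
  "square_integrable f \<Longrightarrow> square_integrable g \<Longrightarrow> square_integrable (\<lambda>x. f x - g x)"
  using square_integrable_add [of f "\<lambda>x. - g x"] square_integrable_uminus [of g] by simp

lemma square_integrable_inner:
  assumes "square_integrable f" "square_integrable g"
  shows "integrable lebesgue (\<lambda>x. f x \<bullet> g x)"
proof -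
  have [measurable]: "f \<in> borel_measurable lebesgue" "g \<in> borel_measurable lebesgue"
    using assms by (auto simp: square_integrable_def)
  have "integrable lebesgue (\<lambda>x. (norm (f x))\<^sup>2 + (norm (g x))\<^sup>2)"
    using assms by (auto simp: square_integrable_def)
  moreover have "\<bar>f x \<bullet> g x\<bar> \<le> (norm (f x))\<^sup>2 + (norm (g x))\<^sup>2" for x
  proof -
    have "\<bar>f x \<bullet> g x\<bar> \<le> norm (f x) * norm (g x)"
      by (rule Cauchy_Schwarz_ineq2)
    also have "\<dots> \<le> (norm (f x))\<^sup>2 + (norm (g x))\<^sup>2"
      using sum_squares_bound [of "norm (f x)" "norm (g x)"]
        mult_nonneg_nonneg [OF norm_ge_zero [of "f x"] norm_ge_zero [of "g x"]]
      by linarith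
    finally show ?thesis .
  qed
  ultimately show ?thesis
    by (elim Bochner_Integration.integrable_bound) (auto intro!: AE_I2)
qed

definition L2_rel :: "('a::euclidean_space \<Rightarrow> complex) \<Rightarrow> ('a \<Rightarrow> complex) \<Rightarrow> bool" where
  "L2_rel f g \<longleftrightarrow>
     square_integrable f \<and> square_integrable g \<and> (AE x in lebesgue. f x = g x)"

text \<open>
  Classes of square-integrable functions modulo equality almost everywhere.
  \<open>L2_class f\<close> is the class of \<open>f\<close>; it is meaningful only if \<open>square_integrable f\<close> holds.
\<close>

quotient_type (overloaded) 'a L2 = "'a::euclidean_space \<Rightarrow> complex" / partial: L2_rel
  morphisms L2_rep L2_class
proof (rule part_equivpI)
  show "\<exists>f. L2_rel f f"
    using square_integrable_zero by (auto simp: L2_rel_def)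
  show "symp L2_rel"
    by (auto simp: symp_def L2_rel_def elim: AE_mp)
  show "transp L2_rel"
    unfolding transp_def L2_rel_def by (auto elim!: AE_mp)
qed

instantiation L2 :: (euclidean_space) real_vector
begin

lift_definition zero_L2 :: "'a L2" is "\<lambda>x. 0"
  by (simp add: L2_rel_def square_integrable_zero)

lift_definition plus_L2 :: "'a L2 \<Rightarrow> 'a L2 \<Rightarrow> 'a L2" is "\<lambda>f g x. f x + g x"
  unfolding L2_rel_def by (auto intro: square_integrable_add elim!: AE_mp)

lift_definition minus_L2 :: "'a L2 \<Rightarrow> 'a L2 \<Rightarrow> 'a L2" is "\<lambda>f g x. f x - g x"
  unfolding L2_rel_def by (auto intro: square_integrable_diff elim!: AE_mp)

lift_definition uminus_L2 :: "'a L2 \<Rightarrow> 'a L2" is "\<lambda>f x. - f x"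
  unfolding L2_rel_def by (auto intro: square_integrable_uminus elim!: AE_mp)

lift_definition scaleR_L2 :: "real \<Rightarrow> 'a L2 \<Rightarrow> 'a L2" is "\<lambda>r f x. r *\<^sub>R f x"
  unfolding L2_rel_def by (auto intro: square_integrable_scaleR elim!: AE_mp)

instance
  by standard
    (transfer, simp add: L2_rel_def algebra_simps square_integrable_add square_integrable_diff
      square_integrable_uminus square_integrable_scaleR square_integrable_zero)+

end

instantiation L2 :: (euclidean_space) real_inner
begin

lift_definition inner_L2 :: "'a L2 \<Rightarrow> 'a L2 \<Rightarrow> real" is
  "\<lambda>f g. LINT x|lebesgue. f x \<bullet> g x"
  unfolding L2_rel_def
  by (intro integral_cong_AE) (auto simp: square_integrable_def elim!: AE_mp)

lift_definition norm_L2 :: "'a L2 \<Rightarrow> real" is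
  "\<lambda>f. sqrt (LINT x|lebesgue. (norm (f x))\<^sup>2)"
  unfolding L2_rel_def
  by (intro arg_cong [where f = sqrt] integral_cong_AE)
    (auto simp: square_integrable_def elim!: AE_mp)

definition dist_L2 :: "'a L2 \<Rightarrow> 'a L2 \<Rightarrow> real" where
  "dist_L2 u v = norm (u - v)"

definition sgn_L2 :: "'a L2 \<Rightarrow> 'a L2" where
  "sgn_L2 u = u /\<^sub>R norm u"

definition uniformity_L2 :: "('a L2 \<times> 'a L2) filter" where
  "uniformity_L2 = (INF e\<in>{0<..}. principal {(u, v). dist u v < e})"

definition open_L2 :: "'a L2 set \<Rightarrow> bool" where
  "open_L2 U \<longleftrightarrow> (\<forall>u\<in>U. eventually (\<lambda>(u', v). u' = u \<longrightarrow> v \<in> U) uniformity)"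

instance
proof
  fix u v w :: "'a L2" and r :: real
  show "dist u v = norm (u - v)" by (rule dist_L2_def)
  show "sgn u = u /\<^sub>R norm u" by (rule sgn_L2_def)
  show "uniformity = (INF e\<in>{0<..}. principal {(u, v::'a L2). dist u v < e})"
    by (rule uniformity_L2_def)
  show "open U \<longleftrightarrow> (\<forall>u\<in>U. eventually (\<lambda>(u', v). u' = u \<longrightarrow> v \<in> U) uniformity)"
    for U :: "'a L2 set"
    by (rule open_L2_def)
  show "inner u v = inner v u"
    by transfer (simp add: inner_commute)
  show "inner (u + v) w = inner u w + inner v w"
    by transfer (simp add: L2_rel_def inner_add_left square_integrable_inner)
  show "inner (r *\<^sub>R u) v = r * inner u v"
    by transfer simp
  show "0 \<le> inner u u"
    by transfer simp
  show "inner u u = 0 \<longleftrightarrow> u = 0"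
  proof transfer
    fix f :: "'a \<Rightarrow> complex"
    assume "L2_rel f f"
    then have f: "square_integrable f" by (simp add: L2_rel_def)
    then have "(LINT x|lebesgue. f x \<bullet> f x) = 0 \<longleftrightarrow> (AE x in lebesgue. f x \<bullet> f x = 0)"
      by (intro integral_nonneg_eq_0_iff_AE square_integrable_inner) auto
    then show "(LINT x|lebesgue. f x \<bullet> f x) = 0 \<longleftrightarrow> L2_rel f (\<lambda>x. 0)"
      using f square_integrable_zero [where 'a = 'a] by (simp add: L2_rel_def)
  qed
  show "norm u = sqrt (inner u u)"
    by transfer (simp add: power2_norm_eq_inner)
qed

end

lift_definition scaleC_L2 :: "complex \<Rightarrow> 'a::euclidean_space L2 \<Rightarrow> 'a L2" is "\<lambda>a f x. a * f x"
  unfolding L2_rel_def by (auto intro: square_integrable_mult elim!: AE_mp)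

definition bounded_clinear_L2 :: "('a::euclidean_space L2 \<Rightarrow> 'a L2) \<Rightarrow> bool" where
  "bounded_clinear_L2 A \<longleftrightarrow>
     bounded_linear A \<and> (\<forall>a u. A (scaleC_L2 a u) = scaleC_L2 a (A u))"

definition essentially_bounded :: "('a::euclidean_space \<Rightarrow> real) \<Rightarrow> bool" where
  "essentially_bounded c \<longleftrightarrow>
     c \<in> borel_measurable lebesgue \<and> (\<exists>C. AE x in lebesgue. \<bar>c x\<bar> \<le> C)"

definition mult_L2 :: "('a::euclidean_space \<Rightarrow> real) \<Rightarrow> 'a L2 \<Rightarrow> 'a L2" where
  "mult_L2 c u = L2_class (\<lambda>x. c x *\<^sub>R L2_rep u x)"

fun iterated_partial ::
  "'a::euclidean_space list \<Rightarrow> ('a \<Rightarrow> complex) \<Rightarrow> 'a \<Rightarrow> complex" where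
  "iterated_partial [] f = f"
| "iterated_partial (b # bs) f = (\<lambda>x. frechet_derivative (iterated_partial bs f) (at x) b)"

text \<open>
  Differentiability of all iterated partial derivatives includes their continuity,
  so this is the class of infinitely often continuously differentiable functions.
\<close>

definition smooth :: "('a::euclidean_space \<Rightarrow> complex) \<Rightarrow> bool" where
  "smooth f \<longleftrightarrow>
     (\<forall>bs. set bs \<subseteq> Basis \<longrightarrow> (\<forall>x. iterated_partial bs f differentiable (at x)))"

definition schwartz :: "('a::euclidean_space \<Rightarrow> complex) \<Rightarrow> bool" where
  "schwartz f \<longleftrightarrow> smooth f \<and>
     (\<forall>k bs. set bs \<subseteq> Basis \<longrightarrow>
        (\<exists>C. \<forall>x. (1 + norm x) ^ k * norm (iterated_partial bs f x) \<le> C))"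

definition test_function :: "('a::euclidean_space \<Rightarrow> complex) \<Rightarrow> bool" where
  "test_function f \<longleftrightarrow> smooth f \<and> compact (closure {x. f x \<noteq> 0})"

text \<open>
  An unbounded operator is represented by its graph, a set of pairs; the closure of an
  operator is then the topological closure of its graph.
\<close>

definition strongly_continuous_semigroup ::
  "(real \<Rightarrow> 'a::euclidean_space L2 \<Rightarrow> 'a L2) \<Rightarrow> bool" where
  "strongly_continuous_semigroup T \<longleftrightarrow>
     (\<forall>t\<ge>0. bounded_clinear_L2 (T t)) \<and>
     T 0 = id \<and>
     (\<forall>s\<ge>0. \<forall>t\<ge>0. T (s + t) = T s \<circ> T t) \<and>
     (\<forall>u. ((\<lambda>t. T t u) \<longlongrightarrow> u) (at_right 0))"

definition generator ::
  "(real \<Rightarrow> 'a::euclidean_space L2 \<Rightarrow> 'a L2) \<Rightarrow> ('a L2 \<times> 'a L2) set" where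
  "generator T = {(u, v). ((\<lambda>t. (T t u - u) /\<^sub>R t) \<longlongrightarrow> v) (at_right 0)}"

text \<open>Points are written \<open>((x, y), s)\<close>, with \<open>z = (x, y)\<close>.\<close>

type_synonym 'd plane = "(real ^ 'd) \<times> (real ^ 'd)"
type_synonym 'd heis = "'d plane \<times> real"

definition sigma_prod :: "'d::finite plane \<Rightarrow> 'd plane \<Rightarrow> real" (infixl "\<bullet>\<^sub>\<sigma>" 70) where
  "z \<bullet>\<^sub>\<sigma> z' = fst z' \<bullet> snd z - fst z \<bullet> snd z'"

definition partial_x :: "'d::finite \<Rightarrow> ('d heis \<Rightarrow> complex) \<Rightarrow> 'd heis \<Rightarrow> complex" where
  "partial_x i f p = frechet_derivative f (at p) ((axis i 1, 0), 0)"

definition partial_y :: "'d::finite \<Rightarrow> ('d heis \<Rightarrow> complex) \<Rightarrow> 'd heis \<Rightarrow> complex" where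
  "partial_y i f p = frechet_derivative f (at p) ((0, axis i 1), 0)"

definition partial_s :: "('d::finite heis \<Rightarrow> complex) \<Rightarrow> 'd heis \<Rightarrow> complex" where
  "partial_s f p = frechet_derivative f (at p) ((0, 0), 1)"

definition X_field :: "'d::finite \<Rightarrow> ('d heis \<Rightarrow> complex) \<Rightarrow> 'd heis \<Rightarrow> complex" where
  "X_field i f p = partial_x i f p + (snd (fst p) $ i) *\<^sub>R partial_s f p"

definition Y_field :: "'d::finite \<Rightarrow> ('d heis \<Rightarrow> complex) \<Rightarrow> 'd heis \<Rightarrow> complex" where
  "Y_field i f p = partial_y i f p - (fst (fst p) $ i) *\<^sub>R partial_s f p"

definition sublaplacian :: "('d::finite heis \<Rightarrow> complex) \<Rightarrow> 'd heis \<Rightarrow> complex" where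
  "sublaplacian f p = (\<Sum>i\<in>UNIV. X_field i (X_field i f) p + Y_field i (Y_field i f) p)"

definition L0_graph :: "('d::finite heis L2 \<times> 'd heis L2) set" where
  "L0_graph = {(L2_class f, L2_class (sublaplacian f)) | f. test_function f}"

definition L_graph :: "('d::finite heis L2 \<times> 'd heis L2) set" where
  "L_graph = closure L0_graph"

definition Lc_graph :: "('d::finite heis \<Rightarrow> real) \<Rightarrow> ('d heis L2 \<times> 'd heis L2) set" where
  "Lc_graph c = {(u, (1/2) *\<^sub>R v + mult_L2 c u) | u v. (u, v) \<in> L_graph}"

definition gauss :: "'d::finite plane measure" where
  "gauss = density lborel
     (\<lambda>\<zeta>. ennreal (1 / (2 * pi) ^ CARD('d) * exp (- (norm \<zeta>)\<^sup>2 / 2)))"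

definition S_pre ::
  "('d::finite heis \<Rightarrow> real) \<Rightarrow> real \<Rightarrow> ('d heis \<Rightarrow> complex) \<Rightarrow> 'd heis \<Rightarrow> complex" where
  "S_pre c \<tau> \<psi> = (\<lambda>(z, s).
     (LINT \<zeta>|gauss. \<psi> (z + sqrt \<tau> *\<^sub>R \<zeta>, s + sqrt \<tau> * (z \<bullet>\<^sub>\<sigma> \<zeta>))) + (\<tau> * c (z, s)) *\<^sub>R \<psi> (z, s))"

definition is_L2_extension ::
  "(('a::euclidean_space \<Rightarrow> complex) \<Rightarrow> 'a \<Rightarrow> complex) \<Rightarrow> ('a L2 \<Rightarrow> 'a L2) \<Rightarrow> bool" where
  "is_L2_extension S0 S \<longleftrightarrow> bounded_clinear_L2 S \<and>
     (\<forall>\<psi>. schwartz \<psi> \<longrightarrow> square_integrable (S0 \<psi>) \<and> S (L2_class \<psi>) = L2_class (S0 \<psi>))"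

definition S_op :: "('d::finite heis \<Rightarrow> real) \<Rightarrow> real \<Rightarrow> 'd heis L2 \<Rightarrow> 'd heis L2" where
  "S_op c \<tau> = (THE S. is_L2_extension (S_pre c \<tau>) S)"

end

theory Submission
  imports Defs "HOL-Probability.Sinc_Integral"
begin

text \<open>
  The statement is an instance of Chernoff's principle: a family of one-step operators that is
  stable and consistent with a generator on a core approximates the semigroup. Stability is
  the bound \<open>\<parallel>S(\<tau>)\<parallel> \<le> 1 + C \<tau>\<close>; consistency is the convergence of \<open>(S(\<tau>) f - f) / \<tau>\<close>
  to \<open>L f / 2 + c f\<close> for test functions \<open>f\<close>.

  From consistency to convergence. The orbit \<open>t \<mapsto> T(t) u\<close> of a vector in the domain of the
  generator solves the evolution equation, but it leaves the set of test functions, and no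
  estimate of \<open>(S(\<tau>) - 1) / \<tau>\<close> in the graph norm is available. The orbit is therefore replaced by a
  polygonal path whose vertices lie in the core and are close, in the graph norm, to the orbit at
  the nodes of a fixed time grid. Finitely many vertices make the consistency uniform along the
  path, and the path solves the evolution equation up to an error that is small compared with
  the step, so telescoping gives convergence (\<open>convergence_on_domain\<close>, \<open>product_formula\<close>). This
  uses that the semigroup is bounded on bounded time intervals, which follows from the uniform
  boundedness principle and hence from the completeness of \<open>L\<^sup>2\<close>.

  The one-step operators. The Gaussian average in \<open>S(\<tau>)\<close> runs over right translations by horizontal
  group elements, and each of these preserves Lebesgue measure. By Jensen's inequality the average
  is a contraction of \<open>L\<^sup>2\<close> (\<open>gauss_mean_contraction\<close>), so the integral formula itself, applied to a
  Borel representative, defines the extension. It is unique because test functions span a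
  dense subspace (\<open>test_functions_total\<close>).

  Consistency. The translated point is \<open>p + r v\<close> with \<open>r = \<surd>\<tau>\<close> and a vector \<open>v\<close> that depends linearly
  on the Gaussian variable \<open>\<zeta>\<close> and equals the fields \<open>X\<^sub>i\<close>, \<open>Y\<^sub>i\<close> at \<open>p\<close> when \<open>\<zeta>\<close> is a basis vector.
  In the Taylor expansion in \<open>r\<close> the first-order term has mean zero, and since the covariance of
  \<open>\<zeta>\<close> is the identity the second-order term has mean \<open>(r\<^sup>2 / 2) L f(p)\<close>. The third-order remainder is
  controlled in \<open>L\<^sup>2\<close> because the decay of \<open>f\<close> at the shifted point transfers to \<open>p\<close> at the cost of a
  power of \<open>1 + \<bar>\<zeta>\<bar>\<close>, which is integrable for the Gaussian (\<open>gauss_mean_expansion\<close>).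
\<close>

section \<open>Uniform boundedness\<close>

text \<open>
  By Baire's theorem one of the closed sets on which the family is bounded by a fixed number contains
  a ball; differences of points of this ball cover a ball about the origin.
\<close>

lemma uniform_boundedness:
  fixes F :: "('a::banach \<Rightarrow> 'b::real_normed_vector) set"
  assumes lin: "\<And>f. f \<in> F \<Longrightarrow> bounded_linear f"
    and pointwise: "\<And>x. \<exists>B. \<forall>f\<in>F. norm (f x) \<le> B"
  shows "\<exists>M. \<forall>f\<in>F. \<forall>x. norm (f x) \<le> M * norm x"
proof -
  define A where "A n = {x. \<forall>f\<in>F. norm (f x) \<le> real n}" for n
  have A_closed: "closed (A n)" for n
  proof -
    have "A n = (\<Inter>f\<in>F. {x. norm (f x) \<le> real n})"
      by (auto simp: A_def)
    also have "closed \<dots>"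
      by (intro closed_INT ballI closed_Collect_le continuous_on_norm continuous_on_const
          linear_continuous_on lin)
    finally show ?thesis .
  qed
  have "(\<Union>n. A n) = UNIV"
  proof -
    have "x \<in> (\<Union>n. A n)" for x
    proof -
      obtain B where B: "\<forall>f\<in>F. norm (f x) \<le> B" using pointwise by blast
      obtain n where "B \<le> real n" using real_arch_simple by blast
      with B have "x \<in> A n" unfolding A_def by (auto intro: order_trans)
      then show ?thesis by blast
    qed
    then show ?thesis by blast
  qed
  then have "interior (\<Union>(range A)) \<noteq> {}"
    by simp
  then obtain n where "interior (A n) \<noteq> {}"
    using Baire_category_alt[of euclidean "range A"] A_closed
    by (metis closed_closedin completely_metrizable_space_euclidean countable_image countableI_type
        euclidean_interior_of imageE)
  then obtain x0 e where e: "e > 0" "cball x0 e \<subseteq> A n"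
    by (meson ex_in_conv mem_interior_cball)
  have "norm (f x) \<le> (2 * real n / e) * norm x" if f: "f \<in> F" for f x
  proof (cases "x = 0")
    case True
    then show ?thesis using lin[OF f] by (simp add: linear_simps)
  next
    case False
    interpret bounded_linear f by (rule lin[OF f])
    define y where "y = (e / norm x) *\<^sub>R x"
    have "x0 + y \<in> A n" "x0 \<in> A n"
      using e False by (auto simp: y_def dist_norm intro!: subsetD[OF e(2)])
    then have "norm (f (x0 + y)) \<le> n" "norm (f x0) \<le> n"
      using f by (auto simp: A_def)
    moreover have "norm (f y) = norm (f (x0 + y) - f x0)" by (simp add: add)
    ultimately have "norm (f y) \<le> 2 * real n"
      using norm_triangle_ineq4[of "f (x0 + y)" "f x0"] by linarith
    moreover have "norm (f y) = e / norm x * norm (f x)"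
      using e False by (simp add: y_def scaleR)
    ultimately show ?thesis using e False by (simp add: field_simps)
  qed
  then show ?thesis by blast
qed

section \<open>Chernoff's product formula\<close>

text \<open>
  Strong continuity at \<open>0\<close> bounds every orbit near \<open>0\<close>. If the operators were unbounded on every
  interval \<open>[0, \<delta>]\<close>, a sequence of times tending to \<open>0\<close> would violate the uniform boundedness
  principle; the semigroup law then carries the bound to any bounded interval.
\<close>

lemma semigroup_locally_bounded:
  fixes T :: "real \<Rightarrow> 'a::banach \<Rightarrow> 'a"
  assumes lin: "\<And>t. t \<ge> 0 \<Longrightarrow> bounded_linear (T t)"
    and T0: "T 0 = id"
    and semi: "\<And>s t. s \<ge> 0 \<Longrightarrow> t \<ge> 0 \<Longrightarrow> T (s + t) = T s \<circ> T t"
    and cont: "\<And>u. ((\<lambda>t. T t u) \<longlongrightarrow> u) (at_right 0)"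
  obtains M where "M \<ge> 1" "\<And>t u. 0 \<le> t \<Longrightarrow> t \<le> t0 \<Longrightarrow> norm (T t u) \<le> M * norm u"
proof -
  have near: "\<exists>d>0. \<forall>t. 0 \<le> t \<and> t < d \<longrightarrow> norm (T t u - u) < 1" for u
  proof -
    have "\<forall>\<^sub>F t in at_right 0. dist (T t u) u < 1"
      using cont[of u] by (rule tendstoD) simp
    then obtain d where "d > 0" "\<forall>t>0. t < d \<longrightarrow> dist (T t u) u < 1"
      unfolding eventually_at_right_field by auto
    then show ?thesis
      using T0 by (intro exI[of _ d]) (auto simp: dist_norm le_less)
  qed
  have "\<exists>\<delta>>0. \<exists>M. \<forall>t u. 0 \<le> t \<and> t \<le> \<delta> \<longrightarrow> norm (T t u) \<le> M * norm u"
  proof (rule ccontr)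
    assume contra: "\<not> ?thesis"
    have "\<exists>t u. 0 \<le> t \<and> t \<le> 1 / real (Suc n) \<and> norm (T t u) > real n * norm u" for n
    proof -
      have "1 / real (Suc n) > 0" by simp
      with contra show ?thesis by (meson not_less)
    qed
    then obtain t u where t: "\<And>n. 0 \<le> t n" "\<And>n. t n \<le> 1 / real (Suc n)"
      and u: "\<And>n. norm (T (t n) (u n)) > real n * norm (u n)"
      by metis
    have "\<exists>M. \<forall>f\<in>range (\<lambda>n. T (t n)). \<forall>x. norm (f x) \<le> M * norm x"
    proof (rule uniform_boundedness)
      fix f assume "f \<in> range (\<lambda>n. T (t n))"
      then show "bounded_linear f" using lin t by auto
    next
      fix x
      obtain d where d: "d > 0" "\<And>s. 0 \<le> s \<Longrightarrow> s < d \<Longrightarrow> norm (T s x - x) < 1"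
        using near by blast
      obtain m where m: "1 / real (Suc m) < d"
        using nat_approx_posE[OF d(1)] by (metis)
      define B where "B = norm x + 1 + (\<Sum>n<m. norm (T (t n) x))"
      have "norm (T (t n) x) \<le> B" for n
      proof (cases "n < m")
        case True
        then have "norm (T (t n) x) \<le> (\<Sum>n<m. norm (T (t n) x))"
          by (intro member_le_sum) auto
        then show ?thesis by (simp add: B_def add_increasing)
      next
        case False
        then have "1 / real (Suc n) \<le> 1 / real (Suc m)"
          by (intro divide_left_mono) auto
        with t[of n] m have "t n < d" by linarith
        then have "norm (T (t n) x - x) < 1" using d t by blast
        moreover have "norm (T (t n) x) \<le> norm (T (t n) x - x) + norm x"
          by (metis diff_add_cancel norm_triangle_ineq)
        moreover have "0 \<le> (\<Sum>n<m. norm (T (t n) x))"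
          by (intro sum_nonneg) auto
        ultimately show ?thesis by (simp add: B_def)
      qed
      then show "\<exists>B. \<forall>f\<in>range (\<lambda>n. T (t n)). norm (f x) \<le> B" by auto
    qed
    then obtain M where M: "\<And>n x. norm (T (t n) x) \<le> M * norm x" by auto
    obtain n where "M \<le> real n" using real_arch_simple by blast
    then have "M * norm (u n) \<le> real n * norm (u n)" by (rule mult_right_mono) simp
    with M[of n "u n"] u[of n] show False by linarith
  qed
  then obtain \<delta> M0 where \<delta>: "\<delta> > 0"
    and M0: "\<And>t u. 0 \<le> t \<Longrightarrow> t \<le> \<delta> \<Longrightarrow> norm (T t u) \<le> M0 * norm u" by blast
  define M where "M = max 1 M0"
  have M: "norm (T t u) \<le> M * norm u" if "0 \<le> t" "t \<le> \<delta>" for t u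
  proof -
    have "M0 * norm u \<le> M * norm u" by (rule mult_right_mono) (auto simp: M_def)
    with M0[OF that, of u] show ?thesis by linarith
  qed
  have M1: "M \<ge> 1" by (simp add: M_def)
  have pow: "norm (T t u) \<le> M ^ Suc k * norm u" if "0 \<le> t" "t \<le> real (Suc k) * \<delta>" for k t u
    using that
  proof (induction k arbitrary: t u)
    case 0
    then show ?case using M by simp
  next
    case (Suc k)
    show ?case
    proof (cases "t \<le> \<delta>")
      case True
      have "M * norm u \<le> M ^ Suc (Suc k) * norm u"
        using M1 by (intro mult_right_mono) (auto intro: order_trans[OF _ mult_left_mono[of 1]]
            simp: one_le_power)
      with M[of t u] True Suc.prems show ?thesis by linarith
    next
      case False
      then have "T t = T \<delta> \<circ> T (t - \<delta>)"
        using semi[of \<delta> "t - \<delta>"] \<delta> by simp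
      then have "norm (T t u) \<le> M * norm (T (t - \<delta>) u)"
        using M[of \<delta>] \<delta> by simp
      also have "\<dots> \<le> M * (M ^ Suc k * norm u)"
        using Suc.prems False M1
        by (intro mult_left_mono Suc.IH) (auto simp: algebra_simps)
      finally show ?thesis by (simp add: mult_ac)
    qed
  qed
  obtain k where "t0 / \<delta> \<le> real k" using real_arch_simple by blast
  then have k: "t0 \<le> real (Suc k) * \<delta>"
    using \<delta> by (simp add: field_simps)
  show thesis
  proof
    show "M ^ Suc k \<ge> 1" using M1 by (rule one_le_power)
    show "norm (T t u) \<le> M ^ Suc k * norm u" if "0 \<le> t" "t \<le> t0" for t u
      using pow that k by (meson order_trans)
  qed
qed

lemma power_bound_exp:
  fixes C h :: real
  assumes "C \<ge> 0" "h \<ge> 0" "real k * h \<le> t"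
  shows "(1 + C * h) ^ k \<le> exp (C * t)"
proof -
  have "(1 + C * h) ^ k \<le> exp (C * h) ^ k"
    using assms by (intro power_mono exp_ge_add_one_self) auto
  also have "\<dots> = exp (C * (real k * h))"
    by (simp add: exp_of_nat_mult[symmetric] mult_ac)
  also have "\<dots> \<le> exp (C * t)"
    using assms by (simp add: mult_left_mono)
  finally show ?thesis .
qed

lemma norm_iterate_le:
  fixes A :: "'a::real_normed_vector \<Rightarrow> 'a"
  assumes "\<And>u. norm (A u) \<le> q * norm u" "q \<ge> 0"
  shows "norm ((A ^^ k) u) \<le> q ^ k * norm u"
proof (induction k)
  case (Suc k)
  have "norm ((A ^^ Suc k) u) \<le> q * norm ((A ^^ k) u)" using assms(1) by simp
  also have "\<dots> \<le> q * (q ^ k * norm u)" using Suc assms(2) by (rule mult_left_mono)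
  finally show ?case by (simp add: mult_ac)
qed simp

lemma norm_diff_triangle_mono:
  "norm a \<le> r \<Longrightarrow> norm b \<le> s \<Longrightarrow> norm (a - b) \<le> r + s"
  using norm_triangle_ineq4[of a b] by linarith

lemma linear_funpow: "linear (A::'a::real_vector \<Rightarrow> 'a) \<Longrightarrow> linear (A ^^ k)"
  by (induction k) (simp_all add: linear_id linear_compose)

text \<open>
  The telescoping sum behind every stability argument: the local errors \<open>\<epsilon>\<close> are added up, each
  amplified by at most the growth \<open>q ^ n\<close> of the iteration.
\<close>

lemma iterate_consistency:
  fixes A :: "'a::real_normed_vector \<Rightarrow> 'a" and f :: "real \<Rightarrow> 'a"
  assumes lin: "linear A"
    and bound: "\<And>u. norm (A u) \<le> q * norm u" and q: "q \<ge> 1"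
    and h: "h \<ge> 0"
    and step: "\<And>k. k < n \<Longrightarrow> norm (A (f (real k * h)) - f (real (Suc k) * h)) \<le> \<epsilon>"
  shows "norm ((A ^^ n) (f 0) - f (real n * h)) \<le> real n * \<epsilon> * q ^ n"
  using step
proof (induction n)
  case (Suc n)
  have eps: "\<epsilon> \<ge> 0"
    using Suc.prems[of 0] by (meson norm_ge_zero order_trans zero_less_Suc)
  have "norm ((A ^^ Suc n) (f 0) - f (real (Suc n) * h))
      = norm (A ((A ^^ n) (f 0) - f (real n * h)) + (A (f (real n * h)) - f (real (Suc n) * h)))"
    by (simp add: linear_diff[OF lin])
  also have "\<dots> \<le> q * (real n * \<epsilon> * q ^ n) + \<epsilon>"
  proof (intro norm_triangle_mono)
    have "norm (A ((A ^^ n) (f 0) - f (real n * h))) \<le> q * norm ((A ^^ n) (f 0) - f (real n * h))"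
      by (rule bound)
    also have "\<dots> \<le> q * (real n * \<epsilon> * q ^ n)"
      using q Suc by (intro mult_left_mono) auto
    finally show "norm (A ((A ^^ n) (f 0) - f (real n * h))) \<le> q * (real n * \<epsilon> * q ^ n)" .
    show "norm (A (f (real n * h)) - f (real (Suc n) * h)) \<le> \<epsilon>"
      using Suc.prems[of n] by simp
  qed
  also have "\<dots> \<le> real (Suc n) * \<epsilon> * q ^ Suc n"
  proof -
    have "\<epsilon> * 1 \<le> \<epsilon> * q ^ Suc n"
      using eps q by (intro mult_left_mono one_le_power)
    then show ?thesis by (simp add: algebra_simps)
  qed
  finally show ?case .
qed simp

text \<open>
  For a semigroup these pairs are the graph of the generator; for a family of one-step operators
  they say what the family is consistent with.
\<close>

definition difference_limit ::
  "(real \<Rightarrow> 'a::real_normed_vector \<Rightarrow> 'a) \<Rightarrow> 'a \<Rightarrow> 'a \<Rightarrow> bool" where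
  "difference_limit S u v \<longleftrightarrow> ((\<lambda>h. (S h u - u) /\<^sub>R h) \<longlongrightarrow> v) (at_right 0)"

text \<open>
  The assumption \<open>consistent\<close> is consistency on a core: the one-step operators need to be
  consistent with the generator only on a set whose closure in the graph norm contains its graph.
\<close>

locale chernoff =
  fixes S T :: "real \<Rightarrow> 'a::banach \<Rightarrow> 'a" and C :: real
  assumes S_linear: "\<And>h. h \<ge> 0 \<Longrightarrow> bounded_linear (S h)"
    and S_bound: "\<And>h u. h \<ge> 0 \<Longrightarrow> norm (S h u) \<le> (1 + C * h) * norm u"
    and S_0: "S 0 = id"
    and C_nonneg: "C \<ge> 0"
    and T_linear: "\<And>t. t \<ge> 0 \<Longrightarrow> bounded_linear (T t)"
    and T_0: "T 0 = id"
    and T_add: "\<And>s t. s \<ge> 0 \<Longrightarrow> t \<ge> 0 \<Longrightarrow> T (s + t) = T s \<circ> T t"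
    and T_cont: "\<And>u. ((\<lambda>t. T t u) \<longlongrightarrow> u) (at_right 0)"
    and consistent: "\<And>u v. difference_limit T u v \<Longrightarrow>
        (u, v) \<in> closure {(w, w'). difference_limit S w w'}"
    and dense: "closure {u. \<exists>v. difference_limit T u v} = UNIV"
begin

text \<open>
  Orbits stay in the domain, so that the orbit and its derivative can be approximated by the core
  at all times.
\<close>

lemma generator_invariant:
  assumes "difference_limit T u v" "t \<ge> 0"
  shows "difference_limit T (T t u) (T t v)"
proof -
  interpret Tt: bounded_linear "T t" by (rule T_linear) fact
  have "((\<lambda>h. T t ((T h u - u) /\<^sub>R h)) \<longlongrightarrow> T t v) (at_right 0)"
    using assms(1) unfolding difference_limit_def by (rule Tt.tendsto)
  moreover have "\<forall>\<^sub>F h in at_right 0. T t ((T h u - u) /\<^sub>R h) = (T h (T t u) - T t u) /\<^sub>R h"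
  proof -
    have "T t ((T h u - u) /\<^sub>R h) = (T h (T t u) - T t u) /\<^sub>R h" if "h > 0" for h
    proof -
      have "T t (T h u) = T h (T t u)"
        using T_add[of t h] T_add[of h t] that assms(2) by (metis add.commute comp_apply less_imp_le)
      then show ?thesis by (simp add: Tt.scaleR Tt.diff)
    qed
    then show ?thesis by (auto simp: eventually_at_right_field intro: exI[of _ 1])
  qed
  ultimately show ?thesis unfolding difference_limit_def by (rule Lim_transform_eventually)
qed

lemma T_near:
  assumes "\<eta> > 0"
  shows "\<exists>d>0. \<forall>t. 0 \<le> t \<and> t < d \<longrightarrow> norm (T t u - u) \<le> \<eta>"
proof -
  have "\<forall>\<^sub>F t in at_right 0. dist (T t u) u < \<eta>"
    using T_cont[of u] assms by (rule tendstoD)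
  then obtain d where "d > 0" "\<forall>t>0. t < d \<longrightarrow> dist (T t u) u < \<eta>"
    unfolding eventually_at_right_field by auto
  then show ?thesis
    using T_0 assms by (intro exI[of _ d]) (auto simp: dist_norm le_less)
qed

text \<open>
  Here \<open>f\<close> is the polygonal path described in the introduction. Its velocity on the \<open>j\<close>th piece is
  \<open>p j\<close>, close to \<open>T (t j) v\<close> because the vertices are \<open>\<eta> \<delta>\<close>-close to the orbit, and the limit of the difference
  quotients of \<open>S\<close> along the path is the interpolation of the \<open>w' j\<close>, again close to \<open>T (t j) v\<close>. Hence
  one step of \<open>S\<close> follows the path up to \<open>h K \<eta>\<close>, and the accumulated error is of order \<open>\<eta>\<close>.
\<close>

lemma convergence_on_domain:
  assumes uv: "difference_limit T u v" and t0: "t0 > 0" and e: "e > 0"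
  shows "\<forall>\<^sub>F n in sequentially. \<forall>\<tau>\<in>{0..t0}. norm ((S (\<tau> / real n) ^^ n) u - T \<tau> u) \<le> e"
proof -
  obtain M where M1: "M \<ge> 1"
    and M: "\<And>t u. 0 \<le> t \<Longrightarrow> t \<le> t0 + 1 \<Longrightarrow> norm (T t u) \<le> M * norm u"
    using semigroup_locally_bounded[of T "t0 + 1"] T_linear T_0 T_add T_cont by metis
  define E where "E = exp (C * t0)"
  define K where "K = 8 + 5 * M"
  have E1: "E \<ge> 1" using C_nonneg t0 by (simp add: E_def)
  \<comment> \<open>The denominator collects the three errors: replacing u by the first vertex, following the
    path, and replacing the path by the orbit at the final time.\<close>
  define \<eta> where "\<eta> = e / (E + t0 * K * E + (3 + 2 * M))"
  have den: "E + t0 * K * E + (3 + 2 * M) > 0"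
    using E1 t0 M1 by (auto simp: K_def intro!: add_nonneg_pos mult_nonneg_nonneg add_pos_nonneg)
  have \<eta>: "\<eta> > 0" using e den by (simp add: \<eta>_def)
  have "\<forall>\<^sub>F h in at_right 0. dist ((T h u - u) /\<^sub>R h) v < \<eta>"
    using uv \<eta> unfolding difference_limit_def by (rule tendstoD)
  then obtain d0 where d0: "d0 > 0" "\<And>h. 0 < h \<Longrightarrow> h < d0 \<Longrightarrow> norm ((T h u - u) /\<^sub>R h - v) < \<eta>"
    unfolding eventually_at_right_field dist_norm by auto
  obtain d1 where d1: "d1 > 0" "\<And>t. 0 \<le> t \<Longrightarrow> t < d1 \<Longrightarrow> norm (T t u - u) \<le> \<eta>"
    using T_near[OF \<eta>] by metis
  obtain d2 where d2: "d2 > 0" "\<And>t. 0 \<le> t \<Longrightarrow> t < d2 \<Longrightarrow> norm (T t v - v) \<le> \<eta>"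
    using T_near[OF \<eta>] by metis
  define \<delta> where "\<delta> = min (min 1 d0) (min d1 d2) / 2"
  have \<delta>: "\<delta> > 0" "\<delta> < 1" "\<delta> < d0" "\<delta> < d1" "\<delta> < d2"
    using d0 d1 d2 by (auto simp: \<delta>_def min_def)
  define t where "t j = real j * \<delta>" for j :: nat
  have t_nonneg: "t j \<ge> 0" for j using \<delta> by (simp add: t_def)
  have t_Suc: "t (Suc j) = t j + \<delta>" for j by (simp add: t_def algebra_simps)
  \<comment> \<open>The vertices must be closer than the mesh size, since their differences are divided by it.\<close>
  have "\<exists>w w'. difference_limit S w w' \<and> norm (w - T (t j) u) \<le> \<eta> * \<delta> \<and> norm (w' - T (t j) v) \<le> \<eta>"
    for j
  proof -
    have "(T (t j) u, T (t j) v) \<in> closure {(w, w'). difference_limit S w w'}"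
      by (intro consistent generator_invariant uv t_nonneg)
    then obtain z where z: "z \<in> {(w, w'). difference_limit S w w'}"
        "dist z (T (t j) u, T (t j) v) < \<eta> * \<delta>"
      using closure_approachable \<eta> \<delta> by (metis mult_pos_pos)
    have "\<eta> * \<delta> \<le> \<eta>" using \<eta> \<delta> by simp
    moreover have "dist (fst z) (T (t j) u) \<le> dist z (T (t j) u, T (t j) v)"
      "dist (snd z) (T (t j) v) \<le> dist z (T (t j) u, T (t j) v)"
      using dist_fst_le[of z "(T (t j) u, T (t j) v)"] dist_snd_le[of z "(T (t j) u, T (t j) v)"]
      by auto
    ultimately show ?thesis
      using z by (intro exI[of _ "fst z"] exI[of _ "snd z"]) (auto simp: dist_norm)
  qed
  then obtain w w' where w: "\<And>j. difference_limit S (w j) (w' j)"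
    and wu: "\<And>j. norm (w j - T (t j) u) \<le> \<eta> * \<delta>" and wv: "\<And>j. norm (w' j - T (t j) v) \<le> \<eta>"
    by metis
  define p where "p j = (w (Suc j) - w j) /\<^sub>R \<delta>" for j
  have T_step: "T (t (Suc j)) x - T (t j) x = T (t j) (T \<delta> x - x)" for j x
  proof -
    interpret bounded_linear "T (t j)" by (intro T_linear t_nonneg)
    show ?thesis using T_add[of "t j" \<delta>] t_nonneg[of j] \<delta> by (simp add: t_Suc diff)
  qed
  \<comment> \<open>The velocity of the path against the velocity of the orbit at the left end of the piece.\<close>
  have p_near: "norm (p j - T (t j) v) \<le> (2 + M) * \<eta>" if j: "t j \<le> t0 + 1" for j
  proof -
    interpret bounded_linear "T (t j)" by (intro T_linear t_nonneg)
    have "p j - T (t j) v = (w (Suc j) - T (t (Suc j)) u) /\<^sub>R \<delta> - (w j - T (t j) u) /\<^sub>R \<delta>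
        + T (t j) ((T \<delta> u - u) /\<^sub>R \<delta> - v)"
      using T_step[of j u] by (simp add: p_def diff scaleR add algebra_simps)
    also have "norm \<dots> \<le> (\<eta> + \<eta>) + M * \<eta>"
    proof (rule norm_triangle_mono[OF norm_diff_triangle_mono])
      have "norm ((w i - T (t i) u) /\<^sub>R \<delta>) \<le> \<eta>" for i
        using wu[of i] \<delta> unfolding norm_scaleR by (simp add: field_simps)
      then show "norm ((w (Suc j) - T (t (Suc j)) u) /\<^sub>R \<delta>) \<le> \<eta>"
        "norm ((w j - T (t j) u) /\<^sub>R \<delta>) \<le> \<eta>" by auto
      have "norm (T (t j) ((T \<delta> u - u) /\<^sub>R \<delta> - v)) \<le> M * norm ((T \<delta> u - u) /\<^sub>R \<delta> - v)"
        by (rule M[OF t_nonneg j])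
      also have "\<dots> \<le> M * \<eta>" using d0(2)[of \<delta>] \<delta> M1 by (intro mult_left_mono) auto
      finally show "norm (T (t j) ((T \<delta> u - u) /\<^sub>R \<delta> - v)) \<le> M * \<eta>" .
    qed
    finally show ?thesis by (simp add: algebra_simps)
  qed
  have v_step: "norm (T (t (Suc j)) v - T (t j) v) \<le> M * \<eta>" if "t j \<le> t0 + 1" for j
    unfolding T_step using M[OF t_nonneg that, of "T \<delta> v - v"] d2(2)[of \<delta>] \<delta> M1
    by (meson less_imp_le mult_left_mono order_trans zero_le_one)
  have u_step: "norm (T (t j + r) u - T (t j) u) \<le> M * \<eta>" if "t j \<le> t0 + 1" "0 \<le> r" "r \<le> \<delta>" for j r
  proof -
    interpret bounded_linear "T (t j)" by (intro T_linear t_nonneg)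
    have "T (t j + r) u - T (t j) u = T (t j) (T r u - u)"
      using T_add[of "t j" r] t_nonneg[of j] that by (simp add: diff)
    also have "norm \<dots> \<le> M * norm (T r u - u)" by (rule M[OF t_nonneg that(1)])
    also have "\<dots> \<le> M * \<eta>" using d1(2)[of r] that \<delta> M1 by (intro mult_left_mono) auto
    finally show ?thesis .
  qed
  have p_step: "norm (p (Suc j) - p j) \<le> (4 + 3 * M) * \<eta>" if j: "t (Suc j) \<le> t0 + 1" for j
  proof -
    have j': "t j \<le> t0 + 1" using j \<delta> by (simp add: t_Suc)
    have "p (Suc j) - p j = (p (Suc j) - T (t (Suc j)) v) - (p j - T (t j) v)
        + (T (t (Suc j)) v - T (t j) v)" by simp
    also have "norm \<dots> \<le> ((2 + M) * \<eta> + (2 + M) * \<eta>) + M * \<eta>"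
      by (rule norm_triangle_mono[OF norm_diff_triangle_mono[OF p_near[OF j] p_near[OF j']] v_step[OF j']])
    finally show ?thesis by (simp add: algebra_simps)
  qed
  define ix where "ix s = nat \<lfloor>s / \<delta>\<rfloor>" for s
  have ix: "t (ix s) \<le> s" "s < t (ix s) + \<delta>" if "s \<ge> 0" for s
  proof -
    have r: "real (ix s) = of_int \<lfloor>s / \<delta>\<rfloor>" using that \<delta> by (simp add: ix_def)
    have "of_int \<lfloor>s / \<delta>\<rfloor> \<le> s / \<delta>" "s / \<delta> < of_int \<lfloor>s / \<delta>\<rfloor> + 1" by linarith+
    then have "of_int \<lfloor>s / \<delta>\<rfloor> * \<delta> \<le> s" "s < (of_int \<lfloor>s / \<delta>\<rfloor> + 1) * \<delta>"
      using \<delta>(1) by (simp_all only: pos_le_divide_eq pos_divide_less_eq)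
    then show "t (ix s) \<le> s" "s < t (ix s) + \<delta>"
      unfolding t_def r by (simp_all add: distrib_right)
  qed
  have ix_eq: "ix s = j" if "t j \<le> s" "s < t j + \<delta>" for s j
  proof -
    have "\<lfloor>s / \<delta>\<rfloor> = int j"
      using that \<delta> by (intro floor_unique) (auto simp: t_def field_simps)
    then show ?thesis by (simp add: ix_def)
  qed
  define f where "f s = w (ix s) + (s - t (ix s)) *\<^sub>R p (ix s)" for s
  have f_0: "f 0 = w 0" using ix_eq[of 0 0] \<delta> by (simp add: f_def t_def)
  have f_near: "norm (f s - T s u) \<le> (3 + 2 * M) * \<eta>" if s: "0 \<le> s" "s \<le> t0" for s
  proof -
    define j where "j = ix s"
    have j: "t j \<le> s" "s < t j + \<delta>" using ix[OF s(1)] by (auto simp: j_def)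
    have j0: "t j \<le> t0 + 1" using j s by linarith
    have "w (Suc j) - w j = (w (Suc j) - T (t (Suc j)) u) - (w j - T (t j) u)
        + (T (t j + \<delta>) u - T (t j) u)"
      by (simp add: t_Suc)
    also have "norm \<dots> \<le> (\<eta> * \<delta> + \<eta> * \<delta>) + M * \<eta>"
      using \<delta> by (intro norm_triangle_mono[OF norm_diff_triangle_mono[OF wu wu] u_step[OF j0]]) auto
    also have "\<dots> \<le> (2 + M) * \<eta>" using \<eta> \<delta> by (simp add: algebra_simps)
    finally have ww: "norm (w (Suc j) - w j) \<le> (2 + M) * \<eta>" .
    have "norm ((s - t j) *\<^sub>R p j) = (s - t j) / \<delta> * norm (w (Suc j) - w j)"
      using j \<delta> by (simp add: p_def divide_inverse)
    also have "\<dots> \<le> 1 * norm (w (Suc j) - w j)"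
      using j \<delta> by (intro mult_right_mono) auto
    finally have sp: "norm ((s - t j) *\<^sub>R p j) \<le> (2 + M) * \<eta>" using ww by simp
    have "f s - T s u = (w j - T (t j) u) + (s - t j) *\<^sub>R p j - (T (t j + (s - t j)) u - T (t j) u)"
      by (simp add: f_def j_def)
    also have "norm \<dots> \<le> (\<eta> * \<delta> + (2 + M) * \<eta>) + M * \<eta>"
      using j by (intro norm_diff_triangle_mono[OF norm_triangle_mono[OF wu sp] u_step[OF j0]]) auto
    also have "\<dots> \<le> (3 + 2 * M) * \<eta>" using \<eta> \<delta> by (simp add: algebra_simps)
    finally show ?thesis .
  qed
  \<comment> \<open>Only the vertices up to index Suc J are met, so one threshold h1 serves for all of them.\<close>
  obtain J where J: "t0 / \<delta> \<le> real J" using real_arch_simple by blast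
  have "\<forall>\<^sub>F h in at_right 0. \<forall>j\<in>{..Suc J}. dist ((S h (w j) - w j) /\<^sub>R h) (w' j) < \<eta>"
    using w \<eta> unfolding difference_limit_def by (intro eventually_ball_finite) (auto intro: tendstoD)
  then obtain h1 where h1: "h1 > 0"
    "\<And>h j. 0 < h \<Longrightarrow> h < h1 \<Longrightarrow> j \<le> Suc J \<Longrightarrow> norm ((S h (w j) - w j) /\<^sub>R h - w' j) \<le> \<eta>"
    unfolding eventually_at_right_field dist_norm by (metis atMost_iff less_imp_le)
  have step: "norm (S h (f s) - f (s + h)) \<le> h * (K * \<eta>)"
    if h: "0 < h" "h < h1" "h < \<delta>" and s: "0 \<le> s" "s + h \<le> t0" for h s
  proof -
    define j where "j = ix s"
    have j: "t j \<le> s" "s < t j + \<delta>" using ix[OF s(1)] by (auto simp: j_def)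
    have j0: "t j \<le> t0 + 1" using j s h by linarith
    have jJ: "j \<le> J"
    proof -
      have "t0 \<le> real J * \<delta>" using J \<delta>(1) by (simp only: pos_divide_le_eq)
      then have "real j * \<delta> < real J * \<delta>" using j s h unfolding t_def by linarith
      then show ?thesis using \<delta> by simp
    qed
    interpret Sh: bounded_linear "S h" using S_linear h by simp
    define \<theta> where "\<theta> = (s - t j) / \<delta>"
    have \<theta>: "0 \<le> \<theta>" "\<theta> \<le> 1" using j \<delta> by (auto simp: \<theta>_def)
    have f_s: "f s = (1 - \<theta>) *\<^sub>R w j + \<theta> *\<^sub>R w (Suc j)"
      by (simp add: f_def j_def[symmetric] p_def \<theta>_def algebra_simps divide_inverse)
    define g where "g = (1 - \<theta>) *\<^sub>R w' j + \<theta> *\<^sub>R w' (Suc j)"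
    have conv: "norm ((1 - \<theta>) *\<^sub>R x + \<theta> *\<^sub>R y) \<le> B" if "norm x \<le> B" "norm y \<le> B" for x y :: 'a and B
    proof -
      have "norm ((1 - \<theta>) *\<^sub>R x + \<theta> *\<^sub>R y) \<le> (1 - \<theta>) * B + \<theta> * B"
        using that \<theta> by (intro norm_triangle_mono) (simp_all add: mult_left_mono)
      then show ?thesis by (simp add: algebra_simps)
    qed
    have "S h (f s) - f s - h *\<^sub>R g = (1 - \<theta>) *\<^sub>R (S h (w j) - w j - h *\<^sub>R w' j)
        + \<theta> *\<^sub>R (S h (w (Suc j)) - w (Suc j) - h *\<^sub>R w' (Suc j))"
      unfolding f_s g_def by (simp add: Sh.add Sh.diff Sh.scaleR algebra_simps)
    also have "norm \<dots> \<le> h * \<eta>"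
    proof (rule conv)
      have "norm (S h (w i) - w i - h *\<^sub>R w' i) \<le> h * \<eta>" if "i \<le> Suc J" for i
      proof -
        have "S h (w i) - w i - h *\<^sub>R w' i = h *\<^sub>R ((S h (w i) - w i) /\<^sub>R h - w' i)"
          using h by (simp add: algebra_simps)
        then show ?thesis using h1(2)[OF h(1,2) that] h by simp
      qed
      then show "norm (S h (w j) - w j - h *\<^sub>R w' j) \<le> h * \<eta>"
        "norm (S h (w (Suc j)) - w (Suc j) - h *\<^sub>R w' (Suc j)) \<le> h * \<eta>" using jJ by auto
    qed
    finally have A: "norm (S h (f s) - f s - h *\<^sub>R g) \<le> h * \<eta>" .
    have "g - p j = ((1 - \<theta>) *\<^sub>R (w' j - T (t j) v) + \<theta> *\<^sub>R (w' (Suc j) - T (t j) v)) - (p j - T (t j) v)"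
      by (simp add: g_def algebra_simps)
    also have "norm \<dots> \<le> (1 + M) * \<eta> + (2 + M) * \<eta>"
    proof (rule norm_diff_triangle_mono[OF conv p_near[OF j0]])
      have "\<eta> \<le> (1 + M) * \<eta>" using \<eta> M1 by (simp add: algebra_simps)
      then show "norm (w' j - T (t j) v) \<le> (1 + M) * \<eta>" using wv[of j] by linarith
      have "norm (w' (Suc j) - T (t j) v) \<le> norm (w' (Suc j) - T (t (Suc j)) v) + norm (T (t (Suc j)) v - T (t j) v)"
        by (rule norm_diff_triangle_le[OF order_refl order_refl])
      then show "norm (w' (Suc j) - T (t j) v) \<le> (1 + M) * \<eta>"
        using wv[of "Suc j"] v_step[OF j0] by (simp add: algebra_simps)
    qed
    finally have B: "norm (g - p j) \<le> (3 + 2 * M) * \<eta>" by (simp add: algebra_simps)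
    \<comment> \<open>As h is smaller than the mesh size, a step crosses at most one vertex of the path.\<close>
    have D: "norm (f (s + h) - f s - h *\<^sub>R p j) \<le> h * ((4 + 3 * M) * \<eta>)"
    proof (cases "s + h < t j + \<delta>")
      case True
      then have "ix (s + h) = j" using j h by (intro ix_eq) auto
      then have "f (s + h) - f s - h *\<^sub>R p j = 0"
        by (simp add: f_def j_def[symmetric] algebra_simps)
      then show ?thesis using h \<eta> M1 by simp
    next
      case False
      then have "ix (s + h) = Suc j" using j h by (intro ix_eq) (auto simp: t_Suc)
      then have "f (s + h) - f s - h *\<^sub>R p j
          = w (Suc j) - w j - \<delta> *\<^sub>R p j + (s + h - t j - \<delta>) *\<^sub>R (p (Suc j) - p j)"
        by (simp add: f_def j_def[symmetric] t_Suc algebra_simps)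
      also have "w (Suc j) - w j - \<delta> *\<^sub>R p j = 0" using \<delta> by (simp add: p_def)
      also have "norm (0 + (s + h - t j - \<delta>) *\<^sub>R (p (Suc j) - p j))
          = (s + h - t j - \<delta>) * norm (p (Suc j) - p j)" using False by simp
      also have "\<dots> \<le> h * ((4 + 3 * M) * \<eta>)"
        using False j h s by (intro mult_mono p_step) (auto simp: t_Suc)
      finally show ?thesis .
    qed
    have "S h (f s) - f (s + h) = (S h (f s) - f s - h *\<^sub>R g) + h *\<^sub>R (g - p j) - (f (s + h) - f s - h *\<^sub>R p j)"
      by (simp add: algebra_simps)
    also have "norm \<dots> \<le> (h * \<eta> + h * ((3 + 2 * M) * \<eta>)) + h * ((4 + 3 * M) * \<eta>)"
      using h B by (intro norm_diff_triangle_mono[OF norm_triangle_mono[OF A] D]) auto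
    also have "\<dots> = h * (K * \<eta>)" by (simp add: K_def algebra_simps)
    finally show ?thesis .
  qed
  have main: "norm ((S (\<tau> / real n) ^^ n) u - T \<tau> u) \<le> e"
    if n: "n > 0" "t0 / real n < min h1 \<delta>" and \<tau>: "0 \<le> \<tau>" "\<tau> \<le> t0" for n \<tau>
  proof (cases "\<tau> = 0")
    case True
    then show ?thesis using e by (simp add: S_0 T_0 id_funpow)
  next
    case False
    define h where "h = \<tau> / real n"
    have nh: "real n * h = \<tau>" using n by (simp add: h_def)
    have h: "h > 0" using False \<tau> n by (simp add: h_def)
    have "h \<le> t0 / real n" unfolding h_def using \<tau> by (intro divide_right_mono) auto
    then have h': "h < h1" "h < \<delta>" using n by auto
    interpret Sh: bounded_linear "S h" using S_linear h by simp
    have q: "1 + C * h \<ge> 1" using C_nonneg h by simp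
    have qE: "(1 + C * h) ^ n \<le> E"
      unfolding E_def using C_nonneg h nh \<tau> by (intro power_bound_exp) auto
    have "norm ((S h ^^ n) (f 0) - f (real n * h)) \<le> real n * (h * (K * \<eta>)) * (1 + C * h) ^ n"
    proof (rule iterate_consistency)
      show "linear (S h)" by (rule Sh.linear)
      show "norm (S h x) \<le> (1 + C * h) * norm x" for x using S_bound h by simp
      fix k assume "k < n"
      then have "real (Suc k) * h \<le> real n * h" using h by (intro mult_right_mono) auto
      then show "norm (S h (f (real k * h)) - f (real (Suc k) * h)) \<le> h * (K * \<eta>)"
        using step[of h "real k * h"] h h' nh \<tau> by (simp add: algebra_simps)
    qed (use q h in auto)
    also have "real n * (h * (K * \<eta>)) * (1 + C * h) ^ n = \<tau> * (K * \<eta>) * (1 + C * h) ^ n"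
      by (simp add: nh[symmetric])
    also have "\<dots> \<le> t0 * (K * \<eta>) * E"
      using \<tau> \<eta> M1 qE q E1 by (intro mult_mono) (auto simp: K_def)
    finally have A: "norm ((S h ^^ n) (f 0) - f \<tau>) \<le> t0 * (K * \<eta>) * E" by (simp add: nh)
    have "norm ((S h ^^ n) (u - w 0)) \<le> (1 + C * h) ^ n * norm (u - w 0)"
      using S_bound[of h] h q by (intro norm_iterate_le) auto
    also have "\<dots> \<le> E * \<eta>"
    proof (intro mult_mono qE)
      have "norm (u - w 0) \<le> \<eta> * \<delta>" using wu[of 0] by (simp add: t_def T_0 norm_minus_commute)
      also have "\<dots> \<le> \<eta>" using \<eta> \<delta> by simp
      finally show "norm (u - w 0) \<le> \<eta>" .
    qed (use E1 in auto)
    finally have B: "norm ((S h ^^ n) (u - w 0)) \<le> E * \<eta>" .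
    have lin: "linear (S h ^^ n)" using Sh.linear by (rule linear_funpow)
    have "(S h ^^ n) u - T \<tau> u = (S h ^^ n) (u - w 0) + ((S h ^^ n) (f 0) - f \<tau>) + (f \<tau> - T \<tau> u)"
      by (simp add: linear_diff[OF lin] f_0)
    also have "norm \<dots> \<le> E * \<eta> + t0 * (K * \<eta>) * E + (3 + 2 * M) * \<eta>"
      using \<tau> by (intro norm_triangle_mono[OF norm_triangle_mono[OF B A] f_near]) auto
    also have "\<dots> = \<eta> * (E + t0 * K * E + (3 + 2 * M))" by (simp add: algebra_simps)
    also have "\<dots> = e" using den by (simp add: \<eta>_def)
    finally show ?thesis by (simp add: h_def)
  qed
  have "(\<lambda>n. t0 / real n) \<longlonglongrightarrow> 0" by (rule lim_const_over_n)
  then have "\<forall>\<^sub>F n in sequentially. t0 / real n < min h1 \<delta>"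
    using h1 \<delta> by (intro order_tendstoD) auto
  with eventually_gt_at_top[of 0] show ?thesis
    by eventually_elim (use main in auto)
qed

text \<open>
  Convergence on the dense domain extends to all vectors because both \<open>S(\<tau>/n)^n\<close> and \<open>T(\<tau>)\<close> are
  bounded uniformly in \<open>n\<close> and \<open>\<tau> \<in> [0, t0]\<close>.
\<close>

theorem product_formula:
  assumes t0: "t0 > 0" and e: "e > 0"
  shows "\<forall>\<^sub>F n in sequentially. \<forall>\<tau>\<in>{0..t0}. norm ((S (\<tau> / real n) ^^ n) u - T \<tau> u) \<le> e"
proof -
  obtain M where M1: "M \<ge> 1"
    and M: "\<And>t u. 0 \<le> t \<Longrightarrow> t \<le> t0 \<Longrightarrow> norm (T t u) \<le> M * norm u"
    using semigroup_locally_bounded[of T t0] T_linear T_0 T_add T_cont by metis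
  define E where "E = exp (C * t0)"
  have EM: "E + M > 0" using M1 by (simp add: E_def add_pos_pos)
  have "u \<in> closure {u. \<exists>v. difference_limit T u v}" using dense by simp
  moreover have "e / 2 / (E + M) > 0" using e EM by simp
  ultimately obtain w where w: "\<exists>v. difference_limit T w v" "dist w u < e / 2 / (E + M)"
    unfolding closure_approachable by blast
  then obtain v where v: "difference_limit T w v" by blast
  have "(E + M) * norm (w - u) \<le> e / 2"
    using w(2) EM by (simp add: dist_norm field_simps)
  note wu = this
  have "e / 2 > 0" using e by simp
  from convergence_on_domain[OF v t0 this] eventually_gt_at_top[of 0]
  show ?thesis
  proof eventually_elim
    case (elim n)
    show ?case
    proof
      fix \<tau> assume \<tau>: "\<tau> \<in> {0..t0}"
      define h where "h = \<tau> / real n"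
      have h: "h \<ge> 0" "real n * h = \<tau>" using \<tau> elim by (auto simp: h_def)
      interpret Sh: bounded_linear "S h" using S_linear h by simp
      interpret Tt: bounded_linear "T \<tau>" using T_linear \<tau> by simp
      have lin: "linear (S h ^^ n)" using Sh.linear by (rule linear_funpow)
      have "norm ((S h ^^ n) (w - u)) \<le> (1 + C * h) ^ n * norm (w - u)"
        using S_bound[of h] h C_nonneg by (intro norm_iterate_le) auto
      also have "\<dots> \<le> E * norm (w - u)"
        unfolding E_def using C_nonneg h \<tau> by (intro mult_right_mono power_bound_exp) auto
      finally have A: "norm ((S h ^^ n) (w - u)) \<le> E * norm (w - u)" .
      have B: "norm (T \<tau> (w - u)) \<le> M * norm (w - u)" using M \<tau> by simp
      have "(S h ^^ n) u - T \<tau> u = ((S h ^^ n) w - T \<tau> w) - (S h ^^ n) (w - u) + T \<tau> (w - u)"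
        by (simp add: linear_diff[OF lin] Tt.diff)
      also have "norm \<dots> \<le> (e / 2 + E * norm (w - u)) + M * norm (w - u)"
        using elim \<tau> by (intro norm_triangle_mono[OF norm_diff_triangle_mono[OF _ A] B])
          (auto simp: h_def)
      also have "\<dots> \<le> e" using wu by (simp add: algebra_simps)
      finally show "norm ((S (\<tau> / real n) ^^ n) u - T \<tau> u) \<le> e" by (simp add: h_def)
    qed
  qed
qed

end

section \<open>The space of square-integrable functions\<close>

lemma L2_rel_refl [simp]: "L2_rel f f \<longleftrightarrow> square_integrable f"
  by (simp add: L2_rel_def)

lemma square_integrable_L2_rep: "square_integrable (L2_rep u)"
  using Quotient3_rep_reflp[OF Quotient3_L2, of u] by simp

lemma L2_class_rep [simp]: "L2_class (L2_rep u) = u"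
  by (rule Quotient3_abs_rep[OF Quotient3_L2])

lemma L2_class_cong:
  "square_integrable f \<Longrightarrow> square_integrable g \<Longrightarrow> AE x in lebesgue. f x = g x \<Longrightarrow> L2_class f = L2_class g"
  by (rule Quotient3_rel_abs[OF Quotient3_L2]) (simp add: L2_rel_def)

lemma L2_rep_class:
  assumes "square_integrable f"
  shows "AE x in lebesgue. L2_rep (L2_class f) x = f x"
proof -
  have "L2_rel (L2_rep (L2_class f)) f"
    using rep_abs_rsp_left[OF Quotient3_L2, of f f] assms by simp
  then show ?thesis by (simp add: L2_rel_def)
qed

lemma L2_class_add:
  "square_integrable f \<Longrightarrow> square_integrable g \<Longrightarrow> L2_class f + L2_class g = L2_class (\<lambda>x. f x + g x)"
  by (rule plus_L2.abs_eq) auto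

lemma L2_class_diff:
  "square_integrable f \<Longrightarrow> square_integrable g \<Longrightarrow> L2_class f - L2_class g = L2_class (\<lambda>x. f x - g x)"
  by (rule minus_L2.abs_eq) auto

lemma L2_class_scaleR:
  "square_integrable f \<Longrightarrow> r *\<^sub>R L2_class f = L2_class (\<lambda>x. r *\<^sub>R f x)"
  by (rule scaleR_L2.abs_eq) auto

lemma L2_class_scaleC:
  "square_integrable f \<Longrightarrow> scaleC_L2 a (L2_class f) = L2_class (\<lambda>x. a * f x)"
  by (rule scaleC_L2.abs_eq) auto

lemma L2_class_zero: "L2_class (\<lambda>x. 0) = 0"
  by (rule zero_L2.abs_eq[symmetric])

lemma norm_L2_class:
  "square_integrable f \<Longrightarrow> norm (L2_class f) = sqrt (LINT x|lebesgue. (norm (f x))\<^sup>2)"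
  by (rule norm_L2.abs_eq) auto

lemma square_integrable_iff_nn_integral:
  "square_integrable f \<longleftrightarrow> f \<in> borel_measurable lebesgue \<and>
     (\<integral>\<^sup>+ x. ennreal ((norm (f x))\<^sup>2) \<partial>lebesgue) < \<infinity>"
  unfolding square_integrable_def integrable_iff_bounded by auto

lemma nn_integral_L2_class:
  assumes "square_integrable f"
  shows "(\<integral>\<^sup>+ x. ennreal ((norm (f x))\<^sup>2) \<partial>lebesgue) = ennreal ((norm (L2_class f))\<^sup>2)"
proof -
  have "(\<integral>\<^sup>+ x. ennreal ((norm (f x))\<^sup>2) \<partial>lebesgue) = ennreal (LINT x|lebesgue. (norm (f x))\<^sup>2)"
    using assms by (intro nn_integral_eq_integral) (auto simp: square_integrable_def)
  then show ?thesis
    using assms by (simp add: norm_L2_class)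
qed

text \<open>
  Most membership and norm estimates below are obtained in this form, since nonnegative integrals
  can be manipulated before integrability is known.
\<close>

lemma square_integrable_norm_le:
  assumes "f \<in> borel_measurable lebesgue" "B \<ge> 0"
    and le: "(\<integral>\<^sup>+ x. ennreal ((norm (f x))\<^sup>2) \<partial>lebesgue) \<le> ennreal (B\<^sup>2)"
  shows "square_integrable f" "norm (L2_class f) \<le> B"
proof -
  show f: "square_integrable f"
    using assms by (auto simp: square_integrable_iff_nn_integral intro: le_less_trans)
  then have "(norm (L2_class f))\<^sup>2 \<le> B\<^sup>2"
    using le nn_integral_L2_class[OF f] by (simp add: ennreal_le_iff)
  then show "norm (L2_class f) \<le> B"
    using assms(2) by (rule power2_le_imp_le)
qed

lemma square_integrable_bound:
  assumes g: "integrable lebesgue (\<lambda>x. (g x)\<^sup>2)" and f: "f \<in> borel_measurable lebesgue"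
    and le: "\<And>x. norm (f x) \<le> g x"
  shows "square_integrable f"
  unfolding square_integrable_def
proof
  show "integrable lebesgue (\<lambda>x. (norm (f x))\<^sup>2)"
    using f le by (intro Bochner_Integration.integrable_bound[OF g] AE_I2)
      (auto intro: power_mono)
qed (rule f)

lemma L2_dominated_convergence:
  fixes f :: "nat \<Rightarrow> 'a::euclidean_space \<Rightarrow> complex"
  assumes f: "\<And>n. f n \<in> borel_measurable lebesgue" and f': "f' \<in> borel_measurable lebesgue"
    and g: "integrable lebesgue (\<lambda>x. (g x)\<^sup>2)"
    and le: "\<And>n x. norm (f n x) \<le> g x" and lim: "\<And>x. (\<lambda>n. f n x) \<longlonglongrightarrow> f' x"
  shows "(\<lambda>n. L2_class (f n)) \<longlonglongrightarrow> L2_class f'"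
proof -
  note [measurable] = f f'
  have le': "norm (f' x) \<le> g x" for x
    using lim[of x, THEN tendsto_norm] le by (intro LIMSEQ_le_const2) auto
  have sq: "square_integrable (f n)" "square_integrable f'" for n
    using g f f' le le' by (auto intro: square_integrable_bound)
  have "(\<lambda>n. LINT x|lebesgue. (norm (f n x - f' x))\<^sup>2) \<longlonglongrightarrow> (LINT (x::'a)|lebesgue. (0::real))"
  proof (rule integral_dominated_convergence)
    show "integrable lebesgue (\<lambda>x. 4 * (g x)\<^sup>2)" using g by simp
    show "AE x in lebesgue. (\<lambda>n. (norm (f n x - f' x))\<^sup>2) \<longlonglongrightarrow> 0"
    proof (rule AE_I2)
      fix x
      have "(\<lambda>n. f n x - f' x) \<longlonglongrightarrow> 0" using lim[of x] by (simp add: LIM_zero)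
      then show "(\<lambda>n. (norm (f n x - f' x))\<^sup>2) \<longlonglongrightarrow> 0"
        by (auto dest!: tendsto_norm_zero intro: tendsto_null_power)
    qed
    show "AE x in lebesgue. norm ((norm (f n x - f' x))\<^sup>2) \<le> 4 * (g x)\<^sup>2" for n
    proof (rule AE_I2)
      fix x
      have "norm (f n x - f' x) \<le> 2 * g x"
        using norm_triangle_ineq4[of "f n x" "f' x"] le[of n x] le'[of x] by linarith
      then have "(norm (f n x - f' x))\<^sup>2 \<le> (2 * g x)\<^sup>2" by (rule power_mono) simp
      then show "norm ((norm (f n x - f' x))\<^sup>2) \<le> 4 * (g x)\<^sup>2"
        by (simp add: power_mult_distrib)
    qed
  qed auto
  then have "(\<lambda>n. sqrt (LINT x|lebesgue. (norm (f n x - f' x))\<^sup>2)) \<longlonglongrightarrow> sqrt 0"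
    by (intro tendsto_real_sqrt) simp
  then have "(\<lambda>n. norm (L2_class (f n) - L2_class f')) \<longlonglongrightarrow> 0"
    using sq by (simp add: L2_class_diff norm_L2_class square_integrable_diff)
  then show ?thesis
    by (rule LIM_zero_cancel[OF tendsto_norm_zero_cancel])
qed

lemma Cauchy_fast_subsequence:
  fixes X :: "nat \<Rightarrow> 'a::metric_space"
  assumes "Cauchy X"
  obtains r where "strict_mono r" "\<And>n m. r n \<le> m \<Longrightarrow> dist (X m) (X (r n)) < (1/2) ^ n"
proof -
  have "\<exists>N. \<forall>m\<ge>N. \<forall>k\<ge>N. dist (X m) (X k) < (1/2) ^ n" for n
    using assms unfolding Cauchy_def by simp
  then obtain N where N: "\<And>n m k. N n \<le> m \<Longrightarrow> N n \<le> k \<Longrightarrow> dist (X m) (X k) < (1/2) ^ n"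
    by metis
  define r where "r n = (\<Sum>i\<le>n. Suc (N i))" for n
  have "r n < r (Suc n)" for n by (simp add: r_def)
  then have mono: "strict_mono r" by (rule strict_mono_Suc_iff[THEN iffD2, rule_format])
  have "N n \<le> r n" for n
    unfolding r_def using member_le_sum[of n "{..n}" "\<lambda>i. Suc (N i)"] by simp
  then show thesis using N mono by (intro that[of r]) (meson order_trans order_refl)+
qed

text \<open>
  The weights \<open>2 ^ n\<close> are small enough to keep the sum of the weighted squares integrable and
  large enough to force geometric decay of the increments wherever that sum is finite.
\<close>

lemma AE_convergent_of_summable_squares:
  fixes f :: "nat \<Rightarrow> 'a \<Rightarrow> complex"
  assumes f[measurable]: "\<And>n. f n \<in> borel_measurable M"
    and le: "\<And>n. (\<integral>\<^sup>+ x. ennreal ((norm (f (Suc n) x - f n x))\<^sup>2) \<partial>M) \<le> ennreal ((1/4) ^ n)"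
  shows "AE x in M. convergent (\<lambda>n. f n x)"
proof -
  let ?d = "\<lambda>n x. (norm (f (Suc n) x - f n x))\<^sup>2"
  have "(\<integral>\<^sup>+ x. (\<Sum>n. ennreal (2 ^ n * ?d n x)) \<partial>M) = (\<Sum>n. \<integral>\<^sup>+ x. ennreal (2 ^ n * ?d n x) \<partial>M)"
    by (rule nn_integral_suminf) simp
  also have "\<dots> = (\<Sum>n. ennreal (2 ^ n) * (\<integral>\<^sup>+ x. ennreal (?d n x) \<partial>M))"
    by (simp add: ennreal_mult nn_integral_cmult)
  also have "\<dots> \<le> (\<Sum>n. ennreal ((1/2) ^ n))"
  proof (rule suminf_le)
    fix n
    have "ennreal (2 ^ n) * (\<integral>\<^sup>+ x. ennreal (?d n x) \<partial>M) \<le> ennreal (2 ^ n) * ennreal ((1/4) ^ n)"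
      by (intro mult_left_mono le) simp
    also have "\<dots> = ennreal ((1/2) ^ n)"
      by (simp add: ennreal_mult[symmetric] power_mult_distrib[symmetric] del: ennreal_power)
    finally show "ennreal (2 ^ n) * (\<integral>\<^sup>+ x. ennreal (?d n x) \<partial>M) \<le> ennreal ((1/2) ^ n)" .
  qed auto
  also have "\<dots> = ennreal 2"
    by (rule suminf_ennreal_eq) (use geometric_sums[of "1/2::real"] in auto)
  finally have "(\<integral>\<^sup>+ x. (\<Sum>n. ennreal (2 ^ n * ?d n x)) \<partial>M) \<noteq> \<infinity>"
    by (auto simp: top_unique)
  then have "AE x in M. (\<Sum>n. ennreal (2 ^ n * ?d n x)) \<noteq> \<infinity>"
    by (intro nn_integral_PInf_AE) auto
  then show ?thesis
  proof (rule AE_mp, intro AE_I2 impI)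
    fix x assume fin: "(\<Sum>n. ennreal (2 ^ n * ?d n x)) \<noteq> \<infinity>"
    then have "summable (\<lambda>n. 2 ^ n * ?d n x)"
      by (intro summable_suminf_not_top) (auto simp: top_unique)
    then have "(\<lambda>n. 2 ^ n * ?d n x) \<longlonglongrightarrow> 0" by (rule summable_LIMSEQ_zero)
    then have "Bseq (\<lambda>n. 2 ^ n * ?d n x)" by (intro convergent_imp_Bseq convergentI)
    then obtain K where K: "K > 0" "\<And>n. norm (2 ^ n * ?d n x) \<le> K" by (auto elim: BseqE)
    have bound: "norm (f (Suc n) x - f n x) \<le> sqrt K * (sqrt (1/2)) ^ n" for n
    proof -
      have "?d n x \<le> K * (1/2) ^ n"
        using K(2)[of n] by (simp add: field_simps abs_mult)
      then have "norm (f (Suc n) x - f n x) \<le> sqrt (K * (1/2) ^ n)" by (rule real_le_rsqrt)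
      then show ?thesis by (simp only: real_sqrt_mult real_sqrt_power)
    qed
    have "summable (\<lambda>n. sqrt K * (sqrt (1/2)) ^ n)"
      by (intro summable_mult summable_geometric) (simp add: real_sqrt_lt_1_iff)
    then have "summable (\<lambda>n. f (Suc n) x - f n x)"
      using bound by (rule summable_comparison_test'[where N = 0])
    then have "convergent (\<lambda>n. f n x - f 0 x)"
      by (simp only: summable_iff_convergent sum_lessThan_telescope[of "\<lambda>n. f n x"])
    then show "convergent (\<lambda>n. f n x)"
      by (simp add: convergent_diff_const_right_iff)
  qed
qed

text \<open>
  The Riesz-Fischer theorem: a rapidly converging subsequence converges almost everywhere, and
  Fatou's lemma shows that the pointwise limit is also the limit in norm.
\<close>

instance L2 :: (euclidean_space) complete_space
proof
  fix X :: "nat \<Rightarrow> 'a L2"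
  assume X: "Cauchy X"
  obtain r where r: "strict_mono r" and close: "\<And>n m. r n \<le> m \<Longrightarrow> dist (X m) (X (r n)) < (1/2) ^ n"
    using Cauchy_fast_subsequence[OF X] by blast
  define f where "f n = L2_rep (X (r n))" for n
  have sq: "square_integrable (f n)" for n by (simp add: f_def square_integrable_L2_rep)
  have cls: "L2_class (f n) = X (r n)" for n by (simp add: f_def)
  have [measurable]: "f n \<in> borel_measurable lebesgue" for n
    using sq by (rule square_integrable_measurable)
  have diff: "(\<integral>\<^sup>+ x. ennreal ((norm (f m x - f n x))\<^sup>2) \<partial>lebesgue) \<le> ennreal (((1/2) ^ n)\<^sup>2)"
    if "n \<le> m" for m n
  proof -
    have "r n \<le> r m" using r that by (simp add: strict_mono_less_eq)
    then have "norm (L2_class (\<lambda>x. f m x - f n x)) \<le> (1/2) ^ n"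
      using close[of n "r m"] sq by (simp add: L2_class_diff[symmetric] cls dist_norm less_imp_le)
    then show ?thesis
      using sq by (simp add: nn_integral_L2_class square_integrable_diff power_mono ennreal_leI)
  qed
  have "AE x in lebesgue. convergent (\<lambda>n. f n x)"
  proof (rule AE_convergent_of_summable_squares)
    fix n
    have "((1/2::real) ^ n)\<^sup>2 = (1/4) ^ n"
      by (simp add: power_divide power_mult[symmetric] mult.commute[of n] power_mult)
    then show "(\<integral>\<^sup>+ x. ennreal ((norm (f (Suc n) x - f n x))\<^sup>2) \<partial>lebesgue) \<le> ennreal ((1/4) ^ n)"
      using diff[of n "Suc n"] by simp
  qed simp
  define g where "g x = lim (\<lambda>n. f n x)" for x
  have [measurable]: "g \<in> borel_measurable lebesgue"
    unfolding g_def by (rule borel_measurable_lim_metric) simp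
  have conv: "AE x in lebesgue. (\<lambda>n. f n x) \<longlonglongrightarrow> g x"
    using \<open>AE x in lebesgue. convergent (\<lambda>n. f n x)\<close>
    by (rule AE_mp) (auto simp: g_def convergent_LIMSEQ_iff)
  have gf: "(\<integral>\<^sup>+ x. ennreal ((norm (g x - f n x))\<^sup>2) \<partial>lebesgue) \<le> ennreal (((1/2) ^ n)\<^sup>2)" for n
  proof -
    have "(\<integral>\<^sup>+ x. ennreal ((norm (g x - f n x))\<^sup>2) \<partial>lebesgue)
        = (\<integral>\<^sup>+ x. liminf (\<lambda>m. ennreal ((norm (f m x - f n x))\<^sup>2)) \<partial>lebesgue)"
    proof (rule nn_integral_cong_AE, use conv in \<open>rule AE_mp\<close>, intro AE_I2 impI)
      fix x assume "(\<lambda>m. f m x) \<longlonglongrightarrow> g x"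
      then have "(\<lambda>m. ennreal ((norm (f m x - f n x))\<^sup>2)) \<longlonglongrightarrow> ennreal ((norm (g x - f n x))\<^sup>2)"
        by (intro tendsto_intros)
      then show "ennreal ((norm (g x - f n x))\<^sup>2) = liminf (\<lambda>m. ennreal ((norm (f m x - f n x))\<^sup>2))"
        by (intro lim_imp_Liminf[symmetric]) simp_all
    qed
    also have "\<dots> \<le> liminf (\<lambda>m. \<integral>\<^sup>+ x. ennreal ((norm (f m x - f n x))\<^sup>2) \<partial>lebesgue)"
      by (rule nn_integral_liminf) simp
    also have "\<dots> \<le> liminf (\<lambda>m. ennreal (((1/2) ^ n)\<^sup>2))"
      by (intro Liminf_mono eventually_sequentiallyI[of n] diff)
    also have "\<dots> = ennreal (((1/2) ^ n)\<^sup>2)" by (simp add: Liminf_const)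
    finally show ?thesis .
  qed
  have gf_sq: "square_integrable (\<lambda>x. g x - f n x)" and gf_norm: "norm (L2_class (\<lambda>x. g x - f n x)) \<le> (1/2) ^ n" for n
    using square_integrable_norm_le[OF _ _ gf[of n]] by simp_all
  have g: "square_integrable g"
    using square_integrable_add[OF gf_sq[of 0] sq[of 0]] by simp
  have "norm (X (r n) - L2_class g) \<le> (1/2) ^ n" for n
    using gf_norm[of n] g sq by (simp add: L2_class_diff[symmetric] cls norm_minus_commute)
  moreover have "(\<lambda>n. (1/2::real) ^ n) \<longlonglongrightarrow> 0" by (rule LIMSEQ_realpow_zero) auto
  ultimately have "(\<lambda>n. X (r n) - L2_class g) \<longlonglongrightarrow> 0"
    by (rule Lim_null_comparison[OF always_eventually[OF allI]])
  then have "(X \<circ> r) \<longlonglongrightarrow> L2_class g" by (simp add: LIM_zero_cancel o_def)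
  then show "convergent X" using X r by (auto intro: Cauchy_converges_subseq convergentI)
qed

instance L2 :: (euclidean_space) banach ..

lemma closed_contains_limit:
  "closed V \<Longrightarrow> (\<And>n::nat. X n \<in> V) \<Longrightarrow> X \<longlonglongrightarrow> l \<Longrightarrow> l \<in> V"
  using closed_sequentially by blast

lemma borel_imp_lebesgue_measurable:
  fixes f :: "'a::euclidean_space \<Rightarrow> complex"
  shows "f \<in> borel_measurable borel \<Longrightarrow> f \<in> borel_measurable lebesgue"
  by (intro measurable_completion) simp

lemma square_integrable_indicator:
  "A \<in> sets lborel \<Longrightarrow> emeasure lborel A < \<infinity> \<Longrightarrow>
    square_integrable (\<lambda>x::'a::euclidean_space. a * indicator A x)"
proof (rule square_integrable_mult)
  assume A: "A \<in> sets lborel" "emeasure lborel A < \<infinity>"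
  then have "integrable lebesgue (indicator A :: 'a \<Rightarrow> real)" by simp
  moreover have "(norm (indicator A x :: complex))\<^sup>2 = indicator A x" for x
    by (simp add: indicator_def)
  ultimately show "square_integrable (\<lambda>x. indicator A x)"
    using A by (auto simp: square_integrable_def intro!: measurable_completion borel_measurable_indicator)
qed

lemma L2_Borel_representative:
  fixes u :: "'a::euclidean_space L2"
  obtains f where "f \<in> borel_measurable borel" "square_integrable f" "L2_class f = u"
proof -
  define g where "g = L2_rep u"
  have g: "square_integrable g" by (simp add: g_def square_integrable_L2_rep)
  then have [measurable]: "g \<in> borel_measurable lebesgue" by (rule square_integrable_measurable)
  have "(\<lambda>x. Re (g x)) \<in> borel_measurable lebesgue" "(\<lambda>x. Im (g x)) \<in> borel_measurable lebesgue"
    by measurable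
  then obtain a b where [measurable]: "a \<in> borel_measurable lborel" "b \<in> borel_measurable lborel"
    and ab: "AE x in lborel. Re (g x) = a x" "AE x in lborel. Im (g x) = b x"
    using completion_ex_borel_measurable_real by metis
  define f where "f x = Complex (a x) (b x)" for x
  have f: "f \<in> borel_measurable borel"
    unfolding f_def Complex_eq by measurable
  have "AE x in lebesgue. g x = f x"
    using ab[THEN AE_completion] by eventually_elim (simp add: f_def complex_eq_iff)
  moreover have f': "f \<in> borel_measurable lebesgue"
    using f by (simp add: measurable_completion)
  moreover have "square_integrable f"
  proof -
    have "integrable lebesgue (\<lambda>x. (norm (f x))\<^sup>2) \<longleftrightarrow> integrable lebesgue (\<lambda>x. (norm (g x))\<^sup>2)"
      using f' \<open>AE x in lebesgue. g x = f x\<close> by (intro integrable_cong_AE) auto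
    then show ?thesis using g f' by (simp add: square_integrable_def)
  qed
  ultimately show thesis
    using f g L2_class_cong[of f g] by (intro that) (auto simp: g_def eq_commute)
qed

text \<open>
  The sets whose indicator lies in \<open>V\<close> form a Dynkin system containing the boxes; intersecting with
  the bounded boxes \<open>B k\<close> keeps complements in \<open>L\<^sup>2\<close>. Simple functions and dominated convergence do the rest.
\<close>

lemma L2_closed_subspace_boxes:
  fixes V :: "'a::euclidean_space L2 set"
  assumes V: "subspace V" "closed V"
    and box: "\<And>(a::complex) c d. L2_class (\<lambda>x. a * indicator (box c d) x) \<in> V"
  shows "V = UNIV"
proof -
  define B :: "nat \<Rightarrow> 'a set" where "B k = box (- real k *\<^sub>R One) (real k *\<^sub>R One)" for k
  have B_fin: "emeasure lborel (A \<inter> B k) < \<infinity>" if "A \<in> sets lborel" for A k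
  proof -
    have "emeasure lborel (A \<inter> B k) \<le> emeasure lborel (B k)"
      by (intro emeasure_mono) (auto simp: B_def)
    also have "\<dots> < \<infinity>" unfolding B_def by (rule emeasure_lborel_box_finite)
    finally show ?thesis .
  qed
  have [measurable]: "B k \<in> sets borel" for k by (simp add: B_def)
  have ind: "L2_class (\<lambda>x. a * indicator (A \<inter> B k) x) \<in> V" if A: "A \<in> sets borel" for A k a
  proof -
    have "Int_stable (range (\<lambda>(a::'a, b). box a b))"
      by (auto simp: Int_stable_def box_Int_box)
    moreover have "range (\<lambda>(a::'a, b). box a b) \<subseteq> Pow UNIV" by simp
    moreover have "A \<in> sigma_sets UNIV (range (\<lambda>(a, b). box a b))"
      using A unfolding borel_eq_box by simp
    ultimately show ?thesis
    proof (induction rule: sigma_sets_induct_disjoint)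
      case (basic A)
      then show ?case using box by (auto simp: B_def box_Int_box)
    next
      case empty
      then show ?case using subspace_0[OF V(1)] by (simp add: L2_class_zero)
    next
      case (compl A)
      then have [measurable]: "A \<in> sets borel" by (simp add: borel_eq_box)
      have "(\<lambda>x. a * indicator ((UNIV - A) \<inter> B k) x)
          = (\<lambda>x. a * indicator (UNIV \<inter> B k) x - a * indicator (A \<inter> B k) x)"
        by (auto simp: fun_eq_iff indicator_def)
      then have "L2_class (\<lambda>x. a * indicator ((UNIV - A) \<inter> B k) x)
          = L2_class (\<lambda>x. a * indicator (UNIV \<inter> B k) x) - L2_class (\<lambda>x. a * indicator (A \<inter> B k) x)"
        by (subst L2_class_diff) (use B_fin[of UNIV] in \<open>auto intro!: square_integrable_indicator B_fin\<close>)
      moreover have "L2_class (\<lambda>x. a * indicator (UNIV \<inter> B k) x) \<in> V"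
        using box by (simp add: B_def)
      ultimately show ?case using compl V(1) by (simp add: subspace_diff)
    next
      case (union F)
      then have F[measurable]: "F i \<in> sets borel" for i by (auto simp: borel_eq_box)
      have disj: "disjoint_family F" using union by simp
      let ?f = "\<lambda>n x. \<Sum>i<n. a * indicator (F i \<inter> B k) x"
      have f_eq: "?f n x = a * indicator ((\<Union>i<n. F i) \<inter> B k) x" for n x
      proof -
        have "indicator (\<Union>i<n. F i \<inter> B k) x = (\<Sum>i<n. indicator (F i \<inter> B k) x :: complex)"
          using disj by (intro indicator_UN_disjoint) (auto simp: disjoint_family_on_def)
        then show ?thesis by (simp add: sum_distrib_left[symmetric])
      qed
      have "(\<lambda>n. L2_class (?f n)) \<longlonglongrightarrow> L2_class (\<lambda>x. a * indicator (\<Union>(range F) \<inter> B k) x)"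
      proof (rule L2_dominated_convergence)
        have "square_integrable (\<lambda>x. a * indicator (UNIV \<inter> B k) x)"
          by (intro square_integrable_indicator B_fin) auto
        then show "integrable lebesgue (\<lambda>x. (norm (a * indicator (UNIV \<inter> B k) x))\<^sup>2)"
          by (simp add: square_integrable_def)
        show "norm (?f n x) \<le> norm (a * indicator (UNIV \<inter> B k) x)" for n x
          unfolding f_eq by (auto simp: indicator_def)
        show "(\<lambda>n. ?f n x) \<longlonglongrightarrow> a * indicator (\<Union>(range F) \<inter> B k) x" for x
        proof (cases "x \<in> \<Union>(range F) \<inter> B k")
          case True
          then obtain i where i: "x \<in> F i" by blast
          have "?f n x = a" if "i < n" for n
          proof -
            have "x \<in> (\<Union>i<n. F i) \<inter> B k" using i that True by blast
            then show ?thesis unfolding f_eq by simp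
          qed
          then have "\<forall>\<^sub>F n in sequentially. ?f n x = a"
            by (rule eventually_mono[OF eventually_gt_at_top[of i]])
          then have "(\<lambda>n. ?f n x) \<longlonglongrightarrow> a" by (rule tendsto_eventually)
          then show ?thesis using True by simp
        next
          case False
          then have "?f n x = 0" for n unfolding f_eq by (auto simp: indicator_def)
          then have f_0: "(\<lambda>n. ?f n x) = (\<lambda>n. 0)" by (rule ext)
          have "indicator (\<Union>(range F) \<inter> B k) x = (0::complex)"
            using False by (rule indicator_simps(2))
          then show ?thesis unfolding f_0 by simp
        qed
        show "?f n \<in> borel_measurable lebesgue" for n
          by (rule borel_imp_lebesgue_measurable) measurable
        show "(\<lambda>x. a * indicator (\<Union>(range F) \<inter> B k) x) \<in> borel_measurable lebesgue"
          by (rule borel_imp_lebesgue_measurable) measurable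
      qed
      moreover have "L2_class (?f n) \<in> V" for n
      proof (induction n)
        case 0
        then show ?case using subspace_0[OF V(1)] by (simp add: L2_class_zero)
      next
        case (Suc n)
        have "square_integrable (?f n)"
          unfolding f_eq by (intro square_integrable_indicator B_fin) auto
        then have "L2_class (?f (Suc n)) = L2_class (?f n) + L2_class (\<lambda>x. a * indicator (F n \<inter> B k) x)"
          by (subst L2_class_add) (auto intro!: square_integrable_indicator B_fin)
        then show ?case using Suc union V(1) by (simp add: subspace_add)
      qed
      ultimately show ?case by (rule closed_contains_limit[OF V(2), rotated])
    qed
  qed
  have simple: "L2_class (\<lambda>x. s x * indicator (B k) x) \<in> V" if s: "simple_function borel s"
    for s :: "'a \<Rightarrow> complex" and k
  proof -
    have fin: "finite (range s)" using s by (simp add: simple_function_def)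
    have [measurable]: "s -` {y} \<in> sets borel" for y
      using s by (auto dest: simple_functionD)
    have s_eq: "s x * indicator (B k) x = (\<Sum>y\<in>range s. y * indicator (s -` {y} \<inter> B k) x)" for x
    proof -
      have "(\<Sum>y\<in>range s. y * indicator (s -` {y} \<inter> B k) x)
          = (\<Sum>y\<in>range s. if y = s x then s x * indicator (B k) x else 0)"
        by (intro sum.cong) (auto simp: indicator_def)
      then show ?thesis using fin by simp
    qed
    have "square_integrable (\<lambda>x. \<Sum>y\<in>R. y * indicator (s -` {y} \<inter> B k) x) \<and>
        L2_class (\<lambda>x. \<Sum>y\<in>R. y * indicator (s -` {y} \<inter> B k) x) \<in> V" if "finite R" for R
      using that
    proof induction
      case empty
      then show ?case using subspace_0[OF V(1)] by (simp add: L2_class_zero square_integrable_zero)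
    next
      case (insert y R)
      have y: "square_integrable (\<lambda>x. y * indicator (s -` {y} \<inter> B k) x)"
        by (intro square_integrable_indicator B_fin) auto
      have "L2_class (\<lambda>x. y * indicator (s -` {y} \<inter> B k) x) \<in> V" by (rule ind) simp
      then have "L2_class (\<lambda>x. y * indicator (s -` {y} \<inter> B k) x)
          + L2_class (\<lambda>x. \<Sum>y\<in>R. y * indicator (s -` {y} \<inter> B k) x) \<in> V"
        by (rule subspace_add[OF V(1) _ conjunct2[OF insert.IH]])
      then show ?case
        unfolding sum.insert[OF insert.hyps] L2_class_add[OF y conjunct1[OF insert.IH]]
        using square_integrable_add[OF y conjunct1[OF insert.IH]] by (rule conjI[rotated])
    qed
    then show ?thesis using fin by (simp add: s_eq)
  qed
  have "u \<in> V" for u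
  proof -
    obtain f where f: "f \<in> borel_measurable borel" "square_integrable f" "L2_class f = u"
      by (rule L2_Borel_representative)
    from borel_measurable_implies_sequence_metric[OF f(1), of 0]
    obtain s where s: "\<And>i. simple_function borel (s i)" "\<And>x. (\<lambda>i. s i x) \<longlonglongrightarrow> f x"
      "\<And>i x. norm (s i x) \<le> 2 * norm (f x)" by (auto simp: dist_norm)
    have "(\<lambda>i. L2_class (\<lambda>x. s i x * indicator (B i) x)) \<longlonglongrightarrow> L2_class f"
    proof (rule L2_dominated_convergence)
      show "integrable lebesgue (\<lambda>x. (2 * norm (f x))\<^sup>2)"
        using f(2) by (simp add: square_integrable_def power_mult_distrib)
      show "norm (s i x * indicator (B i) x) \<le> 2 * norm (f x)" for i x
        using s(3)[of i x] by (auto simp: indicator_def)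
      have "s i \<in> borel_measurable borel" for i using s(1) by (rule borel_measurable_simple_function)
      then show "(\<lambda>x. s i x * indicator (B i) x) \<in> borel_measurable lebesgue" for i
        by (intro measurable_completion) simp
      show "f \<in> borel_measurable lebesgue" using f by (simp add: square_integrable_measurable)
      fix x :: 'a
      have "x \<in> (\<Union>i::nat. box (- (real i *\<^sub>R One)) (real i *\<^sub>R One))"
        unfolding UN_box_eq_UNIV by (rule UNIV_I)
      then obtain k where "x \<in> box (- (real k *\<^sub>R One)) (real k *\<^sub>R One)" by (rule UN_E)
      then have k: "x \<in> B k" by (simp add: B_def)
      have BB: "B k \<subseteq> B i" if "k \<le> i" for i
        using that unfolding B_def by (intro subset_box_imp) simp
      have "\<forall>\<^sub>F i in sequentially. s i x = s i x * indicator (B i) x"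
        using eventually_ge_at_top[of k] by eventually_elim (use subsetD[OF BB k] in simp)
      then show "(\<lambda>i. s i x * indicator (B i) x) \<longlonglongrightarrow> f x"
        using s(2) by (rule Lim_transform_eventually[rotated])
    qed
    then have "L2_class f \<in> V"
      using simple[OF s(1)] by (rule closed_contains_limit[OF V(2), rotated])
    then show ?thesis using f(3) by simp
  qed
  then show ?thesis by blast
qed

section \<open>Smooth test functions\<close>

text \<open>
  The function \<open>exp (- 1 / t)\<close> continued by \<open>0\<close>. Allowing a polynomial factor in \<open>1 / t\<close> gives a family
  that is closed under differentiation.
\<close>

definition flat :: "real poly \<Rightarrow> real \<Rightarrow> real" where
  "flat p t = (if t \<le> 0 then 0 else poly p (1 / t) * exp (- (1 / t)))"

text \<open>
  The derivative of \<open>P(1/t) exp (- 1/t)\<close> is \<open>(P(1/t) - P'(1/t)) / t\<^sup>2\<close> times the exponential.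
\<close>

definition flat_deriv :: "real poly \<Rightarrow> real poly" where
  "flat_deriv p = monom 1 2 * (p - pderiv p)"

lemma flat_smult: "flat (smult a p) t = a * flat p t"
  by (simp add: flat_def)

lemma poly_exp_tendsto_0:
  fixes p :: "real poly"
  shows "((\<lambda>y. poly p y * exp (- y)) \<longlongrightarrow> 0) at_top"
proof -
  have "((\<lambda>y. \<Sum>i\<le>degree p. coeff p i * (y ^ i / exp y)) \<longlongrightarrow> (\<Sum>i\<le>degree p. coeff p i * 0)) at_top"
    by (intro tendsto_sum tendsto_mult tendsto_const tendsto_power_div_exp_0)
  moreover have "(\<Sum>i\<le>degree p. coeff p i * (y ^ i / exp y)) = poly p y * exp (- y)" for y
    by (simp add: poly_altdef sum_distrib_right exp_minus divide_inverse mult.assoc)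
  ultimately show ?thesis by simp
qed

lemma flat_tendsto_0: "(flat p \<longlongrightarrow> 0) (at_right 0)"
proof -
  have "((\<lambda>t. poly p (inverse t) * exp (- inverse t)) \<longlongrightarrow> 0) (at_right 0)"
    using poly_exp_tendsto_0 filterlim_inverse_at_top_right by (rule filterlim_compose)
  then show ?thesis
    by (rule Lim_transform_eventually)
      (auto simp: eventually_at_right_field flat_def inverse_eq_divide intro!: exI[of _ 1])
qed

lemma DERIV_flat: "(flat p has_real_derivative flat (flat_deriv p) t) (at t)"
proof (cases "t = 0")
  case False
  show ?thesis
  proof (cases "t < 0")
    case True
    have "((\<lambda>_. 0) has_real_derivative 0) (at t)" by simp
    then have "(flat p has_real_derivative 0) (at t)"
      by (rule has_field_derivative_transform_within_open[where S = "{..<0}"])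
        (use True in \<open>auto simp: flat_def\<close>)
    then show ?thesis using True by (simp add: flat_def)
  next
    case False
    with \<open>t \<noteq> 0\<close> have t: "t > 0" by simp
    have "((\<lambda>t. poly p (1 / t) * exp (- (1 / t))) has_real_derivative
        poly (flat_deriv p) (1 / t) * exp (- (1 / t))) (at t)"
      using t by (auto intro!: derivative_eq_intros poly_DERIV[THEN DERIV_chain2]
          simp: flat_deriv_def poly_monom field_simps power2_eq_square)
    then have "(flat p has_real_derivative poly (flat_deriv p) (1 / t) * exp (- (1 / t))) (at t)"
      by (rule has_field_derivative_transform_within_open[where S = "{0<..}"])
        (use t in \<open>auto simp: flat_def\<close>)
    then show ?thesis using t by (simp add: flat_def)
  qed
next
  case True
  have "((\<lambda>h. (flat p h - flat p 0) / (h - 0)) \<longlongrightarrow> 0) (at_left 0)"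
    by (rule tendsto_eventually)
      (auto simp: eventually_at_left_field flat_def intro!: exI[of _ "-1"])
  moreover have "((\<lambda>h. (flat p h - flat p 0) / (h - 0)) \<longlongrightarrow> 0) (at_right 0)"
    by (rule Lim_transform_eventually[OF flat_tendsto_0[of "[:0, 1:] * p"]])
      (auto simp: eventually_at_right_field flat_def divide_simps intro!: exI[of _ 1])
  ultimately have "((\<lambda>h. (flat p h - flat p 0) / (h - 0)) \<longlongrightarrow> 0) (at 0)"
    by (rule filterlim_split_at)
  then show ?thesis using True by (simp add: has_field_derivative_iff flat_def)
qed

text \<open>
  A class of functions that contains the bump functions used below and is closed under partial
  derivatives. Smoothness of its members follows from this closure alone, without a formula for
  the higher derivatives.
\<close>

inductive flat_algebra :: "('a::euclidean_space \<Rightarrow> complex) \<Rightarrow> bool" where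
  flat: "flat_algebra (\<lambda>x. of_real (flat p (\<alpha> * (x \<bullet> b) + \<beta>)))"
| const: "flat_algebra (\<lambda>x. c)"
| add: "flat_algebra f \<Longrightarrow> flat_algebra g \<Longrightarrow> flat_algebra (\<lambda>x. f x + g x)"
| mult: "flat_algebra f \<Longrightarrow> flat_algebra g \<Longrightarrow> flat_algebra (\<lambda>x. f x * g x)"

lemma flat_algebra_derivative:
  assumes "flat_algebra f"
  shows "\<exists>f'. (\<forall>e. flat_algebra (f' e)) \<and> (\<forall>x. (f has_derivative (\<lambda>e. f' e x)) (at x))"
  using assms
proof induction
  case (flat p \<alpha> b \<beta>)
  have "((\<lambda>x. of_real (flat p (\<alpha> * (x \<bullet> b) + \<beta>))) has_derivative
      (\<lambda>e. complex_of_real (flat (smult (\<alpha> * (e \<bullet> b)) (flat_deriv p)) (\<alpha> * (x \<bullet> b) + \<beta>)))) (at x)" for x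
  proof -
    have "((\<lambda>x. \<alpha> * (x \<bullet> b) + \<beta>) has_derivative (\<lambda>e. \<alpha> * (e \<bullet> b))) (at x)"
      by (auto intro!: derivative_eq_intros)
    moreover have "(flat p has_derivative (*) (flat (flat_deriv p) (\<alpha> * (x \<bullet> b) + \<beta>))) (at (\<alpha> * (x \<bullet> b) + \<beta>))"
      using DERIV_flat by (rule has_field_derivative_imp_has_derivative)
    ultimately have "((\<lambda>x. flat p (\<alpha> * (x \<bullet> b) + \<beta>)) has_derivative
        (\<lambda>e. flat (flat_deriv p) (\<alpha> * (x \<bullet> b) + \<beta>) * (\<alpha> * (e \<bullet> b)))) (at x)"
      by (rule has_derivative_compose)
    from has_derivative_of_real[OF this] show ?thesis
      by (simp add: flat_smult mult_ac)
  qed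
  then show ?case
    by (intro exI[of _ "\<lambda>e x. of_real (flat (smult (\<alpha> * (e \<bullet> b)) (flat_deriv p)) (\<alpha> * (x \<bullet> b) + \<beta>))"])
      (auto intro: flat_algebra.flat)
next
  case (const c)
  show ?case by (intro exI[of _ "\<lambda>e x. 0"]) (auto intro: flat_algebra.const)
next
  case (add f g)
  then obtain f' g' where "\<forall>e. flat_algebra (f' e)" "\<forall>x. (f has_derivative (\<lambda>e. f' e x)) (at x)"
    "\<forall>e. flat_algebra (g' e)" "\<forall>x. (g has_derivative (\<lambda>e. g' e x)) (at x)" by blast
  then show ?case
    by (intro exI[of _ "\<lambda>e x. f' e x + g' e x"]) (auto intro: flat_algebra.add has_derivative_add)
next
  case (mult f g)
  then obtain f' g' where "\<forall>e. flat_algebra (f' e)" "\<forall>x. (f has_derivative (\<lambda>e. f' e x)) (at x)"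
    "\<forall>e. flat_algebra (g' e)" "\<forall>x. (g has_derivative (\<lambda>e. g' e x)) (at x)" by blast
  note fg = this
  have "flat_algebra (\<lambda>x. f x * g' e x + f' e x * g x)" for e
    by (intro flat_algebra.add[OF flat_algebra.mult flat_algebra.mult])
      (use fg mult.hyps in auto)
  moreover have "((\<lambda>x. f x * g x) has_derivative (\<lambda>e. f x * g' e x + f' e x * g x)) (at x)" for x
    by (intro has_derivative_mult) (use fg in auto)
  ultimately show ?case by (intro exI[of _ "\<lambda>e x. f x * g' e x + f' e x * g x"]) simp
qed

lemma smooth_flat_algebra:
  assumes "flat_algebra f"
  shows "smooth f"
proof -
  have it: "flat_algebra (iterated_partial bs f)" for bs
  proof (induction bs)
    case (Cons b bs)
    obtain f' where f': "\<And>e. flat_algebra (f' e)"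
      "\<And>x. (iterated_partial bs f has_derivative (\<lambda>e. f' e x)) (at x)"
      using flat_algebra_derivative[OF Cons] by blast
    have "iterated_partial (b # bs) f = f' b"
      using frechet_derivative_at[OF f'(2), symmetric] by (auto simp: fun_eq_iff)
    then show ?case using f'(1) by simp
  qed (use assms in simp)
  show ?thesis
    unfolding smooth_def
    using flat_algebra_derivative[OF it] by (meson differentiable_def)
qed

lemma flat_algebra_prod:
  "finite I \<Longrightarrow> (\<And>i. i \<in> I \<Longrightarrow> flat_algebra (f i)) \<Longrightarrow> flat_algebra (\<lambda>x. \<Prod>i\<in>I. f i x)"
  by (induction I rule: finite_induct) (auto intro: flat_algebra.const flat_algebra.mult)

text \<open>
  Positive exactly on the box for \<open>n > 0\<close>; the dilation by \<open>n\<close> pushes the values towards \<open>1\<close>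
  at every point of the box.
\<close>

definition box_bump :: "nat \<Rightarrow> 'a::euclidean_space \<Rightarrow> 'a \<Rightarrow> 'a \<Rightarrow> real" where
  "box_bump n c d x =
     (\<Prod>b\<in>Basis. flat 1 (real n * (x \<bullet> b) - real n * (c \<bullet> b)) * flat 1 (real n * (d \<bullet> b) - real n * (x \<bullet> b)))"

lemma flat_1_bounds: "0 \<le> flat 1 t" "flat 1 t \<le> 1"
  by (auto simp: flat_def)

lemma box_bump_bounds: "0 \<le> box_bump n c d x" "box_bump n c d x \<le> 1"
  unfolding box_bump_def
  by (auto intro!: prod_nonneg prod_le_1 mult_nonneg_nonneg mult_le_one simp: flat_1_bounds)

lemma box_bump_eq_0:
  assumes "x \<notin> box c d"
  shows "box_bump n c d x = 0"
proof -
  obtain b where b: "b \<in> Basis" "x \<bullet> b \<le> c \<bullet> b \<or> d \<bullet> b \<le> x \<bullet> b"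
    using assms by (auto simp: box_def not_less)
  have "flat 1 (real n * (x \<bullet> b) - real n * (c \<bullet> b)) * flat 1 (real n * (d \<bullet> b) - real n * (x \<bullet> b)) = 0"
    using b(2) by (auto simp: flat_def mult_left_mono)
  with b(1) show ?thesis unfolding box_bump_def by (intro prod_zero) auto
qed

lemma box_bump_tendsto: "(\<lambda>n. box_bump n c d x) \<longlonglongrightarrow> indicator (box c d) x"
proof (cases "x \<in> box c d")
  case True
  have lim: "(\<lambda>n. flat 1 (real n * u - real n * v)) \<longlonglongrightarrow> 1" if "v < u" for u v :: real
  proof -
    have "(\<lambda>n. exp (- ((1 / (u - v)) / real n))) \<longlonglongrightarrow> exp (- 0)"
      by (intro tendsto_exp tendsto_minus lim_const_over_n)
    then have "(\<lambda>n. exp (- ((1 / (u - v)) / real n))) \<longlonglongrightarrow> 1" by simp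
    moreover have "\<forall>\<^sub>F n in sequentially. exp (- ((1 / (u - v)) / real n)) = flat 1 (real n * u - real n * v)"
      using eventually_gt_at_top[of 0]
    proof eventually_elim
      case (elim n)
      have "real n * u - real n * v = real n * (u - v)" by (simp add: algebra_simps)
      then show ?case using elim that by (simp add: flat_def mult.commute zero_less_mult_iff not_le)
    qed
    ultimately show ?thesis by (rule Lim_transform_eventually)
  qed
  have "(\<lambda>n. box_bump n c d x) \<longlonglongrightarrow> (\<Prod>b\<in>(Basis::'a set). 1 * 1)"
    unfolding box_bump_def
    using True by (intro tendsto_prod tendsto_mult lim) (auto simp: box_def)
  then show ?thesis using True by simp
qed (simp add: box_bump_eq_0)

lemma test_function_box_bump: "test_function (\<lambda>x. a * of_real (box_bump n c d x))"
  unfolding test_function_def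
proof
  have "flat_algebra (\<lambda>x. of_real (flat 1 (real n * (x \<bullet> b) + - real n * (c \<bullet> b)))
      * of_real (flat 1 ((- real n) * (x \<bullet> b) + real n * (d \<bullet> b))))" for b
    by (intro flat_algebra.mult flat_algebra.flat)
  then have "flat_algebra (\<lambda>x. a * (\<Prod>b\<in>Basis. of_real (flat 1 (real n * (x \<bullet> b) + - real n * (c \<bullet> b)))
      * of_real (flat 1 ((- real n) * (x \<bullet> b) + real n * (d \<bullet> b)))))"
    by (intro flat_algebra.mult[OF flat_algebra.const] flat_algebra_prod) auto
  then show "smooth (\<lambda>x. a * of_real (box_bump n c d x))"
    by (intro smooth_flat_algebra) (simp add: box_bump_def)
  have "{x. a * of_real (box_bump n c d x) \<noteq> 0} \<subseteq> cbox c d"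
    using box_bump_eq_0[of _ c d n] box_subset_cbox[of c d] by auto
  then have "bounded {x. a * of_real (box_bump n c d x) \<noteq> 0}"
    using bounded_cbox bounded_subset by blast
  then show "compact (closure {x. a * of_real (box_bump n c d x) \<noteq> 0})"
    by (simp only: compact_closure)
qed

lemma smooth_iterated_differentiable:
  "smooth f \<Longrightarrow> set bs \<subseteq> Basis \<Longrightarrow> iterated_partial bs f differentiable (at x)"
  by (simp add: smooth_def)

lemma smooth_iterated_continuous:
  "smooth f \<Longrightarrow> set bs \<subseteq> Basis \<Longrightarrow> continuous_on UNIV (iterated_partial bs f)"
  by (auto intro!: continuous_at_imp_continuous_on differentiable_imp_continuous_within
      smooth_iterated_differentiable)

lemma iterated_partial_eq_0:
  assumes "x \<notin> closure {x. f x \<noteq> 0}"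
  shows "iterated_partial bs f x = 0"
  using assms
proof (induction bs arbitrary: x)
  case Nil
  then show ?case using closure_subset[of "{x. f x \<noteq> 0}"] by auto
next
  case (Cons b bs)
  have "((\<lambda>_. 0) has_derivative (\<lambda>_. 0)) (at x)" by simp
  then have "(iterated_partial bs f has_derivative (\<lambda>_. 0)) (at x)"
    by (rule has_derivative_transform_within_open[where s = "- closure {x. f x \<noteq> 0}"])
      (use Cons in auto)
  then show ?case using frechet_derivative_at[symmetric] by fastforce
qed

lemma test_function_imp_schwartz:
  assumes "test_function f"
  shows "schwartz f"
  unfolding schwartz_def
proof (intro conjI allI impI)
  show smooth: "smooth f" using assms by (simp add: test_function_def)
  fix k :: nat and bs :: "'a list" assume bs: "set bs \<subseteq> Basis"
  let ?K = "closure {x. f x \<noteq> 0}" and ?g = "\<lambda>x. (1 + norm x) ^ k * norm (iterated_partial bs f x)"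
  have "continuous_on ?K ?g"
    using continuous_on_subset[OF smooth_iterated_continuous[OF smooth bs]]
    by (intro continuous_intros) auto
  moreover have "compact ?K" using assms by (simp add: test_function_def)
  ultimately have "bounded (?g ` ?K)" by (intro compact_imp_bounded compact_continuous_image)
  then obtain C where C: "\<And>x. x \<in> ?K \<Longrightarrow> \<bar>?g x\<bar> \<le> C" by (auto simp: bounded_iff)
  have "?g x \<le> max C 0" for x
  proof (cases "x \<in> ?K")
    case True
    then show ?thesis using C[of x] by linarith
  qed (simp add: iterated_partial_eq_0)
  then show "\<exists>C. \<forall>x. ?g x \<le> C" by blast
qed

lemma integrable_inverse_square: "(\<integral>\<^sup>+ x. ennreal (inverse (1 + x\<^sup>2)) \<partial>lborel) < \<infinity>"
proof -
  have "integrable lborel (\<lambda>x::real. inverse (1 + x\<^sup>2))"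
    using integrable_inverse_1_plus_square by (simp add: set_integrable_def einterval_def)
  then show ?thesis by (simp add: integrable_iff_bounded)
qed

text \<open>
  The weight is dominated by the product over the coordinates of \<open>1 / (1 + t\<^sup>2)\<close>.
\<close>

lemma integrable_weight:
  "integrable lebesgue (\<lambda>x::'a::euclidean_space. (1 / (1 + norm x) ^ DIM('a))\<^sup>2)"
proof -
  have "(\<integral>\<^sup>+ x. ennreal ((1 / (1 + norm x) ^ DIM('a))\<^sup>2) \<partial>(lborel::'a measure))
      \<le> (\<integral>\<^sup>+ x. (\<Prod>b\<in>Basis. ennreal (inverse (1 + (x \<bullet> b)\<^sup>2))) \<partial>(lborel::'a measure))"
  proof (rule nn_integral_mono)
    fix x :: 'a
    have "(\<Prod>b\<in>Basis. 1 + (x \<bullet> b)\<^sup>2) \<le> (\<Prod>b\<in>(Basis::'a set). (1 + norm x)\<^sup>2)"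
    proof (rule prod_mono)
      fix b :: 'a assume "b \<in> Basis"
      then have "(x \<bullet> b)\<^sup>2 \<le> (norm x)\<^sup>2"
        using Basis_le_norm[of b x] by (metis abs_ge_zero power2_abs power_mono)
      then show "0 \<le> 1 + (x \<bullet> b)\<^sup>2 \<and> 1 + (x \<bullet> b)\<^sup>2 \<le> (1 + norm x)\<^sup>2"
        by (auto simp: power2_sum intro: add_increasing2)
    qed
    also have "\<dots> = ((1 + norm x) ^ DIM('a))\<^sup>2" by (simp add: power_mult[symmetric] mult.commute)
    finally have "inverse (((1 + norm x) ^ DIM('a))\<^sup>2) \<le> inverse (\<Prod>b\<in>Basis. 1 + (x \<bullet> b)\<^sup>2)"
      by (rule le_imp_inverse_le) (intro prod_pos ballI add_pos_nonneg, auto)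
    also have "\<dots> = (\<Prod>b\<in>Basis. inverse (1 + (x \<bullet> b)\<^sup>2))"
      by (simp add: prod_inversef[symmetric] o_def)
    finally show "ennreal ((1 / (1 + norm x) ^ DIM('a))\<^sup>2) \<le> (\<Prod>b\<in>Basis. ennreal (inverse (1 + (x \<bullet> b)\<^sup>2)))"
      by (subst prod_ennreal) (simp_all add: power_divide inverse_eq_divide ennreal_leI)
  qed
  also have "\<dots> = (\<Prod>b\<in>(Basis::'a set). \<integral>\<^sup>+ x. ennreal (inverse (1 + x\<^sup>2)) \<partial>lborel)"
    by (rule nn_integral_lborel_prod) auto
  also have "\<dots> < \<infinity>"
    using integrable_inverse_square by (simp add: power_less_top_ennreal)
  finally have "integrable lborel (\<lambda>x::'a. (1 / (1 + norm x) ^ DIM('a))\<^sup>2)"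
    by (intro integrableI_bounded) auto
  then show ?thesis by (simp add: integrable_completion)
qed

definition weight_norm :: "'a::euclidean_space itself \<Rightarrow> real" where
  "weight_norm _ = sqrt (LINT x::'a|lebesgue. (1 / (1 + norm x) ^ DIM('a))\<^sup>2)"

lemma weighted_bound:
  fixes f :: "'a::euclidean_space \<Rightarrow> complex"
  assumes f: "f \<in> borel_measurable lebesgue" and C: "C \<ge> 0"
    and le: "\<And>x. norm (f x) \<le> C / (1 + norm x) ^ DIM('a)"
  shows "square_integrable f" "norm (L2_class f) \<le> C * weight_norm TYPE('a)"
proof -
  have int: "integrable lebesgue (\<lambda>x::'a. (C / (1 + norm x) ^ DIM('a))\<^sup>2)"
    using integrable_weight[where 'a = 'a, THEN integrable_mult_right, of "C\<^sup>2"]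
    by (simp add: power_divide)
  then show f': "square_integrable f"
    using f le by (rule square_integrable_bound)
  have "(LINT x|lebesgue. (norm (f x))\<^sup>2) \<le> (LINT x::'a|lebesgue. (C / (1 + norm x) ^ DIM('a))\<^sup>2)"
    using f' le by (intro integral_mono int power_mono) (auto simp: square_integrable_def)
  also have "\<dots> = C\<^sup>2 * (LINT x::'a|lebesgue. (1 / (1 + norm x) ^ DIM('a))\<^sup>2)"
    by (subst integral_mult_right_zero[symmetric]) (simp add: power_divide)
  finally have "sqrt (LINT x|lebesgue. (norm (f x))\<^sup>2)
      \<le> sqrt (C\<^sup>2 * (LINT x::'a|lebesgue. (1 / (1 + norm x) ^ DIM('a))\<^sup>2))" by (rule real_sqrt_le_mono)
  then show "norm (L2_class f) \<le> C * weight_norm TYPE('a)"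
    using f' C by (simp add: norm_L2_class real_sqrt_mult weight_norm_def)
qed

lemma schwartz_decay:
  assumes "schwartz f" "set bs \<subseteq> Basis"
  obtains C where "C \<ge> 0" "\<And>x. norm (iterated_partial bs f x) \<le> C / (1 + norm x) ^ k"
proof -
  obtain C where C: "\<And>x. (1 + norm x) ^ k * norm (iterated_partial bs f x) \<le> C"
    using assms unfolding schwartz_def by meson
  have "0 \<le> C" using C[of 0] by (simp add: order_trans[OF norm_ge_zero])
  moreover have "norm (iterated_partial bs f x) \<le> C / (1 + norm x) ^ k" for x
    using C[of x] by (simp add: pos_le_divide_eq add_pos_nonneg mult.commute)
  ultimately show thesis by (rule that)
qed

lemma schwartz_smooth: "schwartz f \<Longrightarrow> smooth f"
  by (simp add: schwartz_def)

lemma smooth_continuous: "smooth f \<Longrightarrow> continuous_on UNIV f"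
  using smooth_iterated_continuous[of f "[]"] by simp

lemma smooth_borel: "smooth f \<Longrightarrow> f \<in> borel_measurable borel"
  by (intro borel_measurable_continuous_onI smooth_continuous)

lemma schwartz_square_integrable:
  fixes f :: "'a::euclidean_space \<Rightarrow> complex"
  assumes "schwartz f"
  shows "square_integrable f"
proof -
  obtain C where "C \<ge> 0" "\<And>x. norm (iterated_partial [] f x) \<le> C / (1 + norm x) ^ DIM('a)"
    using schwartz_decay[OF assms, of "[]" "DIM('a)"] by auto
  then show ?thesis
    using assms by (intro weighted_bound(1)[of f C] borel_imp_lebesgue_measurable smooth_borel schwartz_smooth) auto
qed

text \<open>
  The only density statement that is needed: it gives uniqueness of continuous extensions and
  density of the domain of the generator.
\<close>

lemma test_functions_total:
  fixes V :: "'a::euclidean_space L2 set"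
  assumes V: "subspace V" "closed V" and test: "\<And>f. test_function f \<Longrightarrow> L2_class f \<in> V"
  shows "V = UNIV"
proof (rule L2_closed_subspace_boxes[OF V])
  fix a :: complex and c d :: 'a
  have "(\<lambda>n. L2_class (\<lambda>x. a * of_real (box_bump n c d x))) \<longlonglongrightarrow> L2_class (\<lambda>x. a * indicator (box c d) x)"
  proof (rule L2_dominated_convergence)
    show "(\<lambda>x. a * of_real (box_bump n c d x)) \<in> borel_measurable lebesgue" for n
      using test_function_box_bump[of a n c d]
      by (intro borel_imp_lebesgue_measurable smooth_borel) (simp add: test_function_def)
    show "(\<lambda>x. a * indicator (box c d) x) \<in> borel_measurable lebesgue"
      by (intro borel_imp_lebesgue_measurable) auto
    have "square_integrable (\<lambda>x. a * indicator (box c d) x)"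
      using emeasure_lborel_box_finite[of c d] by (intro square_integrable_indicator) auto
    then show "integrable lebesgue (\<lambda>x. (norm (a * indicator (box c d) x))\<^sup>2)"
      by (simp add: square_integrable_def)
    show "norm (a * of_real (box_bump n c d x)) \<le> norm (a * indicator (box c d) x)" for n x
      using box_bump_bounds[of n c d x] box_bump_eq_0[of x c d n]
      by (cases "x \<in> box c d") (auto simp: norm_mult intro: mult_left_le)
    show "(\<lambda>n. a * of_real (box_bump n c d x)) \<longlonglongrightarrow> a * indicator (box c d) x" for x
    proof -
      have "(\<lambda>n. a * of_real (box_bump n c d x)) \<longlonglongrightarrow> a * of_real (indicator (box c d) x)"
        by (intro tendsto_intros box_bump_tendsto)
      then show ?thesis by (cases "x \<in> box c d") simp_all
    qed
  qed
  moreover have "L2_class (\<lambda>x. a * of_real (box_bump n c d x)) \<in> V" for n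
    by (intro test test_function_box_bump)
  ultimately show "L2_class (\<lambda>x. a * indicator (box c d) x) \<in> V"
    by (rule closed_contains_limit[OF V(2), rotated])
qed

section \<open>The Gaussian measure\<close>

lemma lborel_integral_prod:
  fixes g :: "'a::euclidean_space \<Rightarrow> real \<Rightarrow> real"
  assumes g: "\<And>b. b \<in> Basis \<Longrightarrow> integrable lborel (g b)"
  shows "integrable lborel (\<lambda>x. \<Prod>b\<in>Basis. g b (x \<bullet> b))"
    and "(LINT x|lborel. (\<Prod>b\<in>Basis. g b (x \<bullet> b))) = (\<Prod>b\<in>Basis. LINT t|lborel. g b t)"
proof -
  interpret product_sigma_finite "\<lambda>_::'a. lborel :: real measure" by standard
  let ?P = "\<Pi>\<^sub>M b\<in>(Basis::'a set). (lborel::real measure)"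
  let ?e = "\<lambda>f::'a \<Rightarrow> real. \<Sum>b\<in>Basis. f b *\<^sub>R b"
  have e: "?e \<in> measurable ?P borel" by measurable
  have [measurable]: "g b \<in> borel_measurable borel" if "b \<in> Basis" for b
    using borel_measurable_integrable[OF g[OF that]] by simp
  have g_meas: "(\<lambda>x. \<Prod>b\<in>Basis. g b (x \<bullet> b)) \<in> borel_measurable borel"
    by measurable
  have coord: "(\<Prod>b\<in>Basis. g b (?e f \<bullet> b)) = (\<Prod>b\<in>Basis. g b (f b))" for f
    by (intro prod.cong refl arg_cong[where f = "g _"]) simp
  have int: "integrable ?P (\<lambda>f. \<Prod>b\<in>Basis. g b (f b))"
    by (rule product_integrable_prod) (use g in auto)
  show "integrable lborel (\<lambda>x. \<Prod>b\<in>Basis. g b (x \<bullet> b))"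
    by (subst lborel_eq, subst integrable_distr_eq[OF e g_meas]) (simp only: coord int)
  show "(LINT x|lborel. (\<Prod>b\<in>Basis. g b (x \<bullet> b))) = (\<Prod>b\<in>Basis. LINT t|lborel. g b t)"
    by (subst lborel_eq, subst integral_distr[OF e g_meas])
      (simp only: coord, rule product_integral_prod, use g in auto)
qed

lemma gauss_density_prod:
  fixes \<zeta> :: "'d::finite plane"
  shows "1 / (2 * pi) ^ CARD('d) * exp (- (norm \<zeta>)\<^sup>2 / 2) = (\<Prod>b\<in>Basis. std_normal_density (\<zeta> \<bullet> b))"
proof -
  have "(norm \<zeta>)\<^sup>2 = (\<Sum>b\<in>Basis. (\<zeta> \<bullet> b)\<^sup>2)"
    unfolding power2_norm_eq_inner euclidean_inner[of \<zeta> \<zeta>] by (simp add: power2_eq_square)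
  then have "exp (- (norm \<zeta>)\<^sup>2 / 2) = (\<Prod>b\<in>Basis. exp (- (\<zeta> \<bullet> b)\<^sup>2 / 2))"
    by (simp add: exp_sum[symmetric] sum_negf sum_divide_distrib)
  moreover have "1 / (2 * pi) ^ CARD('d) = (\<Prod>b\<in>(Basis :: 'd plane set). 1 / sqrt (2 * pi))"
  proof -
    have "DIM('d plane) = 2 * CARD('d)" by simp
    then have "(\<Prod>b\<in>(Basis :: 'd plane set). 1 / sqrt (2 * pi)) = ((1 / sqrt (2 * pi))\<^sup>2) ^ CARD('d)"
      by (simp only: prod_constant power_mult)
    also have "(1 / sqrt (2 * pi))\<^sup>2 = 1 / (2 * pi)"
      by (simp only: power_divide real_sqrt_pow2) simp
    finally show ?thesis by (simp only: power_one_over)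
  qed
  ultimately show ?thesis
    by (simp only: std_normal_density_def prod.distrib)
qed

lemma gauss_eq_std_normal:
  "(gauss :: 'd::finite plane measure) = density lborel (\<lambda>\<zeta>. ennreal (\<Prod>b\<in>Basis. std_normal_density (\<zeta> \<bullet> b)))"
  unfolding gauss_def gauss_density_prod ..

lemma sets_gauss [measurable_cong, simp]: "sets gauss = sets borel"
  by (simp add: gauss_def)

lemma space_gauss [simp]: "space gauss = UNIV"
  by (simp add: gauss_def)

text \<open>
  The Gaussian is the product of standard normal distributions, so its moments reduce to those in
  one dimension.
\<close>

lemma gauss_integral_prod:
  fixes g :: "'d::finite plane \<Rightarrow> real \<Rightarrow> real"
  assumes g: "\<And>b. b \<in> Basis \<Longrightarrow> integrable lborel (\<lambda>t. std_normal_density t * g b t)"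
    and [measurable]: "\<And>b. g b \<in> borel_measurable borel"
  shows "integrable gauss (\<lambda>\<zeta>. \<Prod>b\<in>Basis. g b (\<zeta> \<bullet> b))"
    and "(LINT \<zeta>|gauss. (\<Prod>b\<in>Basis. g b (\<zeta> \<bullet> b))) = (\<Prod>b\<in>Basis. LINT t|lborel. std_normal_density t * g b t)"
proof -
  show "integrable gauss (\<lambda>\<zeta>. \<Prod>b\<in>Basis. g b (\<zeta> \<bullet> b))"
    unfolding gauss_eq_std_normal
    by (subst integrable_density) (auto simp: prod.distrib[symmetric] intro!: lborel_integral_prod(1) g prod_nonneg)
  show "(LINT \<zeta>|gauss. (\<Prod>b\<in>Basis. g b (\<zeta> \<bullet> b))) = (\<Prod>b\<in>Basis. LINT t|lborel. std_normal_density t * g b t)"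
    unfolding gauss_eq_std_normal
    by (subst integral_density) (auto simp: prod.distrib[symmetric] intro!: lborel_integral_prod(2) g prod_nonneg)
qed

lemma std_normal_moments:
  "integrable lborel (\<lambda>t. std_normal_density t * 1)" "(LINT t|lborel. std_normal_density t * 1) = 1"
  "integrable lborel (\<lambda>t. std_normal_density t * t)" "(LINT t|lborel. std_normal_density t * t) = 0"
  "integrable lborel (\<lambda>t. std_normal_density t * (t * t))" "(LINT t|lborel. std_normal_density t * (t * t)) = 1"
  using integrable_std_normal_moment[of 0] integral_std_normal_moment_even[of 0]
    integrable_std_normal_moment[of 1] integral_std_normal_moment_odd[of 0]
    integrable_std_normal_moment[of 2] integral_std_normal_moment_even[of 1]
  by (simp_all add: power2_eq_square)

lemma gauss_first_moment:
  fixes b :: "'d::finite plane"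
  assumes b: "b \<in> Basis"
  shows "integrable gauss (\<lambda>\<zeta>. \<zeta> \<bullet> b)" "(LINT \<zeta>|gauss. \<zeta> \<bullet> b) = 0"
proof -
  define g :: "'d plane \<Rightarrow> real \<Rightarrow> real" where "g c t = (if c = b then t else 1)" for c t
  have [measurable]: "g c \<in> borel_measurable borel" for c
    unfolding g_def by measurable
  have prod: "(\<Prod>c\<in>Basis. g c (\<zeta> \<bullet> c)) = \<zeta> \<bullet> b" for \<zeta>
    using b by (simp add: g_def)
  have int: "integrable lborel (\<lambda>t. std_normal_density t * g c t)" for c
    using std_normal_moments by (cases "c = b") (simp_all add: g_def)
  show "integrable gauss (\<lambda>\<zeta>. \<zeta> \<bullet> b)"
    using gauss_integral_prod(1)[of g] int by (simp add: prod)
  have "(LINT \<zeta>|gauss. \<zeta> \<bullet> b) = (\<Prod>c\<in>Basis. LINT t|lborel. std_normal_density t * g c t)"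
    using gauss_integral_prod(2)[of g] int by (simp add: prod)
  also have "\<dots> = 0"
    using b std_normal_moments by (intro prod_zero bexI[of _ b]) (simp_all add: g_def)
  finally show "(LINT \<zeta>|gauss. \<zeta> \<bullet> b) = 0" .
qed

lemma gauss_second_moment:
  fixes a b :: "'d::finite plane"
  assumes ab: "a \<in> Basis" "b \<in> Basis"
  shows "integrable gauss (\<lambda>\<zeta>. (\<zeta> \<bullet> a) * (\<zeta> \<bullet> b))"
    "(LINT \<zeta>|gauss. (\<zeta> \<bullet> a) * (\<zeta> \<bullet> b)) = (if a = b then 1 else 0)"
proof -
  define g :: "'d plane \<Rightarrow> real \<Rightarrow> real"
    where "g c t = (if c = a then t else 1) * (if c = b then t else 1)" for c t
  have [measurable]: "g c \<in> borel_measurable borel" for c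
    unfolding g_def by measurable
  have prod: "(\<Prod>c\<in>Basis. g c (\<zeta> \<bullet> c)) = (\<zeta> \<bullet> a) * (\<zeta> \<bullet> b)" for \<zeta>
    using ab by (simp add: g_def prod.distrib)
  have int: "integrable lborel (\<lambda>t. std_normal_density t * g c t)" for c
    using std_normal_moments by (cases "c = a"; cases "c = b") (simp_all add: g_def)
  show "integrable gauss (\<lambda>\<zeta>. (\<zeta> \<bullet> a) * (\<zeta> \<bullet> b))"
    using gauss_integral_prod(1)[of g] int by (simp add: prod)
  have "(LINT \<zeta>|gauss. (\<zeta> \<bullet> a) * (\<zeta> \<bullet> b)) = (\<Prod>c\<in>Basis. LINT t|lborel. std_normal_density t * g c t)"
    using gauss_integral_prod(2)[of g] int by (simp add: prod)
  also have "\<dots> = (if a = b then 1 else 0)"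
  proof (cases "a = b")
    case True
    then have "(LINT t|lborel. std_normal_density t * g c t) = 1" for c
      using std_normal_moments by (cases "c = a") (simp_all add: g_def)
    then show ?thesis using True by simp
  next
    case False
    then have "(\<Prod>c\<in>Basis. LINT t|lborel. std_normal_density t * g c t) = 0"
      using ab std_normal_moments by (intro prod_zero bexI[of _ a]) (simp_all add: g_def)
    then show ?thesis using False by simp
  qed
  finally show "(LINT \<zeta>|gauss. (\<zeta> \<bullet> a) * (\<zeta> \<bullet> b)) = (if a = b then 1 else 0)" .
qed

lemma prob_space_gauss: "prob_space (gauss :: 'd::finite plane measure)"
proof
  have int: "integrable gauss (\<lambda>_::'d plane. 1::real)" "(LINT \<zeta>|(gauss :: 'd plane measure). 1::real) = 1"
    using gauss_integral_prod[where g = "\<lambda>(b::'d plane) t. 1"] std_normal_moments by simp_all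
  have "emeasure (gauss :: 'd plane measure) UNIV = (\<integral>\<^sup>+ \<zeta>. ennreal 1 \<partial>(gauss :: 'd plane measure))"
    by simp
  also have "\<dots> = 1"
    by (subst nn_integral_eq_integral) (use int in auto)
  finally show "emeasure gauss (space (gauss :: 'd plane measure)) = 1" by simp
qed

lemma one_plus_sum_le_prod:
  "finite I \<Longrightarrow> (\<And>i. i \<in> I \<Longrightarrow> a i \<ge> 0) \<Longrightarrow> 1 + (\<Sum>i\<in>I. a i) \<le> (\<Prod>i\<in>I. 1 + a i :: real)"
proof (induction I rule: finite_induct)
  case (insert i I)
  have "1 + (\<Sum>j\<in>insert i I. a j) \<le> (1 + a i) * (1 + (\<Sum>j\<in>I. a j))"
    using insert by (simp add: algebra_simps sum_nonneg)
  also have "\<dots> \<le> (1 + a i) * (\<Prod>j\<in>I. 1 + a j)"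
    using insert by (intro mult_left_mono) (auto intro: add_nonneg_nonneg)
  finally show ?case using insert by simp
qed simp

text \<open>
  The bound \<open>1 + \<bar>\<zeta>\<bar> \<le> \<Prod>\<^sub>b (1 + \<bar>\<zeta>\<^sub>b\<bar>)\<close> reduces the claim to one dimension.
\<close>

lemma gauss_polynomial_moment: "integrable gauss (\<lambda>\<zeta>::'d::finite plane. (1 + norm \<zeta>) ^ N)"
proof -
  have "integrable gauss (\<lambda>\<zeta>::'d plane. \<Prod>b\<in>Basis. (1 + \<bar>\<zeta> \<bullet> b\<bar>) ^ N)"
  proof (rule gauss_integral_prod)
    show "integrable lborel (\<lambda>t. std_normal_density t * (1 + \<bar>t\<bar>) ^ N)"
    proof (rule Bochner_Integration.integrable_bound)
      show "integrable lborel (\<lambda>t. 2 ^ N * (std_normal_density t * \<bar>t\<bar> ^ 0) + 2 ^ N * (std_normal_density t * \<bar>t\<bar> ^ N))"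
        by (intro Bochner_Integration.integrable_add integrable_mult_right integrable_std_normal_moment_abs)
      show "AE t in lborel. norm (std_normal_density t * (1 + \<bar>t\<bar>) ^ N)
          \<le> norm (2 ^ N * (std_normal_density t * \<bar>t\<bar> ^ 0) + 2 ^ N * (std_normal_density t * \<bar>t\<bar> ^ N))"
      proof (rule AE_I2)
        fix t :: real
        have "(1 + \<bar>t\<bar>) ^ N \<le> 2 ^ N * (1 + \<bar>t\<bar> ^ N)"
        proof (cases "\<bar>t\<bar> \<le> 1")
          case True
          then have "(1 + \<bar>t\<bar>) ^ N \<le> 2 ^ N" by (intro power_mono) auto
          also have "\<dots> \<le> 2 ^ N * (1 + \<bar>t\<bar> ^ N)" by simp
          finally show ?thesis .
        next
          case False
          then have "(1 + \<bar>t\<bar>) ^ N \<le> (2 * \<bar>t\<bar>) ^ N" by (intro power_mono) auto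
          also have "\<dots> \<le> 2 ^ N * (1 + \<bar>t\<bar> ^ N)" by (simp add: power_mult_distrib)
          finally show ?thesis .
        qed
        then have "std_normal_density t * (1 + \<bar>t\<bar>) ^ N \<le> std_normal_density t * (2 ^ N * (1 + \<bar>t\<bar> ^ N))"
          by (rule mult_left_mono) simp
        then show "norm (std_normal_density t * (1 + \<bar>t\<bar>) ^ N)
            \<le> norm (2 ^ N * (std_normal_density t * \<bar>t\<bar> ^ 0) + 2 ^ N * (std_normal_density t * \<bar>t\<bar> ^ N))"
          by (simp add: algebra_simps abs_mult)
      qed
    qed measurable
  qed measurable
  then show ?thesis
  proof (rule Bochner_Integration.integrable_bound)
    show "AE \<zeta> in (gauss :: 'd plane measure). norm ((1 + norm \<zeta>) ^ N) \<le> norm (\<Prod>b\<in>Basis. (1 + \<bar>\<zeta> \<bullet> b\<bar>) ^ N)"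
    proof (rule AE_I2)
      fix \<zeta> :: "'d plane"
      have "1 + norm \<zeta> \<le> 1 + (\<Sum>b\<in>Basis. \<bar>\<zeta> \<bullet> b\<bar>)" using norm_le_l1[of \<zeta>] by simp
      also have "\<dots> \<le> (\<Prod>b\<in>Basis. 1 + \<bar>\<zeta> \<bullet> b\<bar>)" by (rule one_plus_sum_le_prod) auto
      finally have "(1 + norm \<zeta>) ^ N \<le> (\<Prod>b\<in>Basis. 1 + \<bar>\<zeta> \<bullet> b\<bar>) ^ N" by (rule power_mono) simp
      then have "(1 + norm \<zeta>) ^ N \<le> (\<Prod>b\<in>Basis. (1 + \<bar>\<zeta> \<bullet> b\<bar>) ^ N)" by (simp only: prod_power_distrib)
      then show "norm ((1 + norm \<zeta>) ^ N) \<le> norm (\<Prod>b\<in>Basis. (1 + \<bar>\<zeta> \<bullet> b\<bar>) ^ N)"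
        by (auto intro: order_trans)
    qed
  qed measurable
qed

section \<open>Averaging over horizontal translations\<close>

text \<open>
  Right translation of \<open>p\<close> by the group element \<open>(r \<zeta>, 0)\<close>.
\<close>

definition horizontal_shift :: "real \<Rightarrow> 'd::finite heis \<Rightarrow> 'd plane \<Rightarrow> 'd heis" where
  "horizontal_shift r p \<zeta> = (fst p + r *\<^sub>R \<zeta>, snd p + r * (fst p \<bullet>\<^sub>\<sigma> \<zeta>))"

definition gauss_mean :: "real \<Rightarrow> ('d::finite heis \<Rightarrow> complex) \<Rightarrow> 'd heis \<Rightarrow> complex" where
  "gauss_mean r f p = (LINT \<zeta>|gauss. f (horizontal_shift r p \<zeta>))"

lemma S_pre_eq: "S_pre c \<tau> f = (\<lambda>p. gauss_mean (sqrt \<tau>) f p + (\<tau> * c p) *\<^sub>R f p)"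
  by (auto simp: S_pre_def gauss_mean_def horizontal_shift_def fun_eq_iff)

lemma continuous_horizontal_shift:
  "continuous_on UNIV (\<lambda>(p, \<zeta>). horizontal_shift r p \<zeta>)"
  unfolding horizontal_shift_def sigma_prod_def split_beta
  by (intro continuous_intros)

lemma horizontal_shift_measurable [measurable]:
  "(\<lambda>(p, \<zeta>). horizontal_shift r p \<zeta>) \<in> borel \<Otimes>\<^sub>M borel \<rightarrow>\<^sub>M borel"
  unfolding borel_prod by (rule borel_measurable_continuous_onI[OF continuous_horizontal_shift])

lemma horizontal_shift_measurable':
  "(\<lambda>p. horizontal_shift r p \<zeta>) \<in> borel \<rightarrow>\<^sub>M borel" "horizontal_shift r p \<in> borel \<rightarrow>\<^sub>M borel"
  unfolding horizontal_shift_def sigma_prod_def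
  by (intro borel_measurable_continuous_onI continuous_intros)+

lemma nn_integral_translate:
  fixes a :: "'a::euclidean_space"
  assumes [measurable]: "g \<in> borel_measurable borel"
  shows "(\<integral>\<^sup>+ x. g (x + a) \<partial>lborel) = (\<integral>\<^sup>+ x. g x \<partial>lborel)"
proof -
  have "(\<integral>\<^sup>+ x. g x \<partial>lborel) = (\<integral>\<^sup>+ x. g x \<partial>distr lborel borel ((+) a))"
    by (simp only: lborel_distr_plus)
  also have "\<dots> = (\<integral>\<^sup>+ x. g (a + x) \<partial>lborel)"
    by (rule nn_integral_distr) measurable
  finally show ?thesis by (simp add: add.commute)
qed

text \<open>
  For fixed \<open>\<zeta>\<close> the shift is a translation in the central variable by an amount depending only on \<open>z\<close>,
  followed by a translation in \<open>z\<close>.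
\<close>

lemma nn_integral_horizontal_shift:
  fixes g :: "'d::finite heis \<Rightarrow> ennreal"
  assumes g[measurable]: "g \<in> borel_measurable borel"
  shows "(\<integral>\<^sup>+ p. g (horizontal_shift r p \<zeta>) \<partial>lborel) = (\<integral>\<^sup>+ p. g p \<partial>lborel)"
proof -
  have g'[measurable]: "g \<in> borel_measurable (lborel \<Otimes>\<^sub>M lborel)"
    using g by (simp add: lborel_prod)
  have shift: "(\<lambda>p. g (horizontal_shift r p \<zeta>)) \<in> borel_measurable (lborel \<Otimes>\<^sub>M lborel)"
    using measurable_compose[OF horizontal_shift_measurable'(1) g] by (simp add: lborel_prod)
  have [measurable]: "(\<lambda>s. g (z, s)) \<in> borel_measurable borel" for z
    using measurable_Pair2[OF g', of z] by simp
  have [measurable]: "(\<lambda>z. \<integral>\<^sup>+ s. g (z, s) \<partial>lborel) \<in> borel_measurable borel"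
    using lborel.borel_measurable_nn_integral_fst[OF g'] by simp
  have "(\<integral>\<^sup>+ p. g (horizontal_shift r p \<zeta>) \<partial>lborel)
      = (\<integral>\<^sup>+ p. g (horizontal_shift r p \<zeta>) \<partial>(lborel \<Otimes>\<^sub>M lborel))"
    by (simp only: lborel_prod)
  also have "\<dots> = (\<integral>\<^sup>+ z. \<integral>\<^sup>+ s. g (horizontal_shift r (z, s) \<zeta>) \<partial>lborel \<partial>lborel)"
    by (rule lborel.nn_integral_fst[OF shift, symmetric])
  also have "\<dots> = (\<integral>\<^sup>+ z. \<integral>\<^sup>+ s. g (z + r *\<^sub>R \<zeta>, s) \<partial>lborel \<partial>lborel)"
    by (rule nn_integral_cong, simp only: horizontal_shift_def fst_conv snd_conv)
      (rule nn_integral_translate, measurable)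
  also have "\<dots> = (\<integral>\<^sup>+ z. \<integral>\<^sup>+ s. g (z, s) \<partial>lborel \<partial>lborel)"
    by (rule nn_integral_translate) measurable
  also have "\<dots> = (\<integral>\<^sup>+ p. g p \<partial>(lborel \<Otimes>\<^sub>M lborel))"
    by (rule lborel.nn_integral_fst[OF g'])
  finally show ?thesis by (simp only: lborel_prod)
qed

lemma nn_integral_gauss_shift:
  fixes g :: "'d::finite heis \<Rightarrow> ennreal"
  assumes g[measurable]: "g \<in> borel_measurable borel"
  shows "(\<integral>\<^sup>+ p. \<integral>\<^sup>+ \<zeta>. g (horizontal_shift r p \<zeta>) \<partial>gauss \<partial>lborel) = (\<integral>\<^sup>+ p. g p \<partial>lborel)"
proof -
  interpret G: prob_space "gauss :: 'd plane measure" by (rule prob_space_gauss)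
  interpret pair_sigma_finite "lborel :: 'd heis measure" "gauss :: 'd plane measure" ..
  have meas: "(\<lambda>(p, \<zeta>). g (horizontal_shift r p \<zeta>)) \<in> borel_measurable (lborel \<Otimes>\<^sub>M gauss)"
    by measurable
  have "(\<integral>\<^sup>+ p. \<integral>\<^sup>+ \<zeta>. g (horizontal_shift r p \<zeta>) \<partial>gauss \<partial>lborel)
      = (\<integral>\<^sup>+ \<zeta>. \<integral>\<^sup>+ p. g (horizontal_shift r p \<zeta>) \<partial>lborel \<partial>gauss)"
    by (rule Fubini'[OF meas, symmetric])
  also have "\<dots> = (\<integral>\<^sup>+ \<zeta>. (\<integral>\<^sup>+ p. g p \<partial>lborel) \<partial>(gauss :: 'd plane measure))"
    by (intro nn_integral_cong nn_integral_horizontal_shift g)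
  also have "\<dots> = (\<integral>\<^sup>+ p. g p \<partial>lborel)"
    using G.emeasure_space_1 by simp
  finally show ?thesis .
qed

text \<open>
  Jensen's inequality for the square, obtained from the nonnegativity of the variance.
\<close>

lemma (in prob_space) nn_integral_square_Jensen:
  fixes F :: "'a \<Rightarrow> complex"
  assumes F[measurable]: "F \<in> borel_measurable M"
    and fin: "(\<integral>\<^sup>+ x. ennreal ((norm (F x))\<^sup>2) \<partial>M) < \<infinity>"
  shows "integrable M F" "ennreal ((norm (LINT x|M. F x))\<^sup>2) \<le> (\<integral>\<^sup>+ x. ennreal ((norm (F x))\<^sup>2) \<partial>M)"
proof -
  have sq: "integrable M (\<lambda>x. (norm (F x))\<^sup>2)"
    using fin by (intro integrableI_bounded) auto
  show int: "integrable M F"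
  proof (rule Bochner_Integration.integrable_bound)
    show "integrable M (\<lambda>x. 1 + (norm (F x))\<^sup>2)" using sq by simp
    show "AE x in M. norm (F x) \<le> norm (1 + (norm (F x))\<^sup>2)"
    proof (rule AE_I2)
      fix x
      have "2 * norm (F x) \<le> 1 + (norm (F x))\<^sup>2"
        using sum_squares_bound[of 1 "norm (F x)"] by simp
      then show "norm (F x) \<le> norm (1 + (norm (F x))\<^sup>2)"
        using norm_ge_zero[of "F x"] by (simp only: real_norm_def)
    qed
  qed measurable
  have "norm (LINT x|M. F x) \<le> (LINT x|M. norm (F x))" by (rule integral_norm_bound)
  then have "(norm (LINT x|M. F x))\<^sup>2 \<le> (LINT x|M. norm (F x))\<^sup>2" by (rule power_mono) simp
  also have "\<dots> \<le> (LINT x|M. (norm (F x))\<^sup>2)"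
    using variance_positive[of "\<lambda>x. norm (F x)"] variance_eq[of "\<lambda>x. norm (F x)"] int sq by simp
  finally have "ennreal ((norm (LINT x|M. F x))\<^sup>2) \<le> ennreal (LINT x|M. (norm (F x))\<^sup>2)"
    by (rule ennreal_leI)
  then show "ennreal ((norm (LINT x|M. F x))\<^sup>2) \<le> (\<integral>\<^sup>+ x. ennreal ((norm (F x))\<^sup>2) \<partial>M)"
    using sq by (simp add: nn_integral_eq_integral)
qed

lemma gauss_mean_measurable [measurable]:
  fixes f :: "'d::finite heis \<Rightarrow> complex"
  assumes [measurable]: "f \<in> borel_measurable borel"
  shows "gauss_mean r f \<in> borel_measurable borel"
proof -
  interpret G: prob_space "gauss :: 'd plane measure" by (rule prob_space_gauss)
  show ?thesis unfolding gauss_mean_def[abs_def]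
    by (rule G.borel_measurable_lebesgue_integral) measurable
qed

context
  fixes f :: "'d::finite heis \<Rightarrow> complex"
  assumes f[measurable]: "f \<in> borel_measurable borel" and sq: "square_integrable f"
begin

lemma AE_finite_shift:
  "AE p in lborel. (\<integral>\<^sup>+ \<zeta>. ennreal ((norm (f (horizontal_shift r p \<zeta>)))\<^sup>2) \<partial>gauss) < \<infinity>"
proof -
  interpret G: prob_space "gauss :: 'd plane measure" by (rule prob_space_gauss)
  have "(\<integral>\<^sup>+ p. \<integral>\<^sup>+ \<zeta>. ennreal ((norm (f (horizontal_shift r p \<zeta>)))\<^sup>2) \<partial>gauss \<partial>lborel)
      = (\<integral>\<^sup>+ p. ennreal ((norm (f p))\<^sup>2) \<partial>lborel)"
    by (rule nn_integral_gauss_shift) measurable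
  also have "\<dots> < \<infinity>"
    using sq by (simp add: square_integrable_iff_nn_integral nn_integral_completion)
  finally have "AE p in lborel. (\<integral>\<^sup>+ \<zeta>. ennreal ((norm (f (horizontal_shift r p \<zeta>)))\<^sup>2) \<partial>gauss) \<noteq> \<infinity>"
    by (intro nn_integral_PInf_AE G.borel_measurable_nn_integral) auto
  then show ?thesis by (simp add: less_top)
qed

lemma shift_measurable_gauss: "(\<lambda>\<zeta>. f (horizontal_shift r p \<zeta>)) \<in> borel_measurable gauss"
  using measurable_compose[OF horizontal_shift_measurable'(2) f]
  by (simp cong: measurable_cong_sets)

lemma AE_shift_integrable: "AE p in lborel. integrable gauss (\<lambda>\<zeta>. f (horizontal_shift r p \<zeta>))"
  using AE_finite_shift
  by eventually_elim (rule prob_space.nn_integral_square_Jensen(1)[OF prob_space_gauss shift_measurable_gauss])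

text \<open>
  Jensen's inequality for the inner integral, then Tonelli and the invariance of Lebesgue measure.
\<close>

lemma gauss_mean_contraction:
  shows "square_integrable (gauss_mean r f)" "norm (L2_class (gauss_mean r f)) \<le> norm (L2_class f)"
proof -
  have "(\<integral>\<^sup>+ p. ennreal ((norm (gauss_mean r f p))\<^sup>2) \<partial>lebesgue)
      = (\<integral>\<^sup>+ p. ennreal ((norm (gauss_mean r f p))\<^sup>2) \<partial>lborel)"
    by (rule nn_integral_completion)
  also have "\<dots> \<le> (\<integral>\<^sup>+ p. \<integral>\<^sup>+ \<zeta>. ennreal ((norm (f (horizontal_shift r p \<zeta>)))\<^sup>2) \<partial>gauss \<partial>lborel)"
    using AE_finite_shift[of r] unfolding gauss_mean_def
    by (intro nn_integral_mono_AE, eventually_elim)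
      (rule prob_space.nn_integral_square_Jensen(2)[OF prob_space_gauss shift_measurable_gauss])
  also have "\<dots> = (\<integral>\<^sup>+ p. ennreal ((norm (f p))\<^sup>2) \<partial>lborel)"
    by (rule nn_integral_gauss_shift) measurable
  also have "\<dots> = ennreal ((norm (L2_class f))\<^sup>2)"
    using nn_integral_L2_class[OF sq] by (simp add: nn_integral_completion)
  finally have "(\<integral>\<^sup>+ p. ennreal ((norm (gauss_mean r f p))\<^sup>2) \<partial>lebesgue) \<le> ennreal ((norm (L2_class f))\<^sup>2)" .
  then show "square_integrable (gauss_mean r f)" "norm (L2_class (gauss_mean r f)) \<le> norm (L2_class f)"
    using square_integrable_norm_le[OF borel_imp_lebesgue_measurable[OF gauss_mean_measurable[OF f]] norm_ge_zero]
    by blast+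
qed

end

section \<open>The one-step operators\<close>

text \<open>
  For each point the average runs over a hyperplane, which is a null set, and the integrand must be
  measurable jointly in the point and the Gaussian variable. Lebesgue measurability of \<open>f\<close> does not
  guarantee this, a Borel representative does.
\<close>

definition borel_rep :: "'a::euclidean_space L2 \<Rightarrow> 'a \<Rightarrow> complex" where
  "borel_rep u = (SOME f. f \<in> borel_measurable borel \<and> square_integrable f \<and> L2_class f = u)"

lemma borel_rep:
  shows "borel_rep u \<in> borel_measurable borel" "square_integrable (borel_rep u)" "L2_class (borel_rep u) = u"
proof -
  have "\<exists>f. f \<in> borel_measurable borel \<and> square_integrable f \<and> L2_class f = u"
    using L2_Borel_representative[of u] by metis
  then have "borel_rep u \<in> borel_measurable borel \<and> square_integrable (borel_rep u) \<and> L2_class (borel_rep u) = u"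
    unfolding borel_rep_def by (rule someI_ex)
  then show "borel_rep u \<in> borel_measurable borel" "square_integrable (borel_rep u)" "L2_class (borel_rep u) = u"
    by auto
qed

lemma scaleR_eq_scaleC: "r *\<^sub>R u = scaleC_L2 (of_real r) u"
proof -
  have "r *\<^sub>R L2_class (borel_rep u) = scaleC_L2 (of_real r) (L2_class (borel_rep u))"
    by (simp add: L2_class_scaleR L2_class_scaleC borel_rep(2) scaleR_conv_of_real)
  then show ?thesis by (simp add: borel_rep)
qed

definition heat :: "real \<Rightarrow> 'd::finite heis L2 \<Rightarrow> 'd heis L2" where
  "heat r u = L2_class (gauss_mean r (borel_rep u))"

text \<open>
  Additivity holds only almost everywhere: at exceptional points one of the integrals may not exist.
\<close>

lemma gauss_mean_lincomb:
  fixes f g :: "'d::finite heis \<Rightarrow> complex"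
  assumes f: "f \<in> borel_measurable borel" "square_integrable f"
    and g: "g \<in> borel_measurable borel" "square_integrable g"
  shows "AE p in lebesgue. gauss_mean r (\<lambda>p. a * f p + b * g p) p = a * gauss_mean r f p + b * gauss_mean r g p"
  using AE_completion[OF AE_shift_integrable[OF f, of r]] AE_completion[OF AE_shift_integrable[OF g, of r]]
  by eventually_elim (simp add: gauss_mean_def)

text \<open>
  Independence of the representative: the average of a function that vanishes almost everywhere
  has norm zero, being an image under a contraction.
\<close>

lemma heat_L2_class:
  fixes f :: "'d::finite heis \<Rightarrow> complex"
  assumes f: "f \<in> borel_measurable borel" "square_integrable f"
  shows "heat r (L2_class f) = L2_class (gauss_mean r f)"
proof -
  define g where "g = borel_rep (L2_class f)"
  have g: "g \<in> borel_measurable borel" "square_integrable g" and gf: "L2_class g = L2_class f"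
    by (simp_all add: g_def borel_rep)
  have d: "(\<lambda>p. 1 * g p + (- 1) * f p) \<in> borel_measurable borel" "square_integrable (\<lambda>p. 1 * g p + (- 1) * f p)"
    using f g by (auto intro: square_integrable_diff)
  have "L2_class (gauss_mean r g) - L2_class (gauss_mean r f)
      = L2_class (\<lambda>p. gauss_mean r g p - gauss_mean r f p)"
    using f g by (intro L2_class_diff gauss_mean_contraction(1))
  also have "\<dots> = L2_class (gauss_mean r (\<lambda>p. 1 * g p + (- 1) * f p))"
    using gauss_mean_lincomb[OF g f, of r 1 "- 1"] f g
    by (intro L2_class_cong gauss_mean_contraction(1)[OF d] square_integrable_diff gauss_mean_contraction(1))
      auto
  finally have eq: "L2_class (gauss_mean r g) - L2_class (gauss_mean r f) = \<dots>" .
  have "norm (L2_class (gauss_mean r g) - L2_class (gauss_mean r f)) \<le> norm (L2_class (\<lambda>p. 1 * g p + (- 1) * f p))"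
    unfolding eq by (rule gauss_mean_contraction(2)[OF d])
  also have "L2_class (\<lambda>p. 1 * g p + (- 1) * f p) = L2_class g - L2_class f"
    using f g by (simp add: L2_class_diff)
  finally show ?thesis using gf by (simp add: heat_def g_def)
qed

lemma heat_lincomb:
  "heat r (scaleC_L2 a u + scaleC_L2 b v) = scaleC_L2 a (heat r u) + scaleC_L2 b (heat r v)"
proof -
  define f g where "f = borel_rep u" and "g = borel_rep v"
  have f: "f \<in> borel_measurable borel" "square_integrable f" "L2_class f = u"
    and g: "g \<in> borel_measurable borel" "square_integrable g" "L2_class g = v"
    by (simp_all add: f_def g_def borel_rep)
  have s: "(\<lambda>p. a * f p + b * g p) \<in> borel_measurable borel" "square_integrable (\<lambda>p. a * f p + b * g p)"
    using f g by (auto intro: square_integrable_add square_integrable_mult)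
  have "scaleC_L2 a u + scaleC_L2 b v = L2_class (\<lambda>p. a * f p + b * g p)"
    using f g by (auto simp: L2_class_scaleC L2_class_add square_integrable_mult)
  then have "heat r (scaleC_L2 a u + scaleC_L2 b v) = L2_class (gauss_mean r (\<lambda>p. a * f p + b * g p))"
    by (simp add: heat_L2_class[OF s])
  also have "\<dots> = L2_class (\<lambda>p. a * gauss_mean r f p + b * gauss_mean r g p)"
    using gauss_mean_lincomb[OF f(1,2) g(1,2)] f g
    by (intro L2_class_cong gauss_mean_contraction(1)[OF s] square_integrable_add square_integrable_mult
        gauss_mean_contraction(1)) auto
  also have "\<dots> = scaleC_L2 a (L2_class (gauss_mean r f)) + scaleC_L2 b (L2_class (gauss_mean r g))"
    using f g by (simp add: L2_class_scaleC L2_class_add square_integrable_mult gauss_mean_contraction(1))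
  finally show ?thesis by (simp add: heat_def f_def g_def)
qed

lemma scaleC_zero_one: "scaleC_L2 0 u = 0" "scaleC_L2 1 u = u"
  using scaleR_eq_scaleC[of 0 u] scaleR_eq_scaleC[of 1 u] by simp_all

lemma heat_add: "heat r (u + v) = heat r u + heat r v"
  using heat_lincomb[of r 1 u 1 v] by (simp add: scaleC_zero_one)

lemma heat_scaleC: "heat r (scaleC_L2 a u) = scaleC_L2 a (heat r u)"
  using heat_lincomb[of r a u 0 u] by (simp add: scaleC_zero_one)

lemma heat_contraction: "norm (heat r u) \<le> norm u"
  using gauss_mean_contraction(2)[OF borel_rep(1,2), of r u] by (simp add: heat_def borel_rep(3))

lemma essentially_boundedE:
  assumes "essentially_bounded c"
  obtains C where "C \<ge> 0" "AE x in lebesgue. \<bar>c x\<bar> \<le> C" "c \<in> borel_measurable lebesgue"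
proof -
  obtain C where "AE x in lebesgue. \<bar>c x\<bar> \<le> C" "c \<in> borel_measurable lebesgue"
    using assms by (auto simp: essentially_bounded_def)
  then show thesis by (intro that[of "max C 0"]) (auto elim: eventually_mono)
qed

lemma multiplication_bound:
  assumes c: "c \<in> borel_measurable lebesgue" "AE x in lebesgue. \<bar>c x\<bar> \<le> C" "C \<ge> 0"
    and f: "square_integrable f"
  shows "square_integrable (\<lambda>x. c x *\<^sub>R f x)" "norm (L2_class (\<lambda>x. c x *\<^sub>R f x)) \<le> C * norm (L2_class f)"
proof -
  note [measurable] = c(1) square_integrable_measurable[OF f]
  have "(\<integral>\<^sup>+ x. ennreal ((norm (c x *\<^sub>R f x))\<^sup>2) \<partial>lebesgue) \<le> (\<integral>\<^sup>+ x. ennreal (C\<^sup>2) * ennreal ((norm (f x))\<^sup>2) \<partial>lebesgue)"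
    using c(2)
  proof (intro nn_integral_mono_AE, eventually_elim)
    case (elim x)
    have "(norm (c x *\<^sub>R f x))\<^sup>2 \<le> (C * norm (f x))\<^sup>2"
      using elim by (intro power_mono) (auto intro: mult_right_mono)
    then show ?case by (simp add: ennreal_mult[symmetric] power_mult_distrib ennreal_leI)
  qed
  also have "\<dots> = ennreal (C\<^sup>2) * ennreal ((norm (L2_class f))\<^sup>2)"
    by (simp add: nn_integral_cmult nn_integral_L2_class[OF f])
  also have "\<dots> = ennreal ((C * norm (L2_class f))\<^sup>2)"
    by (simp add: ennreal_mult[symmetric] power_mult_distrib)
  finally have le: "(\<integral>\<^sup>+ x. ennreal ((norm (c x *\<^sub>R f x))\<^sup>2) \<partial>lebesgue) \<le> ennreal ((C * norm (L2_class f))\<^sup>2)" .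
  have m: "(\<lambda>x. c x *\<^sub>R f x) \<in> borel_measurable lebesgue" by measurable
  have nn: "C * norm (L2_class f) \<ge> 0" using c(3) by simp
  show "square_integrable (\<lambda>x. c x *\<^sub>R f x)" "norm (L2_class (\<lambda>x. c x *\<^sub>R f x)) \<le> C * norm (L2_class f)"
    using square_integrable_norm_le[OF m nn le] by auto
qed

lemma mult_L2_class:
  assumes c: "essentially_bounded c" and f: "square_integrable f"
  shows "square_integrable (\<lambda>x. c x *\<^sub>R f x)" "mult_L2 c (L2_class f) = L2_class (\<lambda>x. c x *\<^sub>R f x)"
proof -
  obtain C where C: "c \<in> borel_measurable lebesgue" "AE x in lebesgue. \<bar>c x\<bar> \<le> C" "C \<ge> 0"
    using essentially_boundedE[OF c] by metis
  show sq: "square_integrable (\<lambda>x. c x *\<^sub>R f x)" by (rule multiplication_bound(1)[OF C f])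
  show "mult_L2 c (L2_class f) = L2_class (\<lambda>x. c x *\<^sub>R f x)"
    unfolding mult_L2_def using L2_rep_class[OF f]
    by (intro L2_class_cong sq multiplication_bound(1)[OF C square_integrable_L2_rep]) (auto elim: eventually_mono)
qed

lemma mult_L2_bounded:
  assumes c: "essentially_bounded c"
  obtains C where "C \<ge> 0" "\<And>u. norm (mult_L2 c u) \<le> C * norm u"
proof -
  obtain C where C: "c \<in> borel_measurable lebesgue" "AE x in lebesgue. \<bar>c x\<bar> \<le> C" "C \<ge> 0"
    using essentially_boundedE[OF c] by metis
  have "norm (mult_L2 c u) \<le> C * norm u" for u
    using multiplication_bound(2)[OF C square_integrable_L2_rep, of u] by (simp add: mult_L2_def)
  with C(3) show thesis by (rule that)
qed

lemma mult_L2_add: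
  assumes c: "essentially_bounded c"
  shows "mult_L2 c (u + v) = mult_L2 c u + mult_L2 c v"
proof -
  have "mult_L2 c (L2_class (borel_rep u) + L2_class (borel_rep v))
      = mult_L2 c (L2_class (borel_rep u)) + mult_L2 c (L2_class (borel_rep v))"
    by (simp add: L2_class_add borel_rep(2) mult_L2_class[OF c] square_integrable_add scaleR_add_right)
  then show ?thesis by (simp add: borel_rep)
qed

lemma mult_L2_scaleC:
  assumes c: "essentially_bounded c"
  shows "mult_L2 c (scaleC_L2 a u) = scaleC_L2 a (mult_L2 c u)"
proof -
  have "mult_L2 c (scaleC_L2 a (L2_class (borel_rep u))) = scaleC_L2 a (mult_L2 c (L2_class (borel_rep u)))"
    by (simp add: L2_class_scaleC borel_rep(2) mult_L2_class[OF c] square_integrable_mult)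
  then show ?thesis by (simp add: borel_rep)
qed

lemma bounded_linear_mult_L2:
  assumes c: "essentially_bounded c"
  shows "bounded_linear (mult_L2 c)"
proof -
  obtain C where "\<And>u. norm (mult_L2 c u) \<le> C * norm u" using mult_L2_bounded[OF c] by metis
  then show ?thesis
    by (intro bounded_linear_intro[where K = C])
      (auto simp: mult_L2_add[OF c] mult_L2_scaleC[OF c] scaleR_eq_scaleC mult.commute)
qed

lemma bounded_linear_heat: "bounded_linear (heat r)"
  by (intro bounded_linear_intro[where K = 1])
    (auto simp: heat_add heat_scaleC scaleR_eq_scaleC heat_contraction)

definition step_op :: "('d::finite heis \<Rightarrow> real) \<Rightarrow> real \<Rightarrow> 'd heis L2 \<Rightarrow> 'd heis L2" where
  "step_op c \<tau> u = heat (sqrt \<tau>) u + \<tau> *\<^sub>R mult_L2 c u"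

lemma scaleC_add: "scaleC_L2 a (u + v) = scaleC_L2 a u + scaleC_L2 a v"
proof -
  have "scaleC_L2 a (L2_class (borel_rep u) + L2_class (borel_rep v))
      = scaleC_L2 a (L2_class (borel_rep u)) + scaleC_L2 a (L2_class (borel_rep v))"
    by (simp add: L2_class_add L2_class_scaleC borel_rep(2) square_integrable_add square_integrable_mult distrib_left)
  then show ?thesis by (simp add: borel_rep)
qed

lemma scaleC_scaleC: "scaleC_L2 a (scaleC_L2 b u) = scaleC_L2 (a * b) u"
proof -
  have "scaleC_L2 a (scaleC_L2 b (L2_class (borel_rep u))) = scaleC_L2 (a * b) (L2_class (borel_rep u))"
    by (simp add: L2_class_scaleC borel_rep(2) square_integrable_mult mult.assoc)
  then show ?thesis by (simp add: borel_rep)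
qed

lemma bounded_clinear_step_op:
  assumes c: "essentially_bounded c"
  shows "bounded_clinear_L2 (step_op c \<tau>)"
  unfolding bounded_clinear_L2_def
proof (intro conjI allI)
  show "bounded_linear (step_op c \<tau>)"
    unfolding step_op_def[abs_def]
    by (intro bounded_linear_add bounded_linear_heat bounded_linear_compose[OF bounded_linear_scaleR_right bounded_linear_mult_L2[OF c]])
  show "step_op c \<tau> (scaleC_L2 a u) = scaleC_L2 a (step_op c \<tau> u)" for a u
    by (simp add: step_op_def heat_scaleC mult_L2_scaleC[OF c] scaleC_add scaleR_eq_scaleC scaleC_scaleC mult.commute)
qed

lemma step_op_L2_class:
  fixes f :: "'d::finite heis \<Rightarrow> complex"
  assumes c: "essentially_bounded c" and f: "schwartz f"
  shows "square_integrable (S_pre c \<tau> f)" "step_op c \<tau> (L2_class f) = L2_class (S_pre c \<tau> f)"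
proof -
  have fm: "f \<in> borel_measurable borel" using f by (intro smooth_borel schwartz_smooth)
  have fs: "square_integrable f" using f by (rule schwartz_square_integrable)
  have eq: "S_pre c \<tau> f = (\<lambda>p. gauss_mean (sqrt \<tau>) f p + \<tau> *\<^sub>R (c p *\<^sub>R f p))"
    by (simp add: S_pre_eq)
  have 1: "square_integrable (gauss_mean (sqrt \<tau>) f)" by (rule gauss_mean_contraction(1)[OF fm fs])
  have 2: "square_integrable (\<lambda>p. c p *\<^sub>R f p)" by (rule mult_L2_class(1)[OF c fs])
  show "square_integrable (S_pre c \<tau> f)"
    unfolding eq by (intro square_integrable_add 1 square_integrable_scaleR 2)
  show "step_op c \<tau> (L2_class f) = L2_class (S_pre c \<tau> f)"
    unfolding eq step_op_def heat_L2_class[OF fm fs] mult_L2_class(2)[OF c fs] L2_class_scaleR[OF 2]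
    by (intro L2_class_add 1 square_integrable_scaleR 2)
qed

lemma is_L2_extension_step_op:
  "essentially_bounded c \<Longrightarrow> is_L2_extension (S_pre c \<tau>) (step_op c \<tau>)"
  unfolding is_L2_extension_def using bounded_clinear_step_op step_op_L2_class by blast

text \<open>
  Two continuous linear operators that agree on test functions agree on a closed subspace
  containing all of them.
\<close>

lemma L2_extension_unique:
  assumes "is_L2_extension S0 A" "is_L2_extension S0 B"
  shows "A = B"
proof -
  interpret A: bounded_linear A using assms(1) by (simp add: is_L2_extension_def bounded_clinear_L2_def)
  interpret B: bounded_linear B using assms(2) by (simp add: is_L2_extension_def bounded_clinear_L2_def)
  have "{u. A u = B u} = UNIV"
  proof (rule test_functions_total)
    show "subspace {u. A u = B u}"
      by (auto simp: subspace_def A.add B.add A.scaleR B.scaleR A.zero B.zero)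
    show "closed {u. A u = B u}"
      by (intro closed_Collect_eq linear_continuous_on A.bounded_linear_axioms B.bounded_linear_axioms)
    show "L2_class f \<in> {u. A u = B u}" if "test_function f" for f
      using assms test_function_imp_schwartz[OF that] by (simp add: is_L2_extension_def)
  qed
  then show ?thesis by (auto simp: fun_eq_iff)
qed

lemma S_op_eq_step_op:
  assumes "essentially_bounded c"
  shows "S_op c \<tau> = step_op c \<tau>"
  unfolding S_op_def
  by (intro the_equality is_L2_extension_step_op assms)
    (rule L2_extension_unique[OF _ is_L2_extension_step_op[OF assms]])

lemma gauss_mean_0: "gauss_mean 0 f = (f :: 'd::finite heis \<Rightarrow> complex)"
proof
  fix p
  interpret prob_space "gauss :: 'd plane measure" by (rule prob_space_gauss)
  show "gauss_mean 0 f p = f p"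
    using prob_space by (simp add: gauss_mean_def horizontal_shift_def)
qed

lemma step_op_0: "step_op c 0 = id"
  by (simp add: step_op_def heat_def gauss_mean_0 borel_rep fun_eq_iff)

section \<open>Consistency with the sub-Laplacian\<close>

text \<open>
  The \<open>k\<close>th derivative at \<open>0\<close> of \<open>t \<mapsto> g (q + t v)\<close> for the partial derivative \<open>g\<close> of \<open>f\<close> given by \<open>bs\<close>.
  Carrying \<open>bs\<close> along makes the statements about it provable by induction on \<open>k\<close>.
\<close>

fun directional :: "nat \<Rightarrow> 'a::euclidean_space list \<Rightarrow> ('a \<Rightarrow> complex) \<Rightarrow> 'a \<Rightarrow> 'a \<Rightarrow> complex" where
  "directional 0 bs f v = iterated_partial bs f"
| "directional (Suc k) bs f v = (\<lambda>q. \<Sum>b\<in>Basis. (v \<bullet> b) *\<^sub>R directional k (b # bs) f v q)"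

lemma iterated_partial_has_derivative:
  assumes f: "smooth f" and bs: "set bs \<subseteq> Basis"
  shows "(iterated_partial bs f has_derivative
    (\<lambda>v. \<Sum>b\<in>Basis. (v \<bullet> b) *\<^sub>R iterated_partial (b # bs) f q)) (at q)"
proof -
  let ?D = "frechet_derivative (iterated_partial bs f) (at q)"
  have D: "(iterated_partial bs f has_derivative ?D) (at q)"
    using smooth_iterated_differentiable[OF f bs] frechet_derivative_works by blast
  then have lin: "linear ?D" by (rule has_derivative_linear)
  have "?D v = (\<Sum>b\<in>Basis. (v \<bullet> b) *\<^sub>R iterated_partial (b # bs) f q)" for v
  proof -
    have "?D v = ?D (\<Sum>b\<in>Basis. (v \<bullet> b) *\<^sub>R b)" by (simp add: euclidean_representation)
    also have "\<dots> = (\<Sum>b\<in>Basis. (v \<bullet> b) *\<^sub>R ?D b)"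
      by (simp add: linear_sum[OF lin] linear_scale[OF lin])
    finally show ?thesis by simp
  qed
  then show ?thesis using D by (metis (no_types, lifting) ext)
qed

lemma directional_has_vector_derivative:
  assumes f: "smooth f" and "set bs \<subseteq> Basis"
  shows "((\<lambda>t. directional k bs f v (p + t *\<^sub>R v)) has_vector_derivative
    directional (Suc k) bs f v (p + t *\<^sub>R v)) (at t within A)"
  using assms(2)
proof (induction k arbitrary: bs)
  case 0
  have "((\<lambda>t. p + t *\<^sub>R v) has_derivative (\<lambda>h. h *\<^sub>R v)) (at t within A)"
    by (auto intro!: derivative_eq_intros)
  from has_derivative_compose[OF this iterated_partial_has_derivative[OF f 0]]
  show ?case
    by (simp add: has_vector_derivative_def scaleR_sum_right)
next
  case (Suc k)
  have "((\<lambda>t. \<Sum>b\<in>Basis. (v \<bullet> b) *\<^sub>R directional k (b # bs) f v (p + t *\<^sub>R v)) has_vector_derivative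
      (\<Sum>b\<in>Basis. (v \<bullet> b) *\<^sub>R directional (Suc k) (b # bs) f v (p + t *\<^sub>R v))) (at t within A)"
    using Suc.prems
    by (intro has_vector_derivative_sum Suc.IH
        bounded_linear.has_vector_derivative[OF bounded_linear_scaleR_right]) auto
  then show ?case by simp
qed

lemma directional_decay:
  assumes f: "schwartz f" and "set bs \<subseteq> Basis"
  shows "\<exists>C\<ge>0. \<forall>v q. norm (directional k bs f v q) \<le> C * norm v ^ k / (1 + norm q) ^ N"
  using assms(2)
proof (induction k arbitrary: bs)
  case 0
  obtain C where "C \<ge> 0" "\<And>x. norm (iterated_partial bs f x) \<le> C / (1 + norm x) ^ N"
    using schwartz_decay[OF f 0] by blast
  then show ?case by auto
next
  case (Suc k)
  have "\<forall>b\<in>Basis. \<exists>C\<ge>0. \<forall>v q. norm (directional k (b # bs) f v q) \<le> C * norm v ^ k / (1 + norm q) ^ N"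
    using Suc by auto
  then obtain C where C: "\<And>b. b \<in> Basis \<Longrightarrow> C b \<ge> 0"
    "\<And>b v q. b \<in> Basis \<Longrightarrow> norm (directional k (b # bs) f v q) \<le> C b * norm v ^ k / (1 + norm q) ^ N"
    by metis
  have "norm (directional (Suc k) bs f v q) \<le> (\<Sum>b\<in>Basis. C b) * norm v ^ Suc k / (1 + norm q) ^ N" for v q
  proof -
    have "norm (directional (Suc k) bs f v q) \<le> (\<Sum>b\<in>Basis. norm v * (C b * norm v ^ k / (1 + norm q) ^ N))"
      unfolding directional.simps
    proof (rule sum_norm_le)
      fix b :: 'a assume b: "b \<in> Basis"
      show "norm ((v \<bullet> b) *\<^sub>R directional k (b # bs) f v q) \<le> norm v * (C b * norm v ^ k / (1 + norm q) ^ N)"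
        using Basis_le_norm[OF b, of v] C(2)[OF b, of v q]
        by (simp only: norm_scaleR) (intro mult_mono, auto)
    qed
    also have "\<dots> = (\<Sum>b\<in>Basis. C b) * norm v ^ Suc k / (1 + norm q) ^ N"
      by (simp add: sum_distrib_left sum_distrib_right sum_divide_distrib mult_ac)
    finally show ?thesis .
  qed
  moreover have "(\<Sum>b\<in>Basis. C b) \<ge> 0" using C(1) by (rule sum_nonneg)
  ultimately show ?case by blast
qed

text \<open>
  The integral form of the remainder; the numerical constant is not optimal.
\<close>

lemma second_order_Taylor_bound:
  assumes f: "smooth f" and r: "r \<ge> 0" and B: "B \<ge> 0"
    and le: "\<And>t. 0 \<le> t \<Longrightarrow> t \<le> r \<Longrightarrow> norm (directional 3 [] f v (p + t *\<^sub>R v)) \<le> B"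
  shows "norm (f (p + r *\<^sub>R v) - f p - r *\<^sub>R directional 1 [] f v p - (r\<^sup>2 / 2) *\<^sub>R directional 2 [] f v p) \<le> r ^ 3 * B"
proof -
  let ?D = "\<lambda>k t. directional k [] f v (p + t *\<^sub>R v)"
  have int: "((\<lambda>t. ((r - t) ^ (3 - 1) / fact (3 - 1)) *\<^sub>R ?D 3 t) has_integral
      ?D 0 r - (\<Sum>i<3. ((r - 0) ^ i / fact i) *\<^sub>R ?D i 0)) {0..r}"
    using directional_has_vector_derivative[OF f, of "[]"] r
    by (intro Taylor_has_integral) auto
  have "norm (?D 0 r - (\<Sum>i<3. ((r - 0) ^ i / fact i) *\<^sub>R ?D i 0)) \<le> (r\<^sup>2 * B) * measure lborel (cbox 0 r)"
  proof (rule has_integral_bound)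
    show "0 \<le> r\<^sup>2 * B" using B by simp
    show "((\<lambda>t. ((r - t) ^ (3 - 1) / fact (3 - 1)) *\<^sub>R ?D 3 t) has_integral
      ?D 0 r - (\<Sum>i<3. ((r - 0) ^ i / fact i) *\<^sub>R ?D i 0)) (cbox 0 r)"
      using int by simp
    fix t assume t: "t \<in> cbox 0 r"
    then have "(r - t)\<^sup>2 \<le> r\<^sup>2" by (intro power_mono) auto
    then have "(r - t)\<^sup>2 / 2 \<le> r\<^sup>2" using zero_le_power2[of r] by linarith
    then show "norm (((r - t) ^ (3 - 1) / fact (3 - 1)) *\<^sub>R ?D 3 t) \<le> r\<^sup>2 * B"
      using le[of t] t by (simp only: norm_scaleR) (intro mult_mono, auto simp: numeral_2_eq_2)
  qed
  also have "(r\<^sup>2 * B) * measure lborel (cbox 0 r) = r ^ 3 * B"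
    using r by (simp add: power3_eq_cube power2_eq_square)
  also have "?D 0 r - (\<Sum>i<3. ((r - 0) ^ i / fact i) *\<^sub>R ?D i 0)
      = f (p + r *\<^sub>R v) - f p - r *\<^sub>R directional 1 [] f v p - (r\<^sup>2 / 2) *\<^sub>R directional 2 [] f v p"
    by (simp add: eval_nat_numeral algebra_simps del: directional.simps(2))
  finally show ?thesis .
qed

text \<open>
  The velocity of the straight line \<open>r \<mapsto> horizontal_shift r p \<zeta>\<close>. At the standard basis vectors \<open>\<zeta>\<close> it
  takes the values of the fields \<open>X\<^sub>i\<close> and \<open>Y\<^sub>i\<close> at \<open>p\<close>.
\<close>

definition horizontal :: "'d::finite heis \<Rightarrow> 'd plane \<Rightarrow> 'd heis" where
  "horizontal p \<zeta> = (\<zeta>, fst p \<bullet>\<^sub>\<sigma> \<zeta>)"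

lemma horizontal_shift_eq: "horizontal_shift r p \<zeta> = p + r *\<^sub>R horizontal p \<zeta>"
  by (simp add: horizontal_shift_def horizontal_def prod_eq_iff)

lemma linear_horizontal: "linear (horizontal p)"
  by (rule linearI) (auto simp: horizontal_def sigma_prod_def inner_add inner_diff algebra_simps)

lemma norm_fst_snd_le: "norm (fst z) \<le> norm z" "norm (snd z) \<le> norm z"
  using norm_fst_le[of "fst z" "snd z"] norm_snd_le[of "snd z" "fst z"] by simp_all

lemma sigma_prod_bound: "\<bar>z \<bullet>\<^sub>\<sigma> \<zeta>\<bar> \<le> 2 * norm z * norm \<zeta>"
proof -
  have "\<bar>z \<bullet>\<^sub>\<sigma> \<zeta>\<bar> \<le> \<bar>fst \<zeta> \<bullet> snd z\<bar> + \<bar>fst z \<bullet> snd \<zeta>\<bar>"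
    unfolding sigma_prod_def by (rule abs_triangle_ineq4)
  also have "\<dots> \<le> norm (fst \<zeta>) * norm (snd z) + norm (fst z) * norm (snd \<zeta>)"
    by (intro add_mono Cauchy_Schwarz_ineq2)
  also have "\<dots> \<le> norm \<zeta> * norm z + norm z * norm \<zeta>"
    by (intro add_mono mult_mono norm_fst_snd_le) auto
  finally show ?thesis by (simp add: mult_ac)
qed

lemma norm_horizontal_le: "norm (horizontal p \<zeta>) \<le> 2 * ((1 + norm p) * norm \<zeta>)"
proof -
  have "norm (horizontal p \<zeta>) \<le> norm \<zeta> + \<bar>fst p \<bullet>\<^sub>\<sigma> \<zeta>\<bar>"
    unfolding horizontal_def using norm_Pair_le[of \<zeta> "fst p \<bullet>\<^sub>\<sigma> \<zeta>"] by simp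
  also have "\<dots> \<le> norm \<zeta> + 2 * norm (fst p) * norm \<zeta>" using sigma_prod_bound by simp
  also have "\<dots> \<le> norm \<zeta> + 2 * norm p * norm \<zeta>"
    by (intro add_left_mono mult_right_mono mult_left_mono norm_fst_snd_le) auto
  also have "\<dots> \<le> 2 * ((1 + norm p) * norm \<zeta>)" by (simp add: algebra_simps)
  finally show ?thesis .
qed

text \<open>
  The weight at \<open>p\<close> is controlled by the weight at a shifted point, up to a factor growing linearly
  in \<open>\<zeta>\<close>. The velocity is constant along the line, since \<open>\<zeta> \<bullet>\<^sub>\<sigma> \<zeta> = 0\<close>, so
  \<open>p\<close> is in turn a shift of the shifted point.
\<close>

lemma weight_horizontal_shift:
  assumes t: "0 \<le> t" "t \<le> 1"
  shows "1 + norm p \<le> 2 * ((1 + norm (p + t *\<^sub>R horizontal p \<zeta>)) * (1 + norm \<zeta>))"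
proof -
  define q where "q = p + t *\<^sub>R horizontal p \<zeta>"
  have "horizontal q \<zeta> = horizontal p \<zeta>"
    by (simp add: q_def horizontal_def sigma_prod_def inner_add inner_commute algebra_simps)
  then have "p = q - t *\<^sub>R horizontal q \<zeta>" by (simp add: q_def)
  then have "norm p \<le> norm q + norm (t *\<^sub>R horizontal q \<zeta>)"
    by (metis norm_triangle_ineq4)
  also have "norm (t *\<^sub>R horizontal q \<zeta>) \<le> 1 * norm (horizontal q \<zeta>)"
    using t by (simp add: mult_left_le_one_le)
  also have "1 * norm (horizontal q \<zeta>) \<le> 2 * ((1 + norm q) * norm \<zeta>)"
    using norm_horizontal_le[of q \<zeta>] by simp
  finally have "norm p \<le> norm q + 2 * ((1 + norm q) * norm \<zeta>)" by simp
  moreover have "2 * ((1 + norm q) * (1 + norm \<zeta>)) = 2 + 2 * norm q + 2 * ((1 + norm q) * norm \<zeta>)"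
    by (simp add: algebra_simps)
  ultimately show ?thesis unfolding q_def[symmetric] using norm_ge_zero[of q] by linarith
qed

text \<open>
  The remainder contains the cube of the velocity, which may grow like \<open>(1 + \<bar>p\<bar>)\<^sup>3 (1 + \<bar>\<zeta>\<bar>)\<^sup>3\<close>. The
  third derivatives are therefore estimated with decay of order \<open>m + 3\<close>, and transferring this
  decay from the shifted point to \<open>p\<close> costs another \<open>m + 3\<close> powers of \<open>1 + \<bar>\<zeta>\<bar>\<close>.
\<close>

lemma Taylor_remainder_decay:
  fixes f :: "'d::finite heis \<Rightarrow> complex"
  assumes f: "schwartz f"
  obtains K where "K \<ge> 0"
    "\<And>r p \<zeta>. 0 \<le> r \<Longrightarrow> r \<le> 1 \<Longrightarrow>
      norm (f (horizontal_shift r p \<zeta>) - f p - r *\<^sub>R directional 1 [] f (horizontal p \<zeta>) p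
        - (r\<^sup>2 / 2) *\<^sub>R directional 2 [] f (horizontal p \<zeta>) p)
      \<le> r ^ 3 * (K / (1 + norm p) ^ DIM('d heis) * (1 + norm \<zeta>) ^ (DIM('d heis) + 6))"
proof -
  define m where "m = DIM('d heis)"
  obtain C where C: "C \<ge> 0"
    "\<And>v q. norm (directional 3 [] f v q) \<le> C * norm v ^ 3 / (1 + norm q) ^ (m + 3)"
    using directional_decay[OF f, of "[]" 3 "m + 3"] by auto
  \<comment> \<open>The factor 8 comes from the cube of the velocity, the power of 2 from the transfer of the weight.\<close>
  define K where "K = C * 8 * 2 ^ (m + 3)"
  have bound: "norm (directional 3 [] f (horizontal p \<zeta>) (p + t *\<^sub>R horizontal p \<zeta>))
      \<le> K / (1 + norm p) ^ m * (1 + norm \<zeta>) ^ (m + 6)"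
    if t: "0 \<le> t" "t \<le> 1" for p \<zeta> t
  proof -
    define q where "q = p + t *\<^sub>R horizontal p \<zeta>"
    define P Z Q where "P = 1 + norm p" and "Z = 1 + norm \<zeta>" and "Q = 1 + norm q"
    have pos: "P > 0" "Z > 0" "Q > 0" by (auto simp: P_def Z_def Q_def add_pos_nonneg)
    have v: "norm (horizontal p \<zeta>) \<le> 2 * (P * Z)"
    proof -
      have "(1 + norm p) * norm \<zeta> \<le> P * Z"
        unfolding P_def Z_def by (rule mult_left_mono) auto
      then show ?thesis using norm_horizontal_le[of p \<zeta>] by linarith
    qed
    have PQ: "P \<le> 2 * (Q * Z)"
      using weight_horizontal_shift[OF t, of p \<zeta>] by (simp add: P_def Q_def Z_def q_def)
    have "norm (directional 3 [] f (horizontal p \<zeta>) q) \<le> C * norm (horizontal p \<zeta>) ^ 3 / Q ^ (m + 3)"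
      using C(2) by (simp add: Q_def)
    also have "\<dots> \<le> C * (2 * (P * Z)) ^ 3 / Q ^ (m + 3)"
      using v C(1) pos by (intro divide_right_mono mult_left_mono power_mono) auto
    also have "\<dots> \<le> C * (2 * (P * Z)) ^ 3 * ((2 * Z) ^ (m + 3) / P ^ (m + 3))"
    proof -
      have "P ^ (m + 3) \<le> (2 * (Q * Z)) ^ (m + 3)" using PQ pos by (intro power_mono) auto
      also have "\<dots> = (2 * Z) ^ (m + 3) * Q ^ (m + 3)" by (simp only: power_mult_distrib mult_ac)
      finally have "P ^ (m + 3) \<le> (2 * Z) ^ (m + 3) * Q ^ (m + 3)" .
      moreover have "1 / b \<le> c / a" if "a \<le> c * b" "a > 0" "b > 0" for a b c :: real
        using that by (simp add: field_simps)
      ultimately have "1 / Q ^ (m + 3) \<le> (2 * Z) ^ (m + 3) / P ^ (m + 3)"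
        using zero_less_power pos by blast
      then have "C * (2 * (P * Z)) ^ 3 * (1 / Q ^ (m + 3)) \<le> C * (2 * (P * Z)) ^ 3 * ((2 * Z) ^ (m + 3) / P ^ (m + 3))"
        using C(1) pos by (intro mult_left_mono) auto
      then show ?thesis by simp
    qed
    also have "\<dots> = K / P ^ m * Z ^ (m + 6)"
      using pos by (simp add: K_def power_mult_distrib power_add field_simps eval_nat_numeral)
    finally show ?thesis by (simp add: q_def P_def Z_def)
  qed
  show thesis
  proof
    show "K \<ge> 0" using C(1) by (simp add: K_def)
    fix r p and \<zeta> :: "'d plane" assume r: "0 \<le> r" "r \<le> (1::real)"
    have "K \<ge> 0" using C(1) by (simp add: K_def)
    then show "norm (f (horizontal_shift r p \<zeta>) - f p - r *\<^sub>R directional 1 [] f (horizontal p \<zeta>) p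
        - (r\<^sup>2 / 2) *\<^sub>R directional 2 [] f (horizontal p \<zeta>) p)
      \<le> r ^ 3 * (K / (1 + norm p) ^ DIM('d heis) * (1 + norm \<zeta>) ^ (DIM('d heis) + 6))"
      unfolding horizontal_shift_eq m_def[symmetric]
      using r by (intro second_order_Taylor_bound schwartz_smooth f bound) auto
  qed
qed

definition hessian :: "('a::euclidean_space \<Rightarrow> complex) \<Rightarrow> 'a \<Rightarrow> 'a \<Rightarrow> 'a \<Rightarrow> complex" where
  "hessian f q u v = (\<Sum>b\<in>Basis. (u \<bullet> b) *\<^sub>R (\<Sum>a\<in>Basis. (v \<bullet> a) *\<^sub>R iterated_partial [a, b] f q))"

lemma directional_1: "directional 1 [] f v q = (\<Sum>b\<in>Basis. (v \<bullet> b) *\<^sub>R iterated_partial [b] f q)"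
  by simp

lemma directional_2: "directional 2 [] f v q = hessian f q v v"
  by (simp add: numeral_2_eq_2 hessian_def)

lemma horizontal_coordinates:
  "horizontal p \<zeta> = (\<Sum>e\<in>Basis. (\<zeta> \<bullet> e) *\<^sub>R horizontal p e)"
proof -
  have "horizontal p \<zeta> = horizontal p (\<Sum>e\<in>Basis. (\<zeta> \<bullet> e) *\<^sub>R e)"
    by (simp only: euclidean_representation)
  then show ?thesis
    by (simp add: linear_sum[OF linear_horizontal] linear_scale[OF linear_horizontal])
qed

lemma bilinear_hessian: "bilinear (hessian f q)"
  unfolding bilinear_def
proof (intro conjI allI)
  show "linear (hessian f q u)" for u
    by (rule linearI) (simp_all add: hessian_def inner_add_left scaleR_add_left sum.distrib scaleR_add_right
        scaleR_sum_right mult_ac)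
  show "linear (\<lambda>u. hessian f q u v)" for v
    by (rule linearI) (simp_all add: hessian_def inner_add_left scaleR_add_left sum.distrib scaleR_add_right
        scaleR_sum_right mult_ac distrib_left distrib_right)
qed

lemma gauss_mean_first_order:
  fixes f :: "'d::finite heis \<Rightarrow> complex"
  shows "integrable gauss (\<lambda>\<zeta>. directional 1 [] f (horizontal p \<zeta>) p)"
    "(LINT \<zeta>|gauss. directional 1 [] f (horizontal p \<zeta>) p) = 0"
proof -
  let ?c = "\<lambda>e. \<Sum>b\<in>Basis. (horizontal p e \<bullet> b) *\<^sub>R iterated_partial [b] f p"
  have eq: "directional 1 [] f (horizontal p \<zeta>) p = (\<Sum>e\<in>Basis. (\<zeta> \<bullet> e) *\<^sub>R ?c e)" for \<zeta>
  proof -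
    have "directional 1 [] f (horizontal p \<zeta>) p
        = (\<Sum>b\<in>Basis. \<Sum>e\<in>Basis. (\<zeta> \<bullet> e) *\<^sub>R ((horizontal p e \<bullet> b) *\<^sub>R iterated_partial [b] f p))"
      unfolding directional_1 by (subst horizontal_coordinates) (simp add: inner_sum_left scaleR_sum_left)
    also have "\<dots> = (\<Sum>e\<in>Basis. \<Sum>b\<in>Basis. (\<zeta> \<bullet> e) *\<^sub>R ((horizontal p e \<bullet> b) *\<^sub>R iterated_partial [b] f p))"
      by (rule sum.swap)
    finally show ?thesis by (simp only: scaleR_sum_right)
  qed
  show "integrable gauss (\<lambda>\<zeta>. directional 1 [] f (horizontal p \<zeta>) p)"
    unfolding eq by (intro Bochner_Integration.integrable_sum integrable_scaleR_left gauss_first_moment)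
  show "(LINT \<zeta>|gauss. directional 1 [] f (horizontal p \<zeta>) p) = 0"
    unfolding eq
    by (subst Bochner_Integration.integral_sum)
      (auto intro!: integrable_scaleR_left gauss_first_moment sum.neutral simp: gauss_first_moment)
qed

text \<open>
  Only the diagonal terms survive, because the coordinates of \<open>\<zeta>\<close> are uncorrelated with unit variance.
\<close>

lemma gauss_mean_second_order:
  fixes f :: "'d::finite heis \<Rightarrow> complex"
  shows "integrable gauss (\<lambda>\<zeta>. directional 2 [] f (horizontal p \<zeta>) p)"
    "(LINT \<zeta>|gauss. directional 2 [] f (horizontal p \<zeta>) p)
      = (\<Sum>e\<in>Basis. hessian f p (horizontal p e) (horizontal p e))"
proof -
  let ?c = "\<lambda>e e'. hessian f p (horizontal p e) (horizontal p e')"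
  have eq: "directional 2 [] f (horizontal p \<zeta>) p = (\<Sum>(e, e')\<in>Basis \<times> Basis. ((\<zeta> \<bullet> e) * (\<zeta> \<bullet> e')) *\<^sub>R ?c e e')" for \<zeta>
    unfolding directional_2
    by (subst (1 2) horizontal_coordinates)
      (simp add: bilinear_sum[OF bilinear_hessian] bilinear_lmul[OF bilinear_hessian]
        bilinear_rmul[OF bilinear_hessian] split_beta mult.commute)
  have int: "integrable gauss (\<lambda>\<zeta>. ((\<zeta> \<bullet> e) * (\<zeta> \<bullet> e')) *\<^sub>R ?c e e')" if "e \<in> Basis" "e' \<in> Basis" for e e'
    using that by (intro integrable_scaleR_left gauss_second_moment)
  show "integrable gauss (\<lambda>\<zeta>. directional 2 [] f (horizontal p \<zeta>) p)"
    unfolding eq by (intro Bochner_Integration.integrable_sum) (auto intro: int)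
  have "(LINT \<zeta>|gauss. directional 2 [] f (horizontal p \<zeta>) p)
      = (\<Sum>(e, e')\<in>Basis \<times> Basis. LINT \<zeta>|gauss. ((\<zeta> \<bullet> e) * (\<zeta> \<bullet> e')) *\<^sub>R ?c e e')"
    unfolding eq by (subst Bochner_Integration.integral_sum) (auto intro: int simp: split_beta)
  also have "\<dots> = (\<Sum>(e, e')\<in>Basis \<times> Basis. (if e = e' then ?c e e' else 0))"
    by (intro sum.cong) (auto simp: gauss_second_moment)
  also have "\<dots> = (\<Sum>e\<in>Basis. ?c e e)"
    by (simp add: sum.cartesian_product[symmetric])
  finally show "(LINT \<zeta>|gauss. directional 2 [] f (horizontal p \<zeta>) p) = (\<Sum>e\<in>Basis. ?c e e)" .
qed

text \<open>
  Treats the fields \<open>X\<^sub>i\<close> and \<open>Y\<^sub>i\<close> simultaneously, as the fields attached to the basis vectors \<open>e\<close> of the plane.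
\<close>

definition horizontal_derivative :: "'d::finite plane \<Rightarrow> ('d heis \<Rightarrow> complex) \<Rightarrow> 'd heis \<Rightarrow> complex" where
  "horizontal_derivative e f q = frechet_derivative f (at q) (horizontal q e)"

lemma X_field_eq:
  assumes "f differentiable (at q)"
  shows "X_field i f q = horizontal_derivative (axis i 1, 0) f q"
proof -
  have lin: "linear (frechet_derivative f (at q))"
    using assms by (rule linear_frechet_derivative)
  have "horizontal q (axis i 1, 0) = ((axis i 1, 0), 0) + (snd (fst q) $ i) *\<^sub>R ((0, 0), 1)"
    by (simp add: horizontal_def sigma_prod_def inner_axis inner_axis' prod_eq_iff)
  then show ?thesis
    by (simp only: horizontal_derivative_def X_field_def partial_x_def partial_s_def
        linear_add[OF lin] linear_scale[OF lin])
qed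

lemma Y_field_eq:
  assumes "f differentiable (at q)"
  shows "Y_field i f q = horizontal_derivative (0, axis i 1) f q"
proof -
  have lin: "linear (frechet_derivative f (at q))"
    using assms by (rule linear_frechet_derivative)
  have "horizontal q (0, axis i 1) = ((0, axis i 1), 0) + (- fst (fst q) $ i) *\<^sub>R ((0, 0), 1)"
    by (simp add: horizontal_def sigma_prod_def inner_axis prod_eq_iff)
  then show ?thesis
    by (simp only: horizontal_derivative_def Y_field_def partial_y_def partial_s_def
        linear_add[OF lin] linear_scale[OF lin]) simp
qed

text \<open>
  Although the coefficients of the field vary with \<open>q\<close>, differentiating them along the field itself
  gives \<open>e \<bullet>\<^sub>\<sigma> e = 0\<close>, so only second derivatives of \<open>f\<close> remain.
\<close>

lemma horizontal_derivative_twice: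
  fixes f :: "'d::finite heis \<Rightarrow> complex"
  assumes f: "smooth f"
  shows "horizontal_derivative e f differentiable (at q)"
    "horizontal_derivative e (horizontal_derivative e f) q = hessian f q (horizontal q e) (horizontal q e)"
proof -
  have first: "horizontal_derivative e f = (\<lambda>q. \<Sum>b\<in>Basis. (horizontal q e \<bullet> b) *\<^sub>R iterated_partial [b] f q)"
  proof
    fix q
    show "horizontal_derivative e f q = (\<Sum>b\<in>Basis. (horizontal q e \<bullet> b) *\<^sub>R iterated_partial [b] f q)"
      using fun_cong[OF frechet_derivative_at[OF iterated_partial_has_derivative[OF f, of "[]" q]], of "horizontal q e"]
      by (simp add: horizontal_derivative_def)
  qed
  have hor: "((\<lambda>q. horizontal q e) has_derivative (\<lambda>h. (0, fst h \<bullet>\<^sub>\<sigma> e))) (at q)"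
    unfolding horizontal_def sigma_prod_def
    by (auto intro!: derivative_eq_intros)
  have "(horizontal_derivative e f has_derivative (\<lambda>h. \<Sum>b\<in>Basis.
      (horizontal q e \<bullet> b) *\<^sub>R (\<Sum>a\<in>Basis. (h \<bullet> a) *\<^sub>R iterated_partial [a, b] f q)
      + ((0, fst h \<bullet>\<^sub>\<sigma> e) \<bullet> b) *\<^sub>R iterated_partial [b] f q)) (at q)"
    unfolding first
  proof (intro has_derivative_sum has_derivative_scaleR)
    fix b :: "'d heis" assume b: "b \<in> Basis"
    show "((\<lambda>q. horizontal q e \<bullet> b) has_derivative (\<lambda>h. (0, fst h \<bullet>\<^sub>\<sigma> e) \<bullet> b)) (at q)"
      using hor by (rule has_derivative_inner_left)
    show "(iterated_partial [b] f has_derivative (\<lambda>h. \<Sum>a\<in>Basis. (h \<bullet> a) *\<^sub>R iterated_partial [a, b] f q)) (at q)"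
      using b by (intro iterated_partial_has_derivative f) auto
  qed
  note D = this
  then show "horizontal_derivative e f differentiable (at q)" by (auto simp: differentiable_def)
  have "(fst (horizontal q e) \<bullet>\<^sub>\<sigma> e) = 0"
    by (simp add: horizontal_def sigma_prod_def)
  then show "horizontal_derivative e (horizontal_derivative e f) q = hessian f q (horizontal q e) (horizontal q e)"
    unfolding horizontal_derivative_def[of e "horizontal_derivative e f"]
    using fun_cong[OF frechet_derivative_at[OF D], of "horizontal q e"]
    by (simp add: hessian_def zero_prod_def[symmetric])
qed

lemma sum_Basis_vec: "(\<Sum>u\<in>(Basis :: (real ^ 'd::finite) set). g u) = (\<Sum>i\<in>UNIV. g (axis i 1))"
proof -
  have "(Basis :: (real ^ 'd) set) = (\<lambda>i. axis i 1) ` UNIV"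
    by (auto simp: Basis_vec_def)
  then have "(\<Sum>u\<in>(Basis :: (real ^ 'd) set). g u) = (\<Sum>u\<in>(\<lambda>i. axis i 1) ` UNIV. g u)" by (simp only:)
  also have "\<dots> = (\<Sum>i\<in>UNIV. g (axis i 1))"
    by (subst sum.reindex) (auto simp: inj_on_def axis_eq_axis)
  finally show ?thesis .
qed

lemma sum_Basis_plane:
  "(\<Sum>e\<in>(Basis :: 'd::finite plane set). g e) = (\<Sum>i\<in>UNIV. g (axis i 1, 0) + g (0, axis i 1))"
proof -
  have "(\<Sum>e\<in>(Basis :: 'd plane set). g e) = (\<Sum>u\<in>Basis. g (u, 0)) + (\<Sum>v\<in>Basis. g (0, v))"
    unfolding Basis_prod_def
    by (subst sum.union_disjoint) (auto simp: sum.reindex inj_on_def)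
  then show ?thesis by (simp add: sum_Basis_vec sum.distrib)
qed

lemma sublaplacian_eq:
  fixes f :: "'d::finite heis \<Rightarrow> complex"
  assumes f: "smooth f"
  shows "sublaplacian f p = (\<Sum>e\<in>Basis. hessian f p (horizontal p e) (horizontal p e))"
proof -
  have d: "f differentiable (at q)" for q
    using smooth_iterated_differentiable[OF f, of "[]"] by simp
  have X: "X_field i f = horizontal_derivative (axis i 1, 0) f"
    and Y: "Y_field i f = horizontal_derivative (0, axis i 1) f" for i
    using X_field_eq[OF d] Y_field_eq[OF d] by auto
  show ?thesis
    unfolding sublaplacian_def sum_Basis_plane X Y
    by (simp only: X_field_eq[OF horizontal_derivative_twice(1)[OF f]] Y_field_eq[OF horizontal_derivative_twice(1)[OF f]]
        horizontal_derivative_twice(2)[OF f])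
qed

text \<open>
  Taylor's formula integrated against the Gaussian, with a pointwise bound of the remainder that is
  square-integrable in \<open>p\<close>.
\<close>

lemma gauss_mean_expansion:
  fixes f :: "'d::finite heis \<Rightarrow> complex"
  assumes f: "schwartz f"
  obtains C where "C \<ge> 0"
    "\<And>r p. 0 \<le> r \<Longrightarrow> r \<le> 1 \<Longrightarrow>
      norm (gauss_mean r f p - f p - (r\<^sup>2 / 2) *\<^sub>R sublaplacian f p) \<le> r ^ 3 * C / (1 + norm p) ^ DIM('d heis)"
proof -
  interpret prob_space "gauss :: 'd plane measure" by (rule prob_space_gauss)
  let ?m = "DIM('d heis)"
  let ?R = "\<lambda>r p \<zeta>. f (horizontal_shift r p \<zeta>) - f p - r *\<^sub>R directional 1 [] f (horizontal p \<zeta>) p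
        - (r\<^sup>2 / 2) *\<^sub>R directional 2 [] f (horizontal p \<zeta>) p"
  let ?w = "\<lambda>\<zeta>::'d plane. (1 + norm \<zeta>) ^ (?m + 6)"
  obtain K where K: "K \<ge> 0"
    "\<And>r p \<zeta>. 0 \<le> r \<Longrightarrow> r \<le> 1 \<Longrightarrow> norm (?R r p \<zeta>) \<le> r ^ 3 * (K / (1 + norm p) ^ ?m * ?w \<zeta>)"
    using Taylor_remainder_decay[OF f] by blast
  define C where "C = K * (LINT \<zeta>|gauss. ?w \<zeta>)"
  have fb: "f \<in> borel_measurable borel" using f by (intro smooth_borel schwartz_smooth)
  have "set [] \<subseteq> (Basis :: 'd heis set)" by simp
  then obtain B where "B \<ge> 0" and B: "\<And>x. norm (iterated_partial [] f x) \<le> B / (1 + norm x) ^ 0"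
    by (rule schwartz_decay[OF f, where k = 0]) blast
  have "norm (gauss_mean r f p - f p - (r\<^sup>2 / 2) *\<^sub>R sublaplacian f p) \<le> r ^ 3 * C / (1 + norm p) ^ ?m"
    if r: "0 \<le> r" "r \<le> 1" for r p
  proof -
    have int0: "integrable gauss (\<lambda>\<zeta>. f (horizontal_shift r p \<zeta>))"
      using B by (intro integrable_const_bound[where B = B] AE_I2
          shift_measurable_gauss fb schwartz_square_integrable f) simp
    note int1 = gauss_mean_first_order[of f p] and int2 = gauss_mean_second_order[of f p]
    have "(LINT \<zeta>|gauss. ?R r p \<zeta>) = gauss_mean r f p - f p - (r\<^sup>2 / 2) *\<^sub>R sublaplacian f p"
      using int0 int1 int2 prob_space
      by (simp add: gauss_mean_def sublaplacian_eq[OF schwartz_smooth[OF f]] del: directional.simps One_nat_def)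
    moreover have "norm (LINT \<zeta>|gauss. ?R r p \<zeta>) \<le> (LINT \<zeta>|gauss. r ^ 3 * (K / (1 + norm p) ^ ?m * ?w \<zeta>))"
      by (intro Bochner_Integration.integral_norm_bound_integral Bochner_Integration.integrable_diff int0 integrable_scaleR_right
          int1(1) int2(1) integrable_mult_right gauss_polynomial_moment integrable_const K(2) r)
    moreover have "(LINT \<zeta>|gauss. r ^ 3 * (K / (1 + norm p) ^ ?m * ?w \<zeta>)) = r ^ 3 * C / (1 + norm p) ^ ?m"
      by (simp add: C_def)
    ultimately show ?thesis by (simp only:)
  qed
  moreover have "C \<ge> 0" using K(1) by (simp add: C_def)
  ultimately show thesis using that by blast
qed

lemma sublaplacian_borel:
  fixes f :: "'d::finite heis \<Rightarrow> complex"
  assumes f: "smooth f"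
  shows "sublaplacian f \<in> borel_measurable borel"
proof -
  have "continuous_on UNIV (\<lambda>p. \<Sum>e\<in>Basis. hessian f p (horizontal p e) (horizontal p e))"
    unfolding hessian_def horizontal_def sigma_prod_def
    by (intro continuous_intros smooth_iterated_continuous f) auto
  then show ?thesis
    using borel_measurable_continuous_onI by (simp add: sublaplacian_eq[OF f, abs_def])
qed

text \<open>
  The expansion at \<open>r = 1\<close> shows that the sub-Laplacian of \<open>f\<close> is square-integrable; the expansion at
  \<open>r = \<surd>h\<close>, divided by \<open>h\<close>, leaves an error of order \<open>\<surd>h\<close>.
\<close>

lemma heat_consistency:
  fixes f :: "'d::finite heis \<Rightarrow> complex"
  assumes f: "schwartz f"
  obtains C where "square_integrable (sublaplacian f)"
    "\<And>h. 0 < h \<Longrightarrow> h \<le> 1 \<Longrightarrow>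
      norm ((heat (sqrt h) (L2_class f) - L2_class f) /\<^sub>R h - (1/2) *\<^sub>R L2_class (sublaplacian f)) \<le> sqrt h * C"
proof -
  let ?R = "\<lambda>r p. gauss_mean r f p - f p - (r\<^sup>2 / 2) *\<^sub>R sublaplacian f p"
  let ?W = "weight_norm TYPE('d heis)"
  obtain C where C: "C \<ge> 0"
    "\<And>r p. 0 \<le> r \<Longrightarrow> r \<le> 1 \<Longrightarrow> norm (?R r p) \<le> r ^ 3 * C / (1 + norm p) ^ DIM('d heis)"
    using gauss_mean_expansion[OF f] by blast
  have fb[measurable]: "f \<in> borel_measurable borel" using f by (intro smooth_borel schwartz_smooth)
  have fs: "square_integrable f" using f by (rule schwartz_square_integrable)
  have gs: "square_integrable (gauss_mean r f)" for r by (rule gauss_mean_contraction(1)[OF fb fs])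
  have [measurable]: "sublaplacian f \<in> borel_measurable borel"
    using f by (intro sublaplacian_borel schwartz_smooth)
  have R_meas: "?R r \<in> borel_measurable lebesgue" for r
    by (intro borel_imp_lebesgue_measurable) measurable
  have R_sq: "square_integrable (?R r)" and R_norm: "norm (L2_class (?R r)) \<le> r ^ 3 * C * ?W"
    if "0 \<le> r" "r \<le> 1" for r
    using that C weighted_bound[OF R_meas, of "r ^ 3 * C" r] by auto
  have "square_integrable (\<lambda>p. 2 * (gauss_mean 1 f p - f p - ?R 1 p))"
    by (intro square_integrable_mult square_integrable_diff gs fs R_sq) auto
  then have sub: "square_integrable (sublaplacian f)" by (simp add: scaleR_conv_of_real)
  have "norm ((heat (sqrt h) (L2_class f) - L2_class f) /\<^sub>R h - (1/2) *\<^sub>R L2_class (sublaplacian f)) \<le> sqrt h * (C * ?W)"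
    if h: "0 < h" "h \<le> 1" for h
  proof -
    have "L2_class (?R (sqrt h)) = heat (sqrt h) (L2_class f) - L2_class f - (h / 2) *\<^sub>R L2_class (sublaplacian f)"
      using h by (simp add: heat_L2_class[OF fb fs] L2_class_diff L2_class_scaleR gs fs sub square_integrable_diff
          square_integrable_scaleR)
    then have "(heat (sqrt h) (L2_class f) - L2_class f) /\<^sub>R h - (1/2) *\<^sub>R L2_class (sublaplacian f)
        = (1 / h) *\<^sub>R L2_class (?R (sqrt h))"
      using h by (simp add: scaleR_diff_right inverse_eq_divide)
    then have "norm ((heat (sqrt h) (L2_class f) - L2_class f) /\<^sub>R h - (1/2) *\<^sub>R L2_class (sublaplacian f))
        = norm (L2_class (?R (sqrt h))) / h"
      using h by simp
    also have "\<dots> \<le> (sqrt h ^ 3 * C * ?W) / h"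
      using h R_norm[of "sqrt h"] by (intro divide_right_mono) auto
    also have "sqrt h ^ 3 = h * sqrt h" using h by (simp add: power3_eq_cube)
    also have "h * sqrt h * C * ?W / h = sqrt h * (C * ?W)" using h by simp
    finally show ?thesis .
  qed
  with sub show thesis by (rule that)
qed

section \<open>Convergence of the iterates\<close>

lemma step_op_difference_limit:
  fixes f :: "'d::finite heis \<Rightarrow> complex"
  assumes c: "essentially_bounded c" and f: "test_function f"
  shows "difference_limit (step_op c) (L2_class f)
    ((1/2) *\<^sub>R L2_class (sublaplacian f) + mult_L2 c (L2_class f))"
proof -
  let ?u = "L2_class f" and ?v = "(1/2) *\<^sub>R L2_class (sublaplacian f)"
  obtain C where C: "\<And>h. 0 < h \<Longrightarrow> h \<le> 1 \<Longrightarrow> norm ((heat (sqrt h) ?u - ?u) /\<^sub>R h - ?v) \<le> sqrt h * C"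
    using heat_consistency[OF test_function_imp_schwartz[OF f]] by metis
  have "((\<lambda>h. (step_op c h ?u - ?u) /\<^sub>R h - (?v + mult_L2 c ?u)) \<longlongrightarrow> 0) (at_right 0)"
  proof (rule Lim_null_comparison)
    have "norm ((step_op c h ?u - ?u) /\<^sub>R h - (?v + mult_L2 c ?u)) \<le> sqrt h * C" if h: "0 < h" "h < 1" for h
    proof -
      have "(step_op c h ?u - ?u) /\<^sub>R h - (?v + mult_L2 c ?u) = (heat (sqrt h) ?u - ?u) /\<^sub>R h - ?v"
        using h by (simp add: step_op_def algebra_simps)
      then show ?thesis using C[OF h(1) less_imp_le[OF h(2)]] by (simp only:)
    qed
    then show "\<forall>\<^sub>F h in at_right 0. norm ((step_op c h ?u - ?u) /\<^sub>R h - (?v + mult_L2 c ?u)) \<le> sqrt h * C"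
      unfolding eventually_at_right_field by (intro exI[of _ 1]) auto
    have "((\<lambda>h. sqrt h * C) \<longlongrightarrow> sqrt 0 * C) (at_right 0)" by (intro tendsto_intros)
    then show "((\<lambda>h. sqrt h * C) \<longlongrightarrow> 0) (at_right 0)" by simp
  qed
  then show ?thesis unfolding difference_limit_def by (rule LIM_zero_cancel)
qed

lemma step_op_bound:
  assumes c: "essentially_bounded c"
  obtains C where "C \<ge> 0" "\<And>h u. h \<ge> 0 \<Longrightarrow> norm (step_op c h u) \<le> (1 + C * h) * norm u"
proof -
  obtain C where C: "C \<ge> 0" "\<And>u. norm (mult_L2 c u) \<le> C * norm u"
    using mult_L2_bounded[OF c] by metis
  have "norm (step_op c h u) \<le> (1 + C * h) * norm u" if "h \<ge> 0" for h u
  proof -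
    have "norm (step_op c h u) \<le> norm u + h * (C * norm u)"
      unfolding step_op_def using that C
      by (intro norm_triangle_mono heat_contraction) (simp add: mult_left_mono)
    then show ?thesis by (simp add: algebra_simps)
  qed
  with C(1) show thesis by (rule that)
qed

text \<open>
  The graph of \<open>L/2 + c\<close> is the image of the graph of \<open>L\<close> under a continuous map, because \<open>c\<close> is bounded, and
  that graph is by definition the closure of its restriction to test functions.
\<close>

lemma Lc_graph_subset_closure:
  fixes c :: "'d::finite heis \<Rightarrow> real"
  assumes c: "essentially_bounded c"
  shows "Lc_graph c \<subseteq> closure {(w, w'). difference_limit (step_op c) w w'}"
proof -
  let ?\<Phi> = "\<lambda>z. (fst z, (1/2) *\<^sub>R snd z + mult_L2 c (fst z))"
  have "continuous_on UNIV (mult_L2 c)"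
    by (rule linear_continuous_on[OF bounded_linear_mult_L2[OF c]])
  then have "continuous_on UNIV (\<lambda>z. mult_L2 c (fst z))" by (rule continuous_on_compose2) (auto intro: continuous_intros)
  then have "continuous_on UNIV ?\<Phi>" by (intro continuous_intros)
  then have "?\<Phi> ` closure L0_graph \<subseteq> closure {(w, w'). difference_limit (step_op c) w w'}"
  proof (intro image_closure_subset)
    have "?\<Phi> ` L0_graph \<subseteq> {(w, w'). difference_limit (step_op c) w w'}"
      using step_op_difference_limit[OF c] by (auto simp: L0_graph_def)
    then show "?\<Phi> ` L0_graph \<subseteq> closure {(w, w'). difference_limit (step_op c) w w'}"
      by (rule subset_trans[OF _ closure_subset])
  qed (auto intro: continuous_on_subset)
  then show ?thesis by (force simp: Lc_graph_def L_graph_def)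
qed

lemma Lc_graph_test_function:
  assumes "test_function f"
  shows "(L2_class f, (1/2) *\<^sub>R L2_class (sublaplacian f) + mult_L2 c (L2_class f)) \<in> Lc_graph c"
proof -
  have "(L2_class f, L2_class (sublaplacian f)) \<in> L0_graph"
    unfolding L0_graph_def using assms by blast
  then have "(L2_class f, L2_class (sublaplacian f)) \<in> L_graph"
    unfolding L_graph_def by (rule subsetD[OF closure_subset])
  then show ?thesis unfolding Lc_graph_def by blast
qed

lemma subspace_closure:
  fixes V :: "'a::real_normed_vector set"
  assumes V: "subspace V"
  shows "subspace (closure V)"
  unfolding subspace_def
proof (intro conjI ballI allI)
  show "0 \<in> closure V" using subspace_0[OF V] by (rule subsetD[OF closure_subset])
  fix x assume "x \<in> closure V"
  then obtain f where f: "\<And>n. f n \<in> V" "f \<longlonglongrightarrow> x" unfolding closure_sequential by blast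
  show "a *\<^sub>R x \<in> closure V" for a
    unfolding closure_sequential
    by (intro exI[of _ "\<lambda>n. a *\<^sub>R f n"] conjI allI subspace_scale[OF V] f tendsto_intros)
  fix y assume "y \<in> closure V"
  then obtain g where g: "\<And>n. g n \<in> V" "g \<longlonglongrightarrow> y" unfolding closure_sequential by blast
  show "x + y \<in> closure V"
    unfolding closure_sequential
    by (intro exI[of _ "\<lambda>n. f n + g n"] conjI allI subspace_add[OF V] f g tendsto_intros)
qed

lemma subspace_generator_domain:
  assumes lin: "\<And>t. t \<ge> 0 \<Longrightarrow> linear (T t)"
  shows "subspace {u. \<exists>v. difference_limit T u v}"
proof -
  have comb: "difference_limit T (a *\<^sub>R u + u') (a *\<^sub>R v + v')"
    if "difference_limit T u v" "difference_limit T u' v'" for a u v u' v'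
  proof -
    have "((\<lambda>h. a *\<^sub>R ((T h u - u) /\<^sub>R h) + (T h u' - u') /\<^sub>R h) \<longlongrightarrow> a *\<^sub>R v + v') (at_right 0)"
      using that unfolding difference_limit_def by (intro tendsto_intros)
    moreover have "a *\<^sub>R ((T h u - u) /\<^sub>R h) + (T h u' - u') /\<^sub>R h
        = (T h (a *\<^sub>R u + u') - (a *\<^sub>R u + u')) /\<^sub>R h" if "h > 0" for h
      using linear_add[OF lin, of h] linear_scale[OF lin, of h] that by (simp add: algebra_simps)
    ultimately show ?thesis
      unfolding difference_limit_def
      by (elim Lim_transform_eventually) (auto simp: eventually_at_right_field intro: exI[of _ 1])
  qed
  have zero: "difference_limit T 0 0"
    unfolding difference_limit_def
    by (rule tendsto_eventually)
      (auto simp: eventually_at_right_field linear_0[OF lin] intro!: exI[of _ 1])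
  show ?thesis
    unfolding subspace_def
  proof (intro conjI ballI allI)
    show "0 \<in> {u. \<exists>v. difference_limit T u v}" using zero by blast
    show "x + y \<in> {u. \<exists>v. difference_limit T u v}"
      if xy: "x \<in> {u. \<exists>v. difference_limit T u v}" "y \<in> {u. \<exists>v. difference_limit T u v}" for x y
    proof -
      obtain v w where "difference_limit T x v" "difference_limit T y w" using xy by blast
      from comb[OF this, of 1] show ?thesis by auto
    qed
    show "a *\<^sub>R x \<in> {u. \<exists>v. difference_limit T u v}"
      if xy: "x \<in> {u. \<exists>v. difference_limit T u v}" for a x
    proof -
      obtain v where "difference_limit T x v" using xy by blast
      from comb[OF this zero, of a] show ?thesis by auto
    qed
  qed
qed

theorem proposition3:
  fixes c :: "'d::finite heis \<Rightarrow> real"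
  assumes "essentially_bounded c"
  shows "(\<forall>\<tau>\<ge>0. \<exists>!S. is_L2_extension (S_pre c \<tau>) S) \<and>
    (\<forall>T. strongly_continuous_semigroup T \<and> generator T = Lc_graph c \<longrightarrow>
      (\<forall>\<psi>. \<forall>\<tau>\<^sub>0>0.
         (\<lambda>n. SUP \<tau>\<in>{0..\<tau>\<^sub>0}. ereal (norm ((S_op c (\<tau> / real n) ^^ n) \<psi> - T \<tau> \<psi>)))
           \<longlonglongrightarrow> 0))"
proof (intro conjI allI impI)
  fix \<tau> :: real
  show "\<exists>!S. is_L2_extension (S_pre c \<tau>) S"
    using is_L2_extension_step_op[OF assms] L2_extension_unique by blast
next
  fix T :: "real \<Rightarrow> 'd heis L2 \<Rightarrow> 'd heis L2" and \<psi> and \<tau>\<^sub>0 :: real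
  assume "strongly_continuous_semigroup T \<and> generator T = Lc_graph c" and \<tau>0: "\<tau>\<^sub>0 > 0"
  then have T: "strongly_continuous_semigroup T" and gen: "generator T = Lc_graph c" by auto
  have gen_iff: "difference_limit T u v \<longleftrightarrow> (u, v) \<in> Lc_graph c" for u v
    unfolding gen[symmetric] by (simp add: generator_def difference_limit_def)
  have T_lin: "bounded_linear (T t)" if "t \<ge> 0" for t
    using T that by (auto simp: strongly_continuous_semigroup_def bounded_clinear_L2_def)
  obtain C where C: "C \<ge> 0" "\<And>h u. h \<ge> 0 \<Longrightarrow> norm (step_op c h u) \<le> (1 + C * h) * norm u"
    using step_op_bound[OF assms] by blast
  have "chernoff (step_op c) T C"
  proof (rule chernoff.intro)
    show "bounded_linear (step_op c h)" for h
      using bounded_clinear_step_op[OF assms] by (simp add: bounded_clinear_L2_def)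
    show "T (s + t) = T s \<circ> T t"
      if "s \<ge> 0" "t \<ge> 0" for s t
      using T that by (auto simp: strongly_continuous_semigroup_def)
    show "T 0 = id" "((\<lambda>t. T t u) \<longlongrightarrow> u) (at_right 0)" for u
      using T by (auto simp: strongly_continuous_semigroup_def)
    show "(u, v) \<in> closure {(w, w'). difference_limit (step_op c) w w'}" if "difference_limit T u v" for u v
      using that Lc_graph_subset_closure[OF assms] by (auto simp: gen_iff)
    show "closure {u. \<exists>v. difference_limit T u v} = UNIV"
    proof (rule test_functions_total)
      show "subspace (closure {u. \<exists>v. difference_limit T u v})"
        using T_lin by (intro subspace_closure subspace_generator_domain) (simp add: bounded_linear.linear)
      fix f :: "'d heis \<Rightarrow> complex" assume "test_function f"
      then have "L2_class f \<in> {u. \<exists>v. difference_limit T u v}"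
        using Lc_graph_test_function[of f c] by (auto simp: gen_iff)
      then show "L2_class f \<in> closure {u. \<exists>v. difference_limit T u v}"
        by (rule subsetD[OF closure_subset])
    qed simp
  qed (use C step_op_0 T_lin in auto)
  then interpret chernoff "step_op c" T C .
  let ?s = "\<lambda>n. SUP \<tau>\<in>{0..\<tau>\<^sub>0}. ereal (norm ((S_op c (\<tau> / real n) ^^ n) \<psi> - T \<tau> \<psi>))"
  show "?s \<longlonglongrightarrow> 0"
  proof (rule order_tendstoI)
    fix a :: ereal assume a: "a < 0"
    \<comment> \<open>The interval of times is nonempty, so the supremum is not the bottom element of ereal.\<close>
    have nonneg: "0 \<le> ?s n" for n
    proof (rule SUP_upper2)
      show "0 \<in> {0..\<tau>\<^sub>0}" using \<tau>0 by simp
    qed simp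
    show "\<forall>\<^sub>F n in sequentially. a < ?s n"
      by (intro always_eventually allI less_le_trans[OF a nonneg])
  next
    fix a :: ereal assume "0 < a"
    then obtain e where e: "0 < ereal e" "ereal e < a" using ereal_dense2 by blast
    then have "e > 0" by simp
    from product_formula[OF \<tau>0 this, of \<psi>] show "\<forall>\<^sub>F n in sequentially. ?s n < a"
    proof eventually_elim
      case (elim n)
      have "?s n \<le> ereal e"
        using elim by (intro SUP_least) (simp add: S_op_eq_step_op[OF assms])
      then show ?case using e(2) by (rule le_less_trans)
    qed
  qed
qed

end
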